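(* Let $q\in\Bbbk^\times$ with $q\ne\pm1$. Let $B(G,\underline g,\underline\chi)$ be a bosonization of a quantum linear space of rank $\theta$ with $m_i\ne2$ for all $i$. Suppose $B(G,\underline g,\underline\chi)$ acts on $\mathcal O_q(M_N(\Bbbk))$, $N\ge 3$, with each $g_i$ acting as an element of $\mathcal H\rtimes\langle\tau\rangle$ and each $x_i$ acting linearly and nonzero. Then $\theta\le 2N-2$.
   Context: $\Bbbk$ is an algebraically closed field of characteristic zero; $\operatorname{ord}$ denotes multiplicative order. $\mathcal O_q(M_N(\Bbbk))$ is the algebra generated by $Y_{ij}$, $1\le i,j\le N$, with relations: $Y_{ij}Y_{\ell m}=qY_{\ell m}Y_{ij}$ if ($i<\ell$, $j=m$) or ($i=\ell$, $j<m$); $Y_{ij}Y_{\ell m}=Y_{\ell m}Y_{ij}$ if $i<\ell$, $j>m$; and $Y_{ij}Y_{\ell m}=Y_{\ell m}Y_{ij}+(q-q^{-1})Y_{im}Y_{\ell j}$ if $i<\ell$, $j<m$. $\mathcal H\cong(\Bbbk^\times)^{2N-1}$ is the group of automorphisms $Y_{ij}\mapsto\alpha_{ij}Y_{ij}$ with $(\alpha_{ij})$ an $N\times N$ matrix of rank one with no zero entries; $\tau$ is the automorphism $Y_{ij}\mapsto Y_{ji}$. Bosonization: let $\theta\in\mathbb N$, $G$ a finite abelian group, $\underline g=(g_1,\dots,g_\theta)$ with $g_i\in G$, and $\underline\chi=(\chi_1,\dots,\chi_\theta)$ with $\chi_i\in\widehat G=\operatorname{Hom}(G,\Bbbk^\times)$,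 such that $\chi_i(g_j)=\chi_j(g_i)^{-1}$ for $i\ne j$ and $m_i:=\operatorname{ord}(\chi_i(g_i))\ge 2$. Then $B(G,\underline g,\underline\chi)$ is the Hopf algebra generated by $G$ and $x_1,\dots,x_\theta$ with the relations of $G$ and $x_i^{m_i}=0$, $x_ix_j=\chi_j(g_i)x_jx_i$ ($i\ne j$), $hx_i=\chi_i(h)x_ih$ ($h\in G$), where elements of $G$ are grouplike and $\Delta(x_i)=g_i\otimes x_i+x_i\otimes1$. Its rank is $\theta$. A Hopf algebra $H$ acts on an algebra $R$ if $R$ is a left $H$-module algebra. "$x_i$ acts linearly and nonzero" means $x_i$ maps $\operatorname{Span}_\Bbbk\{Y_{ij}\}$ into itself and does not act as zero. *)

theory Defs
  imports
    "HOL-Library.Poly_Mapping"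
    "HOL-Algebra.Algebra"
    "Jordan_Normal_Form.DL_Rank"
begin

section \<open>Algebras over a field\<close>

text \<open>
  The ground field is a type \<open>'k\<close> of class \<open>field\<close>, and \<open>class_ring\<close> is that field as a record.
  An algebra is carried by the record \<open>module\<close>, which has a multiplication as well as
  a scalar multiplication. The library locale \<open>algebra\<close> demands commutativity and cannot be used.
\<close>

definition is_algebra :: "('k::field, 'a, 'm) module_scheme \<Rightarrow> bool" where
  "is_algebra A \<longleftrightarrow> Module.module (class_ring :: 'k ring) A \<and> ring A \<and>
     (\<forall>c. \<forall>x\<in>carrier A. \<forall>y\<in>carrier A.
        (c \<odot>\<^bsub>A\<^esub> x) \<otimes>\<^bsub>A\<^esub> y = c \<odot>\<^bsub>A\<^esub> (x \<otimes>\<^bsub>A\<^esub> y) \<and>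
        x \<otimes>\<^bsub>A\<^esub> (c \<odot>\<^bsub>A\<^esub> y) = c \<odot>\<^bsub>A\<^esub> (x \<otimes>\<^bsub>A\<^esub> y))"

definition linear_maps ::
  "('k::field, 'a, 'm) module_scheme \<Rightarrow> ('k, 'b, 'n) module_scheme \<Rightarrow> ('a \<Rightarrow> 'b) set" where
  "linear_maps A B = LinearCombinations.module_hom class_ring A B"

definition algebra_homs ::
  "('k::field, 'a, 'm) module_scheme \<Rightarrow> ('k, 'b, 'n) module_scheme \<Rightarrow> ('a \<Rightarrow> 'b) set" where
  "algebra_homs A B = Ring.ring_hom A B \<inter> linear_maps A B"

definition algebra_auts :: "('k::field, 'a, 'm) module_scheme \<Rightarrow> ('a \<Rightarrow> 'a) set" where
  "algebra_auts A = Bij (carrier A) \<inter> algebra_homs A A"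

definition Aut_algebra :: "('k::field, 'a, 'm) module_scheme \<Rightarrow> ('a \<Rightarrow> 'a) monoid" where
  "Aut_algebra A = BijGroup (carrier A) \<lparr>carrier := algebra_auts A\<rparr>"

definition linear_span :: "('k::field, 'a, 'm) module_scheme \<Rightarrow> 'a set \<Rightarrow> 'a set" where
  "linear_span A S = LinearCombinations.module.span class_ring A S"

definition monoid_algebra :: "('a, 'm) monoid_scheme \<Rightarrow> ('k::field, 'a \<Rightarrow>\<^sub>0 'k) module" where
  "monoid_algebra M = \<lparr>
     carrier = {f. Poly_Mapping.keys f \<subseteq> carrier M},
     monoid.mult = (\<lambda>f g. \<Sum>x\<in>Poly_Mapping.keys f. \<Sum>y\<in>Poly_Mapping.keys g.
       Poly_Mapping.single (x \<otimes>\<^bsub>M\<^esub> y) (Poly_Mapping.lookup f x * Poly_Mapping.lookup g y)),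
     one = Poly_Mapping.single \<one>\<^bsub>M\<^esub> 1,
     ring.zero = 0,
     add = (+),
     module.smult = (\<lambda>c f. Poly_Mapping.map ((*) c) f)\<rparr>"

definition quotient_algebra ::
  "('k::field, 'a, 'm) module_scheme \<Rightarrow> 'a set \<Rightarrow> ('k, 'a set) module" where
  "quotient_algebra A I = \<lparr>
     carrier = carrier (A Quot I),
     monoid.mult = monoid.mult (A Quot I),
     one = one (A Quot I),
     ring.zero = ring.zero (A Quot I),
     add = add (A Quot I),
     module.smult = (\<lambda>c U. \<Union>x\<in>U. I +>\<^bsub>A\<^esub> (c \<odot>\<^bsub>A\<^esub> x))\<rparr>"

definition free_monoid :: "'x set \<Rightarrow> 'x list monoid" where
  "free_monoid S = \<lparr>carrier = lists S, monoid.mult = (@), one = []\<rparr>"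

abbreviation free_algebra :: "'x set \<Rightarrow> ('k::field, 'x list \<Rightarrow>\<^sub>0 'k) module" where
  "free_algebra S \<equiv> monoid_algebra (free_monoid S)"

definition presented_algebra ::
  "'x set \<Rightarrow> ('x list \<Rightarrow>\<^sub>0 'k::field) set \<Rightarrow> ('k, ('x list \<Rightarrow>\<^sub>0 'k) set) module" where
  "presented_algebra S rels = quotient_algebra (free_algebra S) (Idl\<^bsub>free_algebra S\<^esub> rels)"

definition generator ::
  "'x set \<Rightarrow> ('x list \<Rightarrow>\<^sub>0 'k::field) set \<Rightarrow> 'x \<Rightarrow> ('x list \<Rightarrow>\<^sub>0 'k) set" where
  "generator S rels x =
     (Idl\<^bsub>free_algebra S\<^esub> rels) +>\<^bsub>free_algebra S\<^esub> Poly_Mapping.single [x] 1"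


section \<open>Tensor products\<close>

text \<open>
  The vector space with basis \<open>A \<times> B\<close> carries the product
  \<open>(a, b) (a', b') = (a a', b b')\<close>. The bilinearity relations span a two-sided ideal of
  this algebra, and the quotient is the algebra \<open>A \<otimes> B\<close>.
\<close>

definition tensor_relations ::
  "('k::field, 'a, 'm) module_scheme \<Rightarrow> ('k, 'b, 'n) module_scheme \<Rightarrow> ('a \<times> 'b \<Rightarrow>\<^sub>0 'k) set" where
  "tensor_relations A B =
     {Poly_Mapping.single (a \<oplus>\<^bsub>A\<^esub> a', b) 1 - Poly_Mapping.single (a, b) 1
        - Poly_Mapping.single (a', b) 1 | a a' b.
        a \<in> carrier A \<and> a' \<in> carrier A \<and> b \<in> carrier B} \<union>
     {Poly_Mapping.single (a, b \<oplus>\<^bsub>B\<^esub> b') 1 - Poly_Mapping.single (a, b) 1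
        - Poly_Mapping.single (a, b') 1 | a b b'.
        a \<in> carrier A \<and> b \<in> carrier B \<and> b' \<in> carrier B} \<union>
     {Poly_Mapping.single (c \<odot>\<^bsub>A\<^esub> a, b) 1 - Poly_Mapping.single (a, b) c | c a b.
        a \<in> carrier A \<and> b \<in> carrier B} \<union>
     {Poly_Mapping.single (a, c \<odot>\<^bsub>B\<^esub> b) 1 - Poly_Mapping.single (a, b) c | c a b.
        a \<in> carrier A \<and> b \<in> carrier B}"

definition tensor_null ::
  "('k::field, 'a, 'm) module_scheme \<Rightarrow> ('k, 'b, 'n) module_scheme \<Rightarrow> ('a \<times> 'b \<Rightarrow>\<^sub>0 'k) set" where
  "tensor_null A B = linear_span (monoid_algebra (A \<times>\<times> B)) (tensor_relations A B)"

definition tensor ::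
  "('k::field, 'a, 'm) module_scheme \<Rightarrow> ('k, 'b, 'n) module_scheme
     \<Rightarrow> ('k, ('a \<times> 'b \<Rightarrow>\<^sub>0 'k) set) module" where
  "tensor A B = quotient_algebra (monoid_algebra (A \<times>\<times> B)) (tensor_null A B)"

definition pure_tensor ::
  "('k::field, 'a, 'm) module_scheme \<Rightarrow> ('k, 'b, 'n) module_scheme
     \<Rightarrow> 'a \<Rightarrow> 'b \<Rightarrow> ('a \<times> 'b \<Rightarrow>\<^sub>0 'k) set" where
  "pure_tensor A B a b =
     tensor_null A B +>\<^bsub>monoid_algebra (A \<times>\<times> B)\<^esub> Poly_Mapping.single (a, b) 1"

text \<open>
  The linear map \<open>a \<otimes> b \<mapsto> \<phi> a b\<close> from a tensor product to \<open>V\<close>. When \<open>\<phi>\<close> is bilinear, as it is in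
  all uses below, the value does not depend on the chosen representative of \<open>T\<close>.
\<close>

definition tensor_lift ::
  "('k::field, 'v, 'm) module_scheme \<Rightarrow> ('a \<Rightarrow> 'b \<Rightarrow> 'v) \<Rightarrow> ('a \<times> 'b \<Rightarrow>\<^sub>0 'k) set \<Rightarrow> 'v" where
  "tensor_lift V \<phi> T =
     (let t = (SOME t. t \<in> T)
      in \<Oplus>\<^bsub>V\<^esub>p\<in>Poly_Mapping.keys t. Poly_Mapping.lookup t p \<odot>\<^bsub>V\<^esub> \<phi> (fst p) (snd p))"

definition tensor_assoc ::
  "('k::field, 'a, 'm) module_scheme \<Rightarrow> ('k, 'b, 'n) module_scheme \<Rightarrow> ('k, 'c, 'p) module_scheme
     \<Rightarrow> (('a \<times> 'b \<Rightarrow>\<^sub>0 'k) set \<times> 'c \<Rightarrow>\<^sub>0 'k) set \<Rightarrow> ('a \<times> ('b \<times> 'c \<Rightarrow>\<^sub>0 'k) set \<Rightarrow>\<^sub>0 'k) set" where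
  "tensor_assoc A B C =
     (let V = tensor A (tensor B C)
      in tensor_lift V (\<lambda>S c. tensor_lift V
           (\<lambda>a b. pure_tensor A (tensor B C) a (pure_tensor B C b c)) S))"


section \<open>Hopf algebras and module algebras\<close>

record (overloaded) ('k::zero, 'a) hopf = "('k, 'a) module" +
  comult :: "'a \<Rightarrow> ('a \<times> 'a \<Rightarrow>\<^sub>0 'k) set"
  counit :: "'a \<Rightarrow> 'k"
  antipode :: "'a \<Rightarrow> 'a"

definition hopf_algebra :: "('k::field, 'a) hopf \<Rightarrow> bool" where
  "hopf_algebra H \<longleftrightarrow>
     is_algebra H \<and>
     comult H \<in> algebra_homs H (tensor H H) \<and>
     counit H \<in> Ring.ring_hom H class_ring \<and>
     (\<forall>c. \<forall>h\<in>carrier H. counit H (c \<odot>\<^bsub>H\<^esub> h) = c * counit H h) \<and>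
     antipode H \<in> linear_maps H H \<and>
     (\<forall>h\<in>carrier H.
        tensor_assoc H H H
          (tensor_lift (tensor (tensor H H) H)
             (\<lambda>a b. pure_tensor (tensor H H) H (comult H a) b) (comult H h)) =
        tensor_lift (tensor H (tensor H H))
          (\<lambda>a b. pure_tensor H (tensor H H) a (comult H b)) (comult H h) \<and>
        tensor_lift H (\<lambda>a b. counit H a \<odot>\<^bsub>H\<^esub> b) (comult H h) = h \<and>
        tensor_lift H (\<lambda>a b. counit H b \<odot>\<^bsub>H\<^esub> a) (comult H h) = h \<and>
        tensor_lift H (\<lambda>a b. antipode H a \<otimes>\<^bsub>H\<^esub> b) (comult H h) = counit H h \<odot>\<^bsub>H\<^esub> \<one>\<^bsub>H\<^esub> \<and>
        tensor_lift H (\<lambda>a b. a \<otimes>\<^bsub>H\<^esub> antipode H b) (comult H h) = counit H h \<odot>\<^bsub>H\<^esub> \<one>\<^bsub>H\<^esub>)"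

definition module_algebra ::
  "('k::field, 'h) hopf \<Rightarrow> ('k, 'a, 'm) module_scheme \<Rightarrow> ('h \<Rightarrow> 'a \<Rightarrow> 'a) \<Rightarrow> bool" where
  "module_algebra H R act \<longleftrightarrow>
     is_algebra R \<and>
     (\<forall>h\<in>carrier H. act h \<in> linear_maps R R) \<and>
     (\<forall>r\<in>carrier R. (\<lambda>h. act h r) \<in> linear_maps H R) \<and>
     (\<forall>r\<in>carrier R. act \<one>\<^bsub>H\<^esub> r = r) \<and>
     (\<forall>h\<in>carrier H. \<forall>h'\<in>carrier H. \<forall>r\<in>carrier R. act (h \<otimes>\<^bsub>H\<^esub> h') r = act h (act h' r)) \<and>
     (\<forall>h\<in>carrier H. act h \<one>\<^bsub>R\<^esub> = counit H h \<odot>\<^bsub>R\<^esub> \<one>\<^bsub>R\<^esub>) \<and>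
     (\<forall>h\<in>carrier H. \<forall>r\<in>carrier R. \<forall>s\<in>carrier R.
        act h (r \<otimes>\<^bsub>R\<^esub> s) =
          tensor_lift R (\<lambda>a b. act a r \<otimes>\<^bsub>R\<^esub> act b s) (comult H h))"


section \<open>Bosonizations of quantum linear spaces\<close>

text \<open>The indices \<open>1, \<dots>, \<theta>\<close> are shifted to \<open>0, \<dots>, \<theta> - 1\<close>.\<close>

definition qls_order :: "(nat \<Rightarrow> 'g) \<Rightarrow> (nat \<Rightarrow> 'g \<Rightarrow> 'k::field) \<Rightarrow> nat \<Rightarrow> nat" where
  "qls_order g \<chi> i = group.ord (mult_of class_ring) (\<chi> i (g i))"

text \<open>An element of infinite order has \<open>ord\<close> equal to 0, so the last condition also excludes it.\<close>

definition qls_datum ::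
  "'g monoid \<Rightarrow> nat \<Rightarrow> (nat \<Rightarrow> 'g) \<Rightarrow> (nat \<Rightarrow> 'g \<Rightarrow> 'k::field) \<Rightarrow> bool" where
  "qls_datum G \<theta> g \<chi> \<longleftrightarrow>
     comm_group G \<and> finite (carrier G) \<and>
     (\<forall>i<\<theta>. g i \<in> carrier G \<and> \<chi> i \<in> hom G (mult_of class_ring)) \<and>
     (\<forall>i<\<theta>. \<forall>j<\<theta>. i \<noteq> j \<longrightarrow> \<chi> i (g j) = inverse (\<chi> j (g i))) \<and>
     (\<forall>i<\<theta>. 2 \<le> qls_order g \<chi> i)"

datatype 'g bos_gen = Grp 'g | Skew nat

definition bos_gens :: "'g monoid \<Rightarrow> nat \<Rightarrow> 'g bos_gen set" where
  "bos_gens G \<theta> = Grp ` carrier G \<union> Skew ` {..<\<theta>}"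

definition bos_relations ::
  "'g monoid \<Rightarrow> nat \<Rightarrow> (nat \<Rightarrow> 'g) \<Rightarrow> (nat \<Rightarrow> 'g \<Rightarrow> 'k::field)
     \<Rightarrow> ('g bos_gen list \<Rightarrow>\<^sub>0 'k) set" where
  "bos_relations G \<theta> g \<chi> =
     {Poly_Mapping.single [Grp a, Grp b] 1 - Poly_Mapping.single [Grp (a \<otimes>\<^bsub>G\<^esub> b)] 1 | a b.
        a \<in> carrier G \<and> b \<in> carrier G} \<union>
     {Poly_Mapping.single [Grp \<one>\<^bsub>G\<^esub>] 1 - Poly_Mapping.single [] 1} \<union>
     {Poly_Mapping.single (replicate (qls_order g \<chi> i) (Skew i)) 1 | i. i < \<theta>} \<union>
     {Poly_Mapping.single [Skew i, Skew j] 1 - Poly_Mapping.single [Skew j, Skew i] (\<chi> j (g i))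
        | i j. i < \<theta> \<and> j < \<theta> \<and> i \<noteq> j} \<union>
     {Poly_Mapping.single [Grp h, Skew i] 1 - Poly_Mapping.single [Skew i, Grp h] (\<chi> i h)
        | h i. h \<in> carrier G \<and> i < \<theta>}"

definition bos_algebra ::
  "'g monoid \<Rightarrow> nat \<Rightarrow> (nat \<Rightarrow> 'g) \<Rightarrow> (nat \<Rightarrow> 'g \<Rightarrow> 'k::field)
     \<Rightarrow> ('k, ('g bos_gen list \<Rightarrow>\<^sub>0 'k) set) module" where
  "bos_algebra G \<theta> g \<chi> = presented_algebra (bos_gens G \<theta>) (bos_relations G \<theta> g \<chi>)"

definition bos_grp ::
  "'g monoid \<Rightarrow> nat \<Rightarrow> (nat \<Rightarrow> 'g) \<Rightarrow> (nat \<Rightarrow> 'g \<Rightarrow> 'k::field)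
     \<Rightarrow> 'g \<Rightarrow> ('g bos_gen list \<Rightarrow>\<^sub>0 'k) set" where
  "bos_grp G \<theta> g \<chi> h = generator (bos_gens G \<theta>) (bos_relations G \<theta> g \<chi>) (Grp h)"

definition bos_skew ::
  "'g monoid \<Rightarrow> nat \<Rightarrow> (nat \<Rightarrow> 'g) \<Rightarrow> (nat \<Rightarrow> 'g \<Rightarrow> 'k::field)
     \<Rightarrow> nat \<Rightarrow> ('g bos_gen list \<Rightarrow>\<^sub>0 'k) set" where
  "bos_skew G \<theta> g \<chi> i = generator (bos_gens G \<theta>) (bos_relations G \<theta> g \<chi>) (Skew i)"

text \<open>
  \<open>H\<close> is the Hopf algebra \<open>B(G, g, \<chi>)\<close>. As the generators generate the presented algebra, their
  coproducts determine the comultiplication, and with it the counit and the antipode, on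
  \<open>carrier H\<close>.
\<close>

definition is_bosonization ::
  "'g monoid \<Rightarrow> nat \<Rightarrow> (nat \<Rightarrow> 'g) \<Rightarrow> (nat \<Rightarrow> 'g \<Rightarrow> 'k::field)
     \<Rightarrow> ('k, ('g bos_gen list \<Rightarrow>\<^sub>0 'k) set) hopf \<Rightarrow> bool" where
  "is_bosonization G \<theta> g \<chi> H \<longleftrightarrow>
     hopf_algebra H \<and>
     module.truncate H = bos_algebra G \<theta> g \<chi> \<and>
     (\<forall>h\<in>carrier G.
        comult H (bos_grp G \<theta> g \<chi> h) = pure_tensor H H (bos_grp G \<theta> g \<chi> h) (bos_grp G \<theta> g \<chi> h)) \<and>
     (\<forall>i<\<theta>.
        comult H (bos_skew G \<theta> g \<chi> i) =
          pure_tensor H H (bos_grp G \<theta> g \<chi> (g i)) (bos_skew G \<theta> g \<chi> i)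
            \<oplus>\<^bsub>tensor H H\<^esub> pure_tensor H H (bos_skew G \<theta> g \<chi> i) \<one>\<^bsub>H\<^esub>)"


section \<open>Quantum matrices\<close>

text \<open>Row and column indices run over \<open>{..<N}\<close> instead of \<open>1, \<dots>, N\<close>.\<close>

definition qmat_relations :: "'k::field \<Rightarrow> nat \<Rightarrow> ((nat \<times> nat) list \<Rightarrow>\<^sub>0 'k) set" where
  "qmat_relations q N =
     {Poly_Mapping.single [(i, j), (l, m)] 1 - Poly_Mapping.single [(l, m), (i, j)] q | i j l m.
        i < N \<and> j < N \<and> l < N \<and> m < N \<and> (i < l \<and> j = m \<or> i = l \<and> j < m)} \<union>
     {Poly_Mapping.single [(i, j), (l, m)] 1 - Poly_Mapping.single [(l, m), (i, j)] 1 | i j l m.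
        i < N \<and> j < N \<and> l < N \<and> m < N \<and> i < l \<and> j > m} \<union>
     {Poly_Mapping.single [(i, j), (l, m)] 1 - Poly_Mapping.single [(l, m), (i, j)] 1
        - Poly_Mapping.single [(i, m), (l, j)] (q - inverse q) | i j l m.
        i < N \<and> j < N \<and> l < N \<and> m < N \<and> i < l \<and> j < m}"

definition quantum_matrices ::
  "'k::field \<Rightarrow> nat \<Rightarrow> ('k, ((nat \<times> nat) list \<Rightarrow>\<^sub>0 'k) set) module" where
  "quantum_matrices q N = presented_algebra ({..<N} \<times> {..<N}) (qmat_relations q N)"

definition qmat_gen :: "'k::field \<Rightarrow> nat \<Rightarrow> nat \<Rightarrow> nat \<Rightarrow> ((nat \<times> nat) list \<Rightarrow>\<^sub>0 'k) set" where
  "qmat_gen q N i j = generator ({..<N} \<times> {..<N}) (qmat_relations q N) (i, j)"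

definition torus_auts ::
  "'k::field \<Rightarrow> nat \<Rightarrow> (((nat \<times> nat) list \<Rightarrow>\<^sub>0 'k) set \<Rightarrow> ((nat \<times> nat) list \<Rightarrow>\<^sub>0 'k) set) set" where
  "torus_auts q N =
     {\<phi> \<in> algebra_auts (quantum_matrices q N).
        \<exists>\<alpha>\<in>carrier_mat N N. vec_space.rank N \<alpha> = 1 \<and>
          (\<forall>i<N. \<forall>j<N. \<alpha> $$ (i, j) \<noteq> 0 \<and>
             \<phi> (qmat_gen q N i j) = \<alpha> $$ (i, j) \<odot>\<^bsub>quantum_matrices q N\<^esub> qmat_gen q N i j)}"

text \<open>The set consisting of the automorphism \<open>\<tau>\<close> only.\<close>

definition transpose_auts ::
  "'k::field \<Rightarrow> nat \<Rightarrow> (((nat \<times> nat) list \<Rightarrow>\<^sub>0 'k) set \<Rightarrow> ((nat \<times> nat) list \<Rightarrow>\<^sub>0 'k) set) set" where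
  "transpose_auts q N =
     {\<phi> \<in> algebra_auts (quantum_matrices q N).
        \<forall>i<N. \<forall>j<N. \<phi> (qmat_gen q N i j) = qmat_gen q N j i}"

text \<open>The semidirect product of the torus and \<open>\<langle>\<tau>\<rangle>\<close>, formed inside the automorphism group.\<close>

definition torus_transpose_group ::
  "'k::field \<Rightarrow> nat \<Rightarrow> (((nat \<times> nat) list \<Rightarrow>\<^sub>0 'k) set \<Rightarrow> ((nat \<times> nat) list \<Rightarrow>\<^sub>0 'k) set) set" where
  "torus_transpose_group q N =
     torus_auts q N <#>\<^bsub>Aut_algebra (quantum_matrices q N)\<^esub>
       generate (Aut_algebra (quantum_matrices q N)) (transpose_auts q N)"

definition acts_linearly_nonzero ::
  "'k::field \<Rightarrow> nat \<Rightarrow> (((nat \<times> nat) list \<Rightarrow>\<^sub>0 'k) set \<Rightarrow> ((nat \<times> nat) list \<Rightarrow>\<^sub>0 'k) set) \<Rightarrow> bool" where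
  "acts_linearly_nonzero q N f \<longleftrightarrow>
     (let R = quantum_matrices q N;
          V = linear_span R {qmat_gen q N i j | i j. i < N \<and> j < N}
      in f ` V \<subseteq> V \<and> (\<exists>r\<in>carrier R. f r \<noteq> \<zero>\<^bsub>R\<^esub>))"

end

theory Submission
  imports Defs
begin

text \<open>
  Write \<open>x\<close> for a skew primitive generator \<open>x\<^sub>i\<close> and \<open>g\<close> for the grouplike \<open>g\<^sub>i\<close>. On the span of
  the \<open>Y\<^sub>a\<close>, where \<open>a\<close> runs through the \<open>N\<^sup>2\<close> matrix positions, \<open>x\<close> acts by a matrix, and it satisfies
  \<open>x(rs) = g(r) x(s) + x(r) s\<close> and \<open>g x = \<mu> x g\<close> with \<open>\<mu> = \<chi>\<^sub>i(g\<^sub>i)\<close>. The order of \<open>\<mu>\<close> is neither 1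
  nor 2, so \<open>\<mu>\<^sup>2 \<noteq> 1\<close>. Applying \<open>x\<close> to a quadratic relation gives an element of degree two that is zero
  in the algebra. In degree two the ideal of relations contains only linear combinations of the
  relations themselves (\<open>low_degree_ideal\<close>), so this amounts to scalar equations for the matrix of
  \<open>x\<close> (\<open>skew_derivation_coefficients\<close>).

  If \<open>g\<close> involves the transposition, these equations force \<open>x\<close> to vanish (\<open>transpose_skew_zero\<close>).
  Otherwise \<open>g\<close> multiplies each \<open>Y\<^sub>a\<close> by a weight \<open>\<alpha>\<^sub>a\<close>. Say that \<open>x\<close> moves \<open>a\<close> to \<open>c\<close> if
  \<open>Y\<^sub>c\<close> occurs in \<open>x(Y\<^sub>a)\<close>; then \<open>\<alpha>\<^sub>c = \<mu> \<alpha>\<^sub>a\<close>. Every move stays in one row or in one column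
  (\<open>straight_move\<close>). A move from one row to another is, by \<open>down_move_cases\<close> and its mirror images, of
  one of two kinds. In a full move, a whole row is moved to an adjacent row, and the weights are
  \<open>q\<close> and \<open>q\<^sup>-\<^sup>1\<close> on the upper and the lower one of the two rows and 1 elsewhere. In a corner move,
  \<open>(0, 0)\<close> is moved to \<open>(N - 1, 0)\<close> or \<open>(N - 1, N - 1)\<close> to \<open>(0, N - 1)\<close>, and the weights in the first
  two, respectively the last two, columns differ by the factor \<open>q\<^sup>2\<close>. Moves between columns are the
  transposes of these.

  A full move occupies the pair of adjacent rows that it involves, and a corner move in
  a column occupies the pair of adjacent columns at that side of the matrix; likewise with rows and
  columns exchanged. There are \<open>2 (N - 1)\<close> such slots, every \<open>x\<^sub>i\<close> occupies at least one, and the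
  theorem follows because no two of the \<open>x\<^sub>i\<close> occupy the same slot (\<open>slot_conflict\<close>). Indeed
  \<open>\<chi>\<^sub>j(g\<^sub>i) \<chi>\<^sub>i(g\<^sub>j) = 1\<close>, while the weights determine both factors and give
  \<open>\<mu>\<^sup>2\<close>, \<open>q\<^sup>2\<close> or \<open>q\<^sup>-\<^sup>2\<close> for the product. The only exception is a pair of opposite full moves; then
  \<open>x\<^sub>i x\<^sub>j\<close> is not a multiple of \<open>x\<^sub>j x\<^sub>i\<close>.
\<close>

section \<open>Coefficient equations for linear skew derivations\<close>

text \<open>
  Each equation says that a linear functional vanishes on the combination of the words \<open>u v\<close> with
  coefficients \<open>F u v\<close>. Up to a factor, the functionals arise by rewriting all products into a fixed
  order by means of the relations and taking the coefficient of one ordered product. The term with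
  \<open>q - inverse q\<close> is what rewriting \<open>Y\<^sub>i\<^sub>j Y\<^sub>l\<^sub>m\<close> contributes to the coefficient of \<open>Y\<^sub>i\<^sub>m Y\<^sub>l\<^sub>j\<close>.
\<close>

definition quad_zero :: "'k::field \<Rightarrow> nat \<Rightarrow> (nat \<times> nat \<Rightarrow> nat \<times> nat \<Rightarrow> 'k) \<Rightarrow> bool" where
  "quad_zero q N F \<longleftrightarrow>
     (\<forall>i<N. \<forall>j<N. F (i, j) (i, j) = 0) \<and>
     (\<forall>i<N. \<forall>j<N. \<forall>m<N. j < m \<longrightarrow> q * F (i, j) (i, m) + F (i, m) (i, j) = 0) \<and>
     (\<forall>i<N. \<forall>l<N. \<forall>j<N. i < l \<longrightarrow> q * F (i, j) (l, j) + F (l, j) (i, j) = 0) \<and>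
     (\<forall>i<N. \<forall>l<N. \<forall>j<N. \<forall>m<N. i < l \<longrightarrow> j < m \<longrightarrow>
        F (i, j) (l, m) + F (l, m) (i, j) = 0 \<and>
        F (i, m) (l, j) + F (l, j) (i, m) + (q - inverse q) * F (i, j) (l, m) = 0)"

lemma quad_zeroD:
  assumes "quad_zero q N F" and "i < N" "j < N" "l < N" "m < N"
  shows "F (i, j) (i, j) = 0"
    and "j < m \<Longrightarrow> q * F (i, j) (i, m) + F (i, m) (i, j) = 0"
    and "i < l \<Longrightarrow> q * F (i, j) (l, j) + F (l, j) (i, j) = 0"
    and "i < l \<Longrightarrow> j < m \<Longrightarrow> F (i, j) (l, m) + F (l, m) (i, j) = 0"
    and "i < l \<Longrightarrow> j < m \<Longrightarrow>
          F (i, m) (l, j) + F (l, j) (i, m) + (q - inverse q) * F (i, j) (l, m) = 0"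
  using assms by (simp_all add: quad_zero_def)

text \<open>
  With \<open>K a u\<close> and \<open>\<xi> b v\<close> the coefficients of \<open>Y\<^sub>u\<close> in \<open>g(Y\<^sub>a)\<close> and of \<open>Y\<^sub>v\<close> in \<open>x(Y\<^sub>b)\<close>, this is
  the coefficient of \<open>Y\<^sub>u Y\<^sub>v\<close> in \<open>g(Y\<^sub>a) x(Y\<^sub>b) + x(Y\<^sub>a) Y\<^sub>b\<close>, that is, in \<open>x(Y\<^sub>a Y\<^sub>b)\<close>.
\<close>

definition leibniz ::
  "('a \<Rightarrow> 'a \<Rightarrow> 'k::field) \<Rightarrow> ('a \<Rightarrow> 'a \<Rightarrow> 'k) \<Rightarrow> 'a \<Rightarrow> 'a \<Rightarrow> 'a \<Rightarrow> 'a \<Rightarrow> 'k" where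
  "leibniz K \<xi> a b u v = K a u * \<xi> b v + \<xi> a u * (if v = b then 1 else 0)"

text \<open>
  The defining relations, one conjunct for each kind, are mapped to zero by \<open>x\<close>.
\<close>

definition skew_derivation ::
  "'k::field \<Rightarrow> nat \<Rightarrow> (nat \<times> nat \<Rightarrow> nat \<times> nat \<Rightarrow> 'k) \<Rightarrow> (nat \<times> nat \<Rightarrow> nat \<times> nat \<Rightarrow> 'k) \<Rightarrow> bool" where
  "skew_derivation q N K \<xi> \<longleftrightarrow>
     (\<forall>i<N. \<forall>j<N. \<forall>m<N. j < m \<longrightarrow>
        quad_zero q N (\<lambda>u v. leibniz K \<xi> (i, j) (i, m) u v - q * leibniz K \<xi> (i, m) (i, j) u v)) \<and>
     (\<forall>i<N. \<forall>l<N. \<forall>j<N. i < l \<longrightarrow>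
        quad_zero q N (\<lambda>u v. leibniz K \<xi> (i, j) (l, j) u v - q * leibniz K \<xi> (l, j) (i, j) u v)) \<and>
     (\<forall>i<N. \<forall>l<N. \<forall>j<N. \<forall>m<N. i < l \<longrightarrow> j < m \<longrightarrow>
        quad_zero q N (\<lambda>u v. leibniz K \<xi> (i, m) (l, j) u v - leibniz K \<xi> (l, j) (i, m) u v) \<and>
        quad_zero q N (\<lambda>u v. leibniz K \<xi> (i, j) (l, m) u v - leibniz K \<xi> (l, m) (i, j) u v
          - (q - inverse q) * leibniz K \<xi> (i, m) (l, j) u v))"

lemma skew_derivationD:
  assumes "skew_derivation q N K \<xi>" and "i < N" "j < N" "l < N" "m < N"
  shows "j < m \<Longrightarrow> quad_zero q N
          (\<lambda>u v. leibniz K \<xi> (i, j) (i, m) u v - q * leibniz K \<xi> (i, m) (i, j) u v)"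
    and "i < l \<Longrightarrow> quad_zero q N
          (\<lambda>u v. leibniz K \<xi> (i, j) (l, j) u v - q * leibniz K \<xi> (l, j) (i, j) u v)"
    and "i < l \<Longrightarrow> j < m \<Longrightarrow> quad_zero q N
          (\<lambda>u v. leibniz K \<xi> (i, m) (l, j) u v - leibniz K \<xi> (l, j) (i, m) u v)"
    and "i < l \<Longrightarrow> j < m \<Longrightarrow> quad_zero q N
          (\<lambda>u v. leibniz K \<xi> (i, j) (l, m) u v - leibniz K \<xi> (l, m) (i, j) u v
            - (q - inverse q) * leibniz K \<xi> (i, m) (l, j) u v)"
  using assms by (simp_all add: skew_derivation_def)

subsection \<open>Symmetries\<close>

text \<open>
  Transposition preserves the relations, and the half turn of the matrix turns the relations for
  \<open>q\<close> into those for \<open>q\<^sup>-\<^sup>1\<close>. A combination of the two takes every move within a row or column to a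
  move down a column.
\<close>

abbreviation tr :: "nat \<times> nat \<Rightarrow> nat \<times> nat" where "tr \<equiv> prod.swap"

definition half_turn :: "nat \<Rightarrow> nat \<times> nat \<Rightarrow> nat \<times> nat" where
  "half_turn N a = (N - 1 - fst a, N - 1 - snd a)"

lemma quad_zero_cong:
  assumes "quad_zero q N F"
    and "\<And>u v. u \<in> {..<N} \<times> {..<N} \<Longrightarrow> v \<in> {..<N} \<times> {..<N} \<Longrightarrow> F' u v = F u v"
  shows "quad_zero q N F'"
  using assms(1) unfolding quad_zero_def by (simp add: assms(2))

lemma quad_zero_diff:
  fixes c :: "'k::field"
  assumes F: "quad_zero q N F" and F': "quad_zero q N F'"
  shows "quad_zero q N (\<lambda>u v. F u v - c * F' u v)"
proof -
  have comb: "(x - c * x') + (y - c * y') = 0" if "x + y = 0" "x' + y' = 0" for x y x' y' :: 'k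
  proof -
    have "(x - c * x') + (y - c * y') = (x + y) - c * (x' + y')" by (simp add: algebra_simps)
    then show ?thesis using that by simp
  qed
  have comb2: "p * x + y = 0 \<Longrightarrow> p * x' + y' = 0 \<Longrightarrow> p * (x - c * x') + (y - c * y') = 0"
    for p x y x' y' :: 'k
    using comb[of "p * x" y "p * x'" y'] by (simp add: algebra_simps)
  have comb3: "x + y + p * z = 0 \<Longrightarrow> x' + y' + p * z' = 0 \<Longrightarrow>
      (x - c * x') + (y - c * y') + p * (z - c * z') = 0" for p x y z x' y' z' :: 'k
    using comb2[of p z "x + y" z' "x' + y'"] by (simp add: algebra_simps)
  show ?thesis
    unfolding quad_zero_def
    by (intro conjI allI impI comb comb2 comb3 quad_zeroD[OF F] quad_zeroD[OF F'])
       (simp_all add: quad_zeroD(1)[OF F] quad_zeroD(1)[OF F'])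
qed

lemma quad_zero_scale:
  assumes "quad_zero q N F"
  shows "quad_zero q N (\<lambda>u v. c * F u v)"
  by (rule quad_zero_cong[OF quad_zero_diff[OF assms assms, of "1 - c"]]) (simp add: algebra_simps)

lemma quad_zero_add:
  assumes "quad_zero q N F" "quad_zero q N F'"
  shows "quad_zero q N (\<lambda>u v. F u v + F' u v)"
  by (rule quad_zero_cong[OF quad_zero_diff[OF assms, of "- 1"]]) simp

lemma quad_zero_tr:
  assumes F: "quad_zero q N F"
  shows "quad_zero q N (\<lambda>u v. F (tr u) (tr v))"
  unfolding quad_zero_def prod.swap_def
  using quad_zeroD[OF F] by (auto simp: add.commute)

lemma quad_zero_half_turn:
  fixes q :: "'k::field"
  assumes q: "q \<noteq> 0" and F: "quad_zero q N F"
  shows "quad_zero (inverse q) N (\<lambda>u v. F (half_turn N u) (half_turn N v))"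
proof -
  have flip: "inverse q * y + x = 0" if "q * x + y = 0" for x y :: 'k
    using q that by (simp add: field_simps)
  have flip2: "y + x + (inverse q - inverse (inverse q)) * w = 0"
    if "x + y + (q - inverse q) * z = 0" "z + w = 0" for x y z w :: 'k
  proof -
    have "w = - z" using that(2) by (simp add: eq_neg_iff_add_eq_0 add.commute)
    then show ?thesis using that(1) by (simp add: algebra_simps)
  qed
  have flip3: "y + x = 0" if "x + y = 0" for x y :: 'k
    using that by (simp add: add.commute)
  show ?thesis
    unfolding quad_zero_def half_turn_def fst_conv snd_conv
  proof (intro conjI allI impI)
    fix i l j m assume *: "i < N" "l < N" "j < N" "m < N" "i < l" "j < m"
    show "F (N - 1 - i, N - 1 - j) (N - 1 - l, N - 1 - m) + F (N - 1 - l, N - 1 - m) (N - 1 - i, N - 1 - j) = 0"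
      by (rule flip3, rule quad_zeroD(4)[OF F]) (use * in auto)
    show "F (N - 1 - i, N - 1 - m) (N - 1 - l, N - 1 - j) + F (N - 1 - l, N - 1 - j) (N - 1 - i, N - 1 - m)
       + (inverse q - inverse (inverse q)) * F (N - 1 - i, N - 1 - j) (N - 1 - l, N - 1 - m) = 0"
      by (rule flip2, rule quad_zeroD(5)[OF F], (use * in auto)[6], rule quad_zeroD(4)[OF F]) (use * in auto)
  next
    fix i j m assume *: "i < N" "j < N" "m < N" "j < m"
    show "inverse q * F (N - 1 - i, N - 1 - j) (N - 1 - i, N - 1 - m) + F (N - 1 - i, N - 1 - m) (N - 1 - i, N - 1 - j) = 0"
      by (rule flip, rule quad_zeroD(2)[OF F, where l = 0]) (use * in auto)
  next
    fix i l j assume *: "i < N" "l < N" "j < N" "i < l"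
    show "inverse q * F (N - 1 - i, N - 1 - j) (N - 1 - l, N - 1 - j) + F (N - 1 - l, N - 1 - j) (N - 1 - i, N - 1 - j) = 0"
      by (rule flip, rule quad_zeroD(3)[OF F, where m = 0]) (use * in auto)
  next
    fix i j assume *: "i < N" "j < N"
    show "F (N - 1 - i, N - 1 - j) (N - 1 - i, N - 1 - j) = 0"
      by (rule quad_zeroD(1)[OF F, where l = 0 and m = 0]) (use * in auto)
  qed
qed

text \<open>
  Transposition exchanges the two factors of an antidiagonal product. The relation between them
  therefore has to be used twice: with the opposite sign, and to reorder the extra term of the
  diagonal relation.
\<close>

lemma skew_derivation_tr:
  assumes sd: "skew_derivation q N K \<xi>"
  shows "skew_derivation q N (\<lambda>a b. K (tr a) (tr b)) (\<lambda>a b. \<xi> (tr a) (tr b))"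
proof -
  let ?L = "leibniz (\<lambda>a b. K (tr a) (tr b)) (\<lambda>a b. \<xi> (tr a) (tr b))"
  have L: "?L a b u v = leibniz K \<xi> (tr a) (tr b) (tr u) (tr v)" for a b u v
    by (cases v; cases b) (auto simp: leibniz_def)
  note D = skew_derivationD[OF sd]
  show ?thesis
    unfolding skew_derivation_def L
  proof (intro conjI allI impI)
    fix i l j m assume *: "i < N" "l < N" "j < N" "m < N" "i < l" "j < m"
    have A: "quad_zero q N (\<lambda>u v. leibniz K \<xi> (j, l) (m, i) u v - leibniz K \<xi> (m, i) (j, l) u v)"
      by (rule D(3)) (use * in auto)
    have "quad_zero q N (\<lambda>u v. leibniz K \<xi> (m, i) (j, l) u v - leibniz K \<xi> (j, l) (m, i) u v)"
      by (rule quad_zero_cong[OF quad_zero_diff[OF A A, of 2]]) simp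
    from quad_zero_tr[OF this]
    show "quad_zero q N (\<lambda>u v. leibniz K \<xi> (tr (i, m)) (tr (l, j)) (tr u) (tr v)
        - leibniz K \<xi> (tr (l, j)) (tr (i, m)) (tr u) (tr v))" by simp
    have B: "quad_zero q N (\<lambda>u v. leibniz K \<xi> (j, i) (m, l) u v - leibniz K \<xi> (m, l) (j, i) u v
            - (q - inverse q) * leibniz K \<xi> (j, l) (m, i) u v)"
      by (rule D(4)) (use * in auto)
    have "quad_zero q N (\<lambda>u v. leibniz K \<xi> (j, i) (m, l) u v - leibniz K \<xi> (m, l) (j, i) u v
            - (q - inverse q) * leibniz K \<xi> (m, i) (j, l) u v)"
      by (rule quad_zero_cong[OF quad_zero_diff[OF B A, of "inverse q - q"]]) (simp add: algebra_simps)
    from quad_zero_tr[OF this]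
    show "quad_zero q N (\<lambda>u v. leibniz K \<xi> (tr (i, j)) (tr (l, m)) (tr u) (tr v)
          - leibniz K \<xi> (tr (l, m)) (tr (i, j)) (tr u) (tr v)
          - (q - inverse q) * leibniz K \<xi> (tr (i, m)) (tr (l, j)) (tr u) (tr v))" by simp
  next
    fix i j m assume *: "i < N" "j < N" "m < N" "j < m"
    have "quad_zero q N (\<lambda>u v. leibniz K \<xi> (j, i) (m, i) u v - q * leibniz K \<xi> (m, i) (j, i) u v)"
      by (rule D(2)[where m = 0]) (use * in auto)
    from quad_zero_tr[OF this]
    show "quad_zero q N (\<lambda>u v. leibniz K \<xi> (tr (i, j)) (tr (i, m)) (tr u) (tr v)
          - q * leibniz K \<xi> (tr (i, m)) (tr (i, j)) (tr u) (tr v))" by simp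
  next
    fix i l j assume *: "i < N" "l < N" "j < N" "i < l"
    have "quad_zero q N (\<lambda>u v. leibniz K \<xi> (j, i) (j, l) u v - q * leibniz K \<xi> (j, l) (j, i) u v)"
      by (rule D(1)[where l = 0]) (use * in auto)
    from quad_zero_tr[OF this]
    show "quad_zero q N (\<lambda>u v. leibniz K \<xi> (tr (i, j)) (tr (l, j)) (tr u) (tr v)
          - q * leibniz K \<xi> (tr (l, j)) (tr (i, j)) (tr u) (tr v))" by simp
  qed
qed

lemma skew_derivation_half_turn:
  fixes q :: "'k::field"
  assumes q: "q \<noteq> 0" and sd: "skew_derivation q N K \<xi>"
  shows "skew_derivation (inverse q) N (\<lambda>a b. K (half_turn N a) (half_turn N b)) (\<lambda>a b. \<xi> (half_turn N a) (half_turn N b))"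
proof -
  let ?L = "leibniz (\<lambda>a b. K (half_turn N a) (half_turn N b)) (\<lambda>a b. \<xi> (half_turn N a) (half_turn N b))"
  let ?M = "\<lambda>a b u v. leibniz K \<xi> (half_turn N a) (half_turn N b) (half_turn N u) (half_turn N v)"
  have L: "?L a b u v = ?M a b u v"
    if "b \<in> {..<N} \<times> {..<N}" "v \<in> {..<N} \<times> {..<N}" for a b u v
  proof -
    have "half_turn N v = half_turn N b \<longleftrightarrow> v = b"
      using that by (cases v; cases b) (auto simp: half_turn_def)
    then show ?thesis by (simp add: leibniz_def)
  qed
  have r: "half_turn N (i, j) = (N - 1 - i, N - 1 - j)" for i j by (simp add: half_turn_def)
  note D = skew_derivationD[OF sd]
  show ?thesis
    unfolding skew_derivation_def
  proof (intro conjI allI impI)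
    fix i l j m assume *: "i < N" "l < N" "j < N" "m < N" "i < l" "j < m"
    have "quad_zero q N (\<lambda>u v. leibniz K \<xi> (half_turn N (l, j)) (half_turn N (i, m)) u v - leibniz K \<xi> (half_turn N (i, m)) (half_turn N (l, j)) u v)"
      unfolding r by (rule D(3)) (use * in auto)
    note A = quad_zero_half_turn[OF q this]
    show "quad_zero (inverse q) N (\<lambda>u v. ?L (i, m) (l, j) u v - ?L (l, j) (i, m) u v)"
      by (rule quad_zero_cong[OF quad_zero_scale[OF A, where c = "-1"]]) (use * in \<open>simp add: L\<close>)
    have "quad_zero q N (\<lambda>u v. leibniz K \<xi> (half_turn N (l, m)) (half_turn N (i, j)) u v - leibniz K \<xi> (half_turn N (i, j)) (half_turn N (l, m)) u v
            - (q - inverse q) * leibniz K \<xi> (half_turn N (l, j)) (half_turn N (i, m)) u v)"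
      unfolding r by (rule D(4)) (use * in auto)
    note B = quad_zero_half_turn[OF q this]
    show "quad_zero (inverse q) N (\<lambda>u v. ?L (i, j) (l, m) u v - ?L (l, m) (i, j) u v
          - (inverse q - inverse (inverse q)) * ?L (i, m) (l, j) u v)"
      by (rule quad_zero_cong[OF quad_zero_scale[OF quad_zero_diff[OF B A, of "inverse q - q"], of "-1"]])
         (use * in \<open>simp add: L algebra_simps\<close>)
  next
    fix i j m assume *: "i < N" "j < N" "m < N" "j < m"
    have "quad_zero q N (\<lambda>u v. leibniz K \<xi> (half_turn N (i, m)) (half_turn N (i, j)) u v - q * leibniz K \<xi> (half_turn N (i, j)) (half_turn N (i, m)) u v)"
      unfolding r by (rule D(1)[where l = 0]) (use * in auto)
    note A = quad_zero_half_turn[OF q this]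
    show "quad_zero (inverse q) N (\<lambda>u v. ?L (i, j) (i, m) u v - inverse q * ?L (i, m) (i, j) u v)"
      by (rule quad_zero_cong[OF quad_zero_scale[OF A, of "- inverse q"]])
         (use * q in \<open>simp add: L algebra_simps\<close>)
  next
    fix i l j assume *: "i < N" "l < N" "j < N" "i < l"
    have "quad_zero q N (\<lambda>u v. leibniz K \<xi> (half_turn N (l, j)) (half_turn N (i, j)) u v - q * leibniz K \<xi> (half_turn N (i, j)) (half_turn N (l, j)) u v)"
      unfolding r by (rule D(2)[where m = 0]) (use * in auto)
    note A = quad_zero_half_turn[OF q this]
    show "quad_zero (inverse q) N (\<lambda>u v. ?L (i, j) (l, j) u v - inverse q * ?L (l, j) (i, j) u v)"
      by (rule quad_zero_cong[OF quad_zero_scale[OF A, of "- inverse q"]])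
         (use * q in \<open>simp add: L algebra_simps\<close>)
  qed
qed

lemma skew_derivation_cong_K:
  assumes "skew_derivation p N K Y"
    and "\<And>a u. a \<in> {..<N} \<times> {..<N} \<Longrightarrow> u \<in> {..<N} \<times> {..<N} \<Longrightarrow> K' a u = K a u"
  shows "skew_derivation p N K' Y"
proof -
  have L: "leibniz K' Y a b u v = leibniz K Y a b u v"
    if "a \<in> {..<N} \<times> {..<N}" "u \<in> {..<N} \<times> {..<N}" for a b u v
    using assms(2)[OF that] by (simp add: leibniz_def)
  note D = skew_derivationD[OF assms(1)]
  show ?thesis unfolding skew_derivation_def
    apply (intro conjI allI impI)
    subgoal by (rule quad_zero_cong[OF D(1)[where l = 0]]) (auto simp: L)
    subgoal by (rule quad_zero_cong[OF D(2)[where m = 0]]) (auto simp: L)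
    subgoal by (rule quad_zero_cong[OF D(3)]) (auto simp: L)
    subgoal by (rule quad_zero_cong[OF D(4)]) (auto simp: L)
    done
qed

section \<open>Skew derivations twisted by a torus element\<close>

lemma fresh_index:
  assumes "3 \<le> (N::nat)"
  shows "\<exists>m<N. m \<noteq> i \<and> m \<noteq> j"
proof -
  have "0 < N" "1 < N" "2 < N" using assms by auto
  moreover have "(0::nat) \<noteq> 1" "(0::nat) \<noteq> 2" "(1::nat) \<noteq> 2" by auto
  ultimately show ?thesis by metis
qed

text \<open>
  Here \<open>g\<close> multiplies \<open>Y\<^sub>a\<close> by \<open>\<alpha> a\<close>. The assumption \<open>minor\<close> expresses that the matrix \<open>\<alpha>\<close> has rank
  one, and \<open>eig\<close> is \<open>g x = \<mu> x g\<close>.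
\<close>

locale torus_skew =
  fixes q \<mu> :: "'k::field" and N :: nat
    and \<alpha> :: "nat \<times> nat \<Rightarrow> 'k" and \<xi> :: "nat \<times> nat \<Rightarrow> nat \<times> nat \<Rightarrow> 'k"
  assumes q0: "q \<noteq> 0" and q2: "q * q \<noteq> 1" and lam: "\<mu> * \<mu> \<noteq> 1" and N3: "3 \<le> N"
    and al0: "\<And>i j. i < N \<Longrightarrow> j < N \<Longrightarrow> \<alpha> (i, j) \<noteq> 0"
    and minor: "\<And>i j k l. i < N \<Longrightarrow> j < N \<Longrightarrow> k < N \<Longrightarrow> l < N \<Longrightarrow>
                  \<alpha> (i, j) * \<alpha> (k, l) = \<alpha> (i, l) * \<alpha> (k, j)"
    and eig: "\<And>i j k l. i < N \<Longrightarrow> j < N \<Longrightarrow> k < N \<Longrightarrow> l < N \<Longrightarrow> \<xi> (i, j) (k, l) \<noteq> 0 \<Longrightarrow>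
                \<alpha> (k, l) = \<mu> * \<alpha> (i, j)"
    and sd: "skew_derivation q N (\<lambda>a u. if u = a then \<alpha> a else 0) \<xi>"
begin

lemma qinv: "inverse q - q \<noteq> 0" "q - inverse q \<noteq> 0"
  using q0 q2 by (auto simp: field_simps)

lemma lam1: "\<mu> \<noteq> 1" using lam by auto

lemma transposed: "torus_skew q \<mu> N (\<lambda>a. \<alpha> (tr a)) (\<lambda>a b. \<xi> (tr a) (tr b))"
proof unfold_locales
  have "(if tr u = tr a then \<alpha> (tr a) else 0) = (if u = a then \<alpha> (tr a) else 0)" for u a :: "nat \<times> nat"
    by (cases u; cases a) auto
  then show "skew_derivation q N (\<lambda>a u. if u = a then \<alpha> (tr a) else 0) (\<lambda>a b. \<xi> (tr a) (tr b))"
    using skew_derivation_tr[OF sd] by simp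
qed (use q0 q2 lam N3 al0 minor eig in \<open>auto simp: mult.commute\<close>)

lemma reversed: "torus_skew (inverse q) \<mu> N (\<lambda>a. \<alpha> (half_turn N a)) (\<lambda>a b. \<xi> (half_turn N a) (half_turn N b))"
proof unfold_locales
  show "skew_derivation (inverse q) N (\<lambda>a u. if u = a then \<alpha> (half_turn N a) else 0)
      (\<lambda>a b. \<xi> (half_turn N a) (half_turn N b))"
    by (rule skew_derivation_cong_K[OF skew_derivation_half_turn[OF q0 sd]]) (auto simp: half_turn_def)
qed (use q0 q2 lam N3 al0 minor eig in \<open>auto simp: half_turn_def field_simps\<close>)

text \<open>
  The relations of \<open>Y\<^sub>i\<^sub>j\<close> with the target and with the two entries \<open>(i, n)\<close> and \<open>(k, j)\<close> that complete
  a rectangle force the weight 1 at these three positions. As \<open>\<alpha>\<close> has rank one, the weight of the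
  source is 1 as well, against \<open>\<mu> \<noteq> 1\<close>.
\<close>

lemma no_anti_move:
  assumes "i < k" "n < j" "k < N" "j < N"
  shows "\<xi> (i, j) (k, n) = 0"
proof (rule ccontr)
  assume y: "\<xi> (i, j) (k, n) \<noteq> 0"
  have b: "i < N" "n < N" using assms by auto
  have "\<alpha> (k, n) = 1"
    using quad_zeroD(1)[OF skew_derivationD(3)[OF sd, of i n k j], of k n 0 0] assms b y
    by (simp add: leibniz_def)
  moreover have "\<alpha> (i, n) = 1"
    using quad_zeroD(3)[OF skew_derivationD(1)[OF sd, of i n 0 j], of i n k 0] assms b y q0
    by (simp add: leibniz_def)
  moreover have "\<alpha> (k, j) = 1"
    using quad_zeroD(2)[OF skew_derivationD(2)[OF sd, of i j k 0], of k n 0 j] assms b y q0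
    by (simp add: leibniz_def)
  ultimately have "\<mu> = 1"
    using minor[of i j k n] eig[OF _ _ _ _ y] assms b by simp
  then show False using lam1 by simp
qed

text \<open>
  The entry \<open>(i, m)\<close> lies in the row of the source and diagonally above the target. Applying \<open>x\<close> to the
  relation between \<open>Y\<^sub>i\<^sub>m\<close> and \<open>Y\<^sub>i\<^sub>j\<close> yields a relation between \<open>Y\<^sub>i\<^sub>m Y\<^sub>k\<^sub>n\<close> and \<open>Y\<^sub>k\<^sub>n Y\<^sub>i\<^sub>m\<close>. These two
  products are linearly independent because \<open>(i, m)\<close> and \<open>(k, n)\<close> are in diagonal position.
\<close>

lemma no_diag_move_left:
  assumes "i < k" "j < n" "k < N" "n < N" "m < n" "m \<noteq> j"
  shows "\<xi> (i, j) (k, n) = 0"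
proof -
  have b: "i < N" "j < N" "m < N" using assms by auto
  have "\<alpha> (i, m) * \<xi> (i, j) (k, n) = 0"
  proof (cases "j < m")
    case True
    then show ?thesis
      using quad_zeroD(5)[OF skew_derivationD(1)[OF sd, of i j 0 m], of i m k n]
        quad_zeroD(4)[OF skew_derivationD(1)[OF sd, of i j 0 m], of i m k n] assms b q0 qinv
      by (auto simp: leibniz_def)
  next
    case False
    then show ?thesis
      using quad_zeroD(5)[OF skew_derivationD(1)[OF sd, of i m 0 j], of i m k n]
        quad_zeroD(4)[OF skew_derivationD(1)[OF sd, of i m 0 j], of i m k n] assms b q0 qinv
      by (auto simp: leibniz_def)
  qed
  then show ?thesis using al0 assms b by simp
qed

text \<open>
  There are a further row \<open>m'\<close> and a further column \<open>m\<close>, since \<open>N \<ge> 3\<close>. If \<open>m\<close> is left of the target, or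
  \<open>m'\<close> above it, the preceding obstruction or its transpose applies. Otherwise \<open>(m', m)\<close> is diagonally
  below the target, and its relation with the source is the obstruction.
\<close>

lemma no_diag_move:
  assumes "i < k" "j < n" "k < N" "n < N"
  shows "\<xi> (i, j) (k, n) = 0"
proof -
  have b: "i < N" "j < N" using assms by auto
  obtain m m' where m: "m < N" "m \<noteq> j" "m \<noteq> n" and m': "m' < N" "m' \<noteq> i" "m' \<noteq> k"
    using fresh_index[OF N3] by metis
  consider "m < n" | "m' < k" | "n < m" "k < m'" using m m' by linarith
  then show ?thesis
  proof cases
    case 1
    then show ?thesis using no_diag_move_left assms m by blast
  next
    case 2
    interpret T: torus_skew q \<mu> N "\<lambda>a. \<alpha> (tr a)" "\<lambda>a b. \<xi> (tr a) (tr b)" by (rule transposed)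
    show ?thesis using T.no_diag_move_left[of j n i k m'] assms m' 2 by simp
  next
    case 3
    then show ?thesis
      using quad_zeroD(5)[OF skew_derivationD(4)[OF sd, of i j m' m], of k n m' m] assms b m m' qinv
      by (simp add: leibniz_def)
  qed
qed

text \<open>
  An entry is not moved to itself because \<open>\<mu> \<noteq> 1\<close>, and the half turn reduces moves upwards to moves
  downwards.
\<close>

lemma straight_move:
  assumes y: "\<xi> (i, j) (k, n) \<noteq> 0" and b: "i < N" "j < N" "k < N" "n < N"
  shows "i = k \<and> j \<noteq> n \<or> j = n \<and> i \<noteq> k"
proof -
  interpret T: torus_skew "inverse q" \<mu> N "\<lambda>a. \<alpha> (half_turn N a)" "\<lambda>a b. \<xi> (half_turn N a) (half_turn N b)"
    by (rule reversed)
  have "i \<noteq> k \<or> j \<noteq> n" using eig[OF b y] lam1 al0 b by auto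
  moreover have False if "i < k" "j \<noteq> n"
    using that no_anti_move[of i k n j] no_diag_move[of i k j n] y b by linarith
  moreover have False if "k < i" "j \<noteq> n"
  proof -
    have k: "N - 1 - i < N - 1 - k" "N - 1 - k < N" "N - 1 - n < N" "N - 1 - j < N"
      using that b by linarith+
    have "\<xi> (half_turn N (N - 1 - i, N - 1 - j)) (half_turn N (N - 1 - k, N - 1 - n)) = 0"
    proof (cases "j < n")
      case True
      then have "N - 1 - n < N - 1 - j" using b by linarith
      then show ?thesis using T.no_anti_move k by blast
    next
      case False
      then have "N - 1 - j < N - 1 - n" using b that by linarith
      then show ?thesis using T.no_diag_move k by blast
    qed
    then show False using y b by (simp add: half_turn_def)
  qed
  ultimately show ?thesis by (meson linorder_neqE_nat)
qed

text \<open>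
  Source and target lie in the same column; \<open>x\<close> turns both sides of their relation into multiples of
  the square of the target.
\<close>

lemma down_move_target:
  assumes "\<xi> (i, j) (k, j) \<noteq> 0" "i < k" "k < N" "j < N"
  shows "\<alpha> (k, j) = inverse q"
  using quad_zeroD(1)[OF skew_derivationD(2)[OF sd, of i j k 0], of k j 0 0] assms q0
  by (auto simp: leibniz_def field_simps)

lemma move_target:
  assumes y: "\<xi> (i, j) (k, n) \<noteq> 0" and b: "i < N" "j < N" "k < N" "n < N"
  shows "\<alpha> (k, n) = q \<or> \<alpha> (k, n) = inverse q"
proof -
  interpret T: torus_skew q \<mu> N "\<lambda>a. \<alpha> (tr a)" "\<lambda>a b. \<xi> (tr a) (tr b)" by (rule transposed)
  interpret V: torus_skew "inverse q" \<mu> N "\<lambda>a. \<alpha> (half_turn N a)" "\<lambda>a b. \<xi> (half_turn N a) (half_turn N b)"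
    by (rule reversed)
  interpret VT: torus_skew "inverse q" \<mu> N "\<lambda>a. \<alpha> (tr (half_turn N a))" "\<lambda>a b. \<xi> (tr (half_turn N a)) (tr (half_turn N b))"
    by (rule T.reversed)
  consider "j = n" "i < k" | "j = n" "k < i" | "i = k" "j < n" | "i = k" "n < j"
    using straight_move[OF y b] by linarith
  then show ?thesis
  proof cases
    case 1 then show ?thesis using down_move_target[of i j k] y b by simp
  next
    case 2 then show ?thesis
      using V.down_move_target[of "N - 1 - i" "N - 1 - j" "N - 1 - k"] y b by (simp add: half_turn_def)
  next
    case 3 then show ?thesis using T.down_move_target[of j i n] y b by simp
  next
    case 4 then show ?thesis
      using VT.down_move_target[of "N - 1 - j" "N - 1 - i" "N - 1 - n"] y b by (simp add: half_turn_def)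
  qed
qed

text \<open>
  The three equations relate the coefficients of a downward move in two columns \<open>j < m\<close>. The first
  two come from the relation between \<open>Y\<^sub>i\<^sub>j\<close> and \<open>Y\<^sub>i\<^sub>m\<close> in the source row, the third from the one
  between \<open>Y\<^sub>i\<^sub>j\<close> and \<open>Y\<^sub>k\<^sub>m\<close>.
\<close>

lemma down_rel1:
  assumes "i < k" "j < m" "k < N" "m < N"
  shows "\<xi> (i, m) (k, m) * (\<alpha> (i, j) - q) = 0"
  using quad_zeroD(4)[OF skew_derivationD(1)[OF sd, of i j 0 m], of i j k m] assms
  by (simp add: leibniz_def algebra_simps)

lemma down_rel2:
  assumes "i < k" "j < m" "k < N" "m < N"
  shows "\<xi> (i, j) (k, j) * (1 - q * \<alpha> (i, m)) + (q - inverse q) * \<alpha> (i, j) * \<xi> (i, m) (k, m) = 0"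
  using quad_zeroD(5)[OF skew_derivationD(1)[OF sd, of i j 0 m], of i j k m] assms
  by (simp add: leibniz_def algebra_simps)

lemma down_rel3:
  assumes "i < k" "j < m" "k < N" "m < N"
  shows "\<xi> (i, j) (k, j) * (q - \<alpha> (k, m)) = (q - inverse q) * \<xi> (i, m) (k, m)"
  using quad_zeroD(2)[OF skew_derivationD(4)[OF sd, of i j k m], of k j 0 m] assms
  by (simp add: leibniz_def algebra_simps)

lemma row_ratio:
  assumes "\<xi> (i, n) (k, n) \<noteq> 0" "i < N" "k < N" "n < N" "j < N"
  shows "\<alpha> (k, j) = \<mu> * \<alpha> (i, j)"
proof -
  have "\<alpha> (i, n) * \<alpha> (k, j) = \<alpha> (i, n) * (\<mu> * \<alpha> (i, j))"
    using minor[of i n k j] eig[of i n k n] assms by (simp add: mult_ac)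
  then show ?thesis using al0 assms by simp
qed

text \<open>
  If the move takes place in a column other than the first, it spreads to all columns. To the left
  this is immediate from \<open>down_rel1\<close> and \<open>down_rel2\<close>. To the right, eliminating the unknown coefficient
  from \<open>down_rel2\<close> and \<open>down_rel3\<close> determines the weight, once \<open>q\<^sup>2 + 1\<close> is known to be invertible;
  this holds because \<open>\<mu> = q\<^sup>-\<^sup>2\<close> differs from \<open>-1\<close>.
\<close>

lemma full_down_coeffs:
  assumes y: "\<xi> (i, m) (k, m) \<noteq> 0" and m: "0 < m" and b: "i < k" "k < N" "m < N"
  shows "\<mu> * q * q = 1"
    and "j < N \<Longrightarrow> \<xi> (i, j) (k, j) \<noteq> 0"
    and "j < N \<Longrightarrow> \<alpha> (i, j) = q"
    and "j < N \<Longrightarrow> \<alpha> (k, j) = inverse q"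
proof -
  have i: "i < N" using b by simp
  have left: "\<alpha> (i, j) = q" "\<xi> (i, j) (k, j) \<noteq> 0" if "j < m" for j
  proof -
    show a: "\<alpha> (i, j) = q" using down_rel1[of i k j m] that b y by simp
    show "\<xi> (i, j) (k, j) \<noteq> 0"
      using down_rel2[of i k j m] that b y a q0 qinv by auto
  qed
  have target: "\<alpha> (k, j) = inverse q" if "\<xi> (i, j) (k, j) \<noteq> 0" "j < N" for j
    using down_move_target that b by blast
  have "inverse q = \<mu> * q"
    using target[of 0] left[of 0] m b i row_ratio[OF y i b(2,3), of 0] by simp
  then show mu: "\<mu> * q * q = 1" using q0 by (metis left_inverse)
  \<comment> \<open>otherwise \<open>\<mu> = q\<^sup>-\<^sup>2 = -1\<close>, against \<open>\<mu>\<^sup>2 \<noteq> 1\<close>\<close>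
  have q4: "q * q + 1 \<noteq> 0"
  proof
    assume "q * q + 1 = 0"
    then have "q * q = - 1" by (simp add: eq_neg_iff_add_eq_0)
    then have "\<mu> = - 1" using mu by (metis minus_equation_iff mult.assoc mult.right_neutral mult_minus_right)
    then show False using lam by simp
  qed
  have am: "\<alpha> (i, m) = q"
  proof -
    have "\<mu> * \<alpha> (i, m) = \<mu> * q"
      using row_ratio[OF y i b(2,3,3)] target[OF y b(3)] \<open>inverse q = \<mu> * q\<close> by auto
    moreover have "\<mu> \<noteq> 0" using mu by auto
    ultimately show ?thesis by auto
  qed
  have right: "\<alpha> (i, j) = q" "\<xi> (i, j) (k, j) \<noteq> 0" if j: "m < j" "j < N" for j
  proof -
    define y where "y = \<xi> (i, m) (k, m)"
    define z where "z = \<xi> (i, j) (k, j)"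
    define s where "s = \<alpha> (i, j)"
    have y0: "y \<noteq> 0" using y by (simp add: y_def)
    have e2: "y * (1 - q * s) + (q - inverse q) * q * z = 0"
      using down_rel2[OF b(1) j(1) b(2) j(2)] am by (simp add: y_def z_def s_def)
    have "\<alpha> (k, j) = inverse q * inverse q * s"
    proof -
      have "\<mu> = inverse q * inverse q" using mu q0 by (simp add: field_simps)
      then show ?thesis using row_ratio[OF y i b(2,3) j(2)] by (simp add: s_def)
    qed
    then have e3: "y * (q - inverse q * inverse q * s) = (q - inverse q) * z"
      using down_rel3[OF b(1) j(1) b(2) j(2)] by (simp add: y_def z_def s_def)
    \<comment> \<open>insert \<open>e3\<close> into \<open>e2\<close> to eliminate \<open>z\<close>\<close>
    have "y * (1 - q * s) + q * (y * (q - inverse q * inverse q * s)) = 0"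
      using e2 e3 by (simp add: mult_ac)
    moreover have "q * (y * (1 - q * s) + q * (y * (q - inverse q * inverse q * s)))
        = y * ((q * q + 1) * (q - s))"
      using q0 by (simp add: field_simps)
    ultimately have "y * ((q * q + 1) * (q - s)) = 0" by simp
    then have s: "s = q" using y0 q4 by simp
    then show "\<alpha> (i, j) = q" by (simp add: s_def)
    have "y * (q - inverse q) = (q - inverse q) * z" using e3 s q0 by (simp add: mult.assoc)
    then have "y = z" using qinv by simp
    then show "\<xi> (i, j) (k, j) \<noteq> 0" using y0 by (simp add: z_def)
  qed
  show "\<xi> (i, j) (k, j) \<noteq> 0" if "j < N" for j
    using left right y that by (metis linorder_neqE_nat)
  then show "j < N \<Longrightarrow> \<alpha> (k, j) = inverse q" using target by blast
  show "j < N \<Longrightarrow> \<alpha> (i, j) = q" using left right am by (metis linorder_neqE_nat)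
qed

text \<open>
  Suppose that row \<open>i + 1\<close> lies strictly between rows \<open>i\<close> and \<open>k\<close>. In the relation between \<open>Y\<^sub>i\<^sub>0\<close> and an
  entry of column 1 in row \<open>i + 1\<close>, the extra term contains \<open>Y\<^sub>i\<^sub>1\<close>. Moving that factor to row \<open>k\<close>
  produces a product that no other term cancels.
\<close>

lemma full_down_adjacent:
  assumes y: "\<And>j. j < N \<Longrightarrow> \<xi> (i, j) (k, j) \<noteq> 0" and b: "i < k" "k < N"
  shows "k = Suc i"
proof (rule ccontr)
  assume "k \<noteq> Suc i"
  then have l: "i < Suc i" "Suc i < k" using b by auto
  have "\<xi> (i, 1) (k, 1) = 0"
    using quad_zeroD(4)[OF skew_derivationD(4)[OF sd, of i 0 "Suc i" 1], of "Suc i" 0 k 1] l b N3 qinv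
    by (simp add: leibniz_def)
  then show False using y N3 by simp
qed

lemma full_down_other:
  assumes y: "\<xi> (i, j) (k, j) \<noteq> 0" and b: "i < k" "k < N" "j < N" and l: "l < N" "l < i \<or> k < l"
  shows "\<alpha> (l, j) = 1"
  using l(2)
proof
  assume "l < i"
  then show ?thesis
    using quad_zeroD(3)[OF skew_derivationD(2)[OF sd, of l j i 0], of l j k 0] b l y q0
    by (simp add: leibniz_def)
next
  assume "k < l"
  then show ?thesis
    using quad_zeroD(3)[OF skew_derivationD(2)[OF sd, of i j l 0], of k j l 0] b l y q0
    by (simp add: leibniz_def)
qed

text \<open>
  When the first column is the only one to move, the equations for columns 0 and 1 give all weights
  that matter. A row above \<open>i\<close> would have weight 1 in both of these columns, against their ratio
  \<open>q\<^sup>2\<close>; a row below \<open>k\<close> would give a diagonal relation whose image under \<open>x\<close> has the nonzero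
  coefficient \<open>q - q\<^sup>-\<^sup>1\<close>.
\<close>

lemma corner_down:
  assumes y: "\<xi> (i, 0) (k, 0) \<noteq> 0" and z: "\<And>j. 0 < j \<Longrightarrow> j < N \<Longrightarrow> \<xi> (i, j) (k, j) = 0"
    and b: "i < k" "k < N"
  shows "i = 0" "k = N - 1" "\<mu> = q * q" "l < N \<Longrightarrow> \<alpha> (l, 1) = q * q * \<alpha> (l, 0)"
proof -
  have n: "1 < N" "0 < N" "i < N" using N3 b by auto
  have z1: "\<xi> (i, Suc 0) (k, Suc 0) = 0" using z[of 1] n by simp
  have ai1: "q * \<alpha> (i, 1) = 1"
    using down_rel2[of i k 0 1] b n y z1 by simp
  have ak1: "\<alpha> (k, 1) = q"
    using down_rel3[of i k 0 1] b n y z1 by simp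
  have ak0: "\<alpha> (k, 0) = inverse q" using down_move_target[OF y] b n by simp
  have "\<alpha> (k, 1) = \<mu> * \<alpha> (i, 1)" using row_ratio[OF y, of 1] b n by simp
  then show mu: "\<mu> = q * q" using ai1 ak1 by (metis mult.assoc mult.commute mult.right_neutral)
  have ratio: "\<alpha> (l, 1) = q * q * \<alpha> (l, 0)" if "l < N" for l
  proof -
    have "\<alpha> (k, 0) * \<alpha> (l, 1) = \<alpha> (k, 0) * (q * q * \<alpha> (l, 0))"
      using minor[of k 0 l 1] ak0 ak1 that b n q0 by (simp add: mult.assoc)
    then show ?thesis using ak0 q0 by simp
  qed
  then show "l < N \<Longrightarrow> \<alpha> (l, 1) = q * q * \<alpha> (l, 0)" .
  show "i = 0"
  proof (rule ccontr)
    assume "i \<noteq> 0"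
    then have i: "0 < i" by simp
    have "\<alpha> (0, 1) = 1"
      using quad_zeroD(5)[OF skew_derivationD(3)[OF sd, of 0 0 i 1], of 0 0 k 1] i b n y
      by (simp add: leibniz_def)
    moreover have "\<alpha> (0, 0) = 1" using full_down_other[OF y, of 0] i b n by simp
    ultimately show False using ratio[of 0] n q2 by simp
  qed
  show "k = N - 1"
  proof (rule ccontr)
    assume "k \<noteq> N - 1"
    then have k: "k < N - 1" using b by simp
    have "(q - inverse q) * \<xi> (i, 0) (k, 0) = 0"
      using quad_zeroD(5)[OF skew_derivationD(4)[OF sd, of i 0 "N - 1" 1], of k 0 "N - 1" 1] k b n y z1
      by (simp add: leibniz_def)
    then show False using y qinv by simp
  qed
qed

end

section \<open>Slots for moves\<close>

text \<open>
  The alternatives are moves downwards and upwards. Both have the same weights and are told apart by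
  the eigenvalue \<open>\<mu>\<close>.
\<close>

definition full_row ::
  "'k::field \<Rightarrow> 'k \<Rightarrow> nat \<Rightarrow> (nat \<times> nat \<Rightarrow> 'k) \<Rightarrow> (nat \<times> nat \<Rightarrow> nat \<times> nat \<Rightarrow> 'k) \<Rightarrow> nat \<Rightarrow> bool" where
  "full_row q \<mu> N \<alpha> \<xi> t \<longleftrightarrow>
     (\<forall>j<N. \<alpha> (t, j) = q \<and> \<alpha> (Suc t, j) = inverse q) \<and>
     (\<forall>l<N. \<forall>j<N. l \<noteq> t \<longrightarrow> l \<noteq> Suc t \<longrightarrow> \<alpha> (l, j) = 1) \<and>
     (\<mu> * q * q = 1 \<and> (\<forall>j<N. \<xi> (t, j) (Suc t, j) \<noteq> 0) \<or>
      \<mu> = q * q \<and> (\<forall>j<N. \<xi> (Suc t, j) (t, j) \<noteq> 0))"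

text \<open>
  A move between two corners within a row goes into the slot of the two rows at that border of the
  matrix: by the condition on the weights, it is full moves between these two rows that cannot
  coexist with it.
\<close>

definition corner ::
  "'k::field \<Rightarrow> 'k \<Rightarrow> nat \<Rightarrow> (nat \<times> nat \<Rightarrow> 'k) \<Rightarrow> (nat \<times> nat \<Rightarrow> nat \<times> nat \<Rightarrow> 'k) \<Rightarrow> nat \<Rightarrow> bool" where
  "corner q \<mu> N \<alpha> \<xi> t \<longleftrightarrow>
     (\<forall>l<N. \<alpha> (Suc t, l) = q * q * \<alpha> (t, l)) \<and>
     (t = 0 \<and> \<mu> = q * q \<and> \<xi> (0, 0) (0, N - 1) \<noteq> 0 \<or>
      t = N - 2 \<and> \<mu> * q * q = 1 \<and> \<xi> (N - 1, N - 1) (N - 1, 0) \<noteq> 0)"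

definition row_slot ::
  "'k::field \<Rightarrow> 'k \<Rightarrow> nat \<Rightarrow> (nat \<times> nat \<Rightarrow> 'k) \<Rightarrow> (nat \<times> nat \<Rightarrow> nat \<times> nat \<Rightarrow> 'k) \<Rightarrow> nat \<Rightarrow> bool" where
  "row_slot q \<mu> N \<alpha> \<xi> t \<longleftrightarrow> Suc t < N \<and> (full_row q \<mu> N \<alpha> \<xi> t \<or> corner q \<mu> N \<alpha> \<xi> t)"

text \<open>
  The first component of a slot tells columns (\<open>True\<close>) from rows.
\<close>

definition slot ::
  "'k::field \<Rightarrow> 'k \<Rightarrow> nat \<Rightarrow> (nat \<times> nat \<Rightarrow> 'k) \<Rightarrow> (nat \<times> nat \<Rightarrow> nat \<times> nat \<Rightarrow> 'k) \<Rightarrow> bool \<times> nat \<Rightarrow> bool" where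
  "slot q \<mu> N \<alpha> \<xi> s \<longleftrightarrow>
     (if fst s then row_slot q \<mu> N (\<lambda>a. \<alpha> (tr a)) (\<lambda>a b. \<xi> (tr a) (tr b)) (snd s)
      else row_slot q \<mu> N \<alpha> \<xi> (snd s))"

context torus_skew
begin

lemma down_move_cases:
  assumes y: "\<xi> (i, n) (k, n) \<noteq> 0" and b: "i < k" "k < N" "n < N"
  obtains (full) "k = Suc i" "\<mu> * q * q = 1" "\<And>j. j < N \<Longrightarrow> \<xi> (i, j) (k, j) \<noteq> 0"
      "\<And>j. j < N \<Longrightarrow> \<alpha> (i, j) = q" "\<And>j. j < N \<Longrightarrow> \<alpha> (k, j) = inverse q"
      "\<And>l j. l < N \<Longrightarrow> j < N \<Longrightarrow> l \<noteq> i \<Longrightarrow> l \<noteq> k \<Longrightarrow> \<alpha> (l, j) = 1"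
  | (corner) "i = 0" "k = N - 1" "n = 0" "\<mu> = q * q" "\<And>l. l < N \<Longrightarrow> \<alpha> (l, 1) = q * q * \<alpha> (l, 0)"
proof (cases "\<exists>m>0. m < N \<and> \<xi> (i, m) (k, m) \<noteq> 0")
  case True
  then obtain m where m: "\<xi> (i, m) (k, m) \<noteq> 0" "0 < m" "m < N" by blast
  note F = full_down_coeffs[OF m(1,2) b(1,2) m(3)]
  have k: "k = Suc i" by (rule full_down_adjacent[OF F(2) b(1,2)])
  show ?thesis
  proof (rule full)
    show "\<alpha> (l, j) = 1" if "l < N" "j < N" "l \<noteq> i" "l \<noteq> k" for l j
      using full_down_other[OF F(2) b(1,2), of j l] that k by linarith
  qed (use k F in auto)
next
  case False
  then have "n = 0" using y b by auto
  have z: "\<xi> (i, j) (k, j) = 0" if "0 < j" "j < N" for j using False that by blast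
  note C = corner_down[OF y[unfolded \<open>n = 0\<close>] z b(1,2)]
  show ?thesis by (rule corner) (use C \<open>n = 0\<close> in auto)
qed

lemma row_move_slot:
  assumes y: "\<xi> (i, n) (k, n) \<noteq> 0" and b: "i < N" "k < N" "n < N" "i \<noteq> k"
  shows "\<exists>s\<in>UNIV \<times> {..<N - 1}. slot q \<mu> N \<alpha> \<xi> s"
proof (cases "i < k")
  case True
  from y True b(2,3) show ?thesis
  proof (cases rule: down_move_cases)
    case full
    then have "full_row q \<mu> N \<alpha> \<xi> i" by (auto simp: full_row_def)
    then have "slot q \<mu> N \<alpha> \<xi> (False, i)" using full(1) b by (simp add: slot_def row_slot_def)
    then show ?thesis using full(1) b(2) by (intro bexI[of _ "(False, i)"]) auto
  next
    case corner
    then have "corner q \<mu> N (\<lambda>a. \<alpha> (tr a)) (\<lambda>a b. \<xi> (tr a) (tr b)) 0"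
      using y by (auto simp: corner_def)
    then have "slot q \<mu> N \<alpha> \<xi> (True, 0)" using N3 by (simp add: slot_def row_slot_def)
    then show ?thesis using N3 by (intro bexI[of _ "(True, 0)"]) auto
  qed
next
  case False
  then have ki: "N - 1 - i < N - 1 - k" using b by linarith
  interpret V: torus_skew "inverse q" \<mu> N "\<lambda>a. \<alpha> (half_turn N a)" "\<lambda>a b. \<xi> (half_turn N a) (half_turn N b)"
    by (rule reversed)
  have twice: "N - 1 - (N - 1 - x) = x" if "x < N" for x using that by simp
  have "\<xi> (half_turn N (N - 1 - i, N - 1 - n)) (half_turn N (N - 1 - k, N - 1 - n)) \<noteq> 0"
    using y b by (simp add: half_turn_def twice)
  moreover note ki
  moreover have "N - 1 - k < N" "N - 1 - n < N" using b by auto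
  ultimately show ?thesis
  proof (cases rule: V.down_move_cases)
    case full
    have i: "i = Suc k" using full(1) b by linarith
    have mu: "\<mu> = q * q" using full(2) q0 by (simp add: field_simps)
    have x: "\<xi> (i, j) (k, j) \<noteq> 0" if "j < N" for j
      using full(3)[of "N - 1 - j"] that b by (simp add: half_turn_def twice)
    have a1: "\<alpha> (i, j) = inverse q" if "j < N" for j
      using full(4)[of "N - 1 - j"] that b by (simp add: half_turn_def twice)
    have a2: "\<alpha> (k, j) = q" if "j < N" for j
      using full(5)[of "N - 1 - j"] that b by (simp add: half_turn_def twice)
    have a3: "\<alpha> (l, j) = 1" if "l < N" "j < N" "l \<noteq> i" "l \<noteq> k" for l j
    proof -
      have "N - 1 - l \<noteq> N - 1 - i" "N - 1 - l \<noteq> N - 1 - k" using that b by linarith+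
      then show ?thesis using full(6)[of "N - 1 - l" "N - 1 - j"] that b by (simp add: half_turn_def twice)
    qed
    have "full_row q \<mu> N \<alpha> \<xi> k"
      using mu x a1 a2 a3 by (simp add: full_row_def i)
    then have "slot q \<mu> N \<alpha> \<xi> (False, k)" using i b by (simp add: slot_def row_slot_def)
    then show ?thesis using i b(1) by (intro bexI[of _ "(False, k)"]) auto
  next
    case corner
    have i: "i = N - 1" and k: "k = 0" and n: "n = N - 1" using corner(1-3) b by linarith+
    have mu: "\<mu> * q * q = 1" using corner(4) q0 by (simp add: field_simps)
    have a: "\<alpha> (l, Suc (N - 2)) = q * q * \<alpha> (l, N - 2)" if "l < N" for l
    proof -
      have e: "Suc (N - 2) = N - 1" "N - 1 - 1 = N - 2" using N3 by auto
      have "\<alpha> (l, N - 2) = inverse q * inverse q * \<alpha> (l, N - 1)"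
        using corner(5)[of "N - 1 - l"] that by (simp add: half_turn_def twice e numeral_2_eq_2)
      then show ?thesis using q0 by (simp add: e field_simps)
    qed
    have "corner q \<mu> N (\<lambda>a. \<alpha> (tr a)) (\<lambda>a b. \<xi> (tr a) (tr b)) (N - 2)"
      using y mu a unfolding corner_def i k n by simp
    then have "slot q \<mu> N \<alpha> \<xi> (True, N - 2)" using N3 by (simp add: slot_def row_slot_def)
    then show ?thesis using N3 by (intro bexI[of _ "(True, N - 2)"]) auto
  qed
qed

lemma slot_tr:
  "slot q \<mu> N (\<lambda>a. \<alpha> (tr a)) (\<lambda>a b. \<xi> (tr a) (tr b)) (s, t) = slot q \<mu> N \<alpha> \<xi> (\<not> s, t)"
  by (simp add: slot_def)

lemma move_slot:
  assumes y: "\<xi> a c \<noteq> 0" and a: "a \<in> {..<N} \<times> {..<N}" and c: "c \<in> {..<N} \<times> {..<N}"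
  shows "\<exists>s\<in>UNIV \<times> {..<N - 1}. slot q \<mu> N \<alpha> \<xi> s"
proof -
  obtain i j k n where ac: "a = (i, j)" "c = (k, n)" by (cases a; cases c)
  have b: "i < N" "j < N" "k < N" "n < N" using a c by (auto simp: ac)
  interpret T: torus_skew q \<mu> N "\<lambda>a. \<alpha> (tr a)" "\<lambda>a b. \<xi> (tr a) (tr b)" by (rule transposed)
  consider "j = n" "i \<noteq> k" | "i = k" "j \<noteq> n" using straight_move[of i j k n] y b ac by blast
  then show ?thesis
  proof cases
    case 1
    then show ?thesis using row_move_slot[of i n k] y b ac by simp
  next
    case 2
    then obtain s where "s \<in> UNIV \<times> {..<N - 1}" "slot q \<mu> N (\<lambda>a. \<alpha> (tr a)) (\<lambda>a b. \<xi> (tr a) (tr b)) s"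
      using T.row_move_slot[of j i n] y b ac by auto
    then show ?thesis using slot_tr by (intro bexI[of _ "(\<not> fst s, snd s)"]) (auto simp: slot_def)
  qed
qed

end

text \<open>
  Two generators \<open>x\<^sub>i\<close> and \<open>x\<^sub>j\<close> with \<open>\<phi> = \<chi>\<^sub>j(g\<^sub>i)\<close> and \<open>\<psi> = \<chi>\<^sub>i(g\<^sub>j)\<close>. The last three assumptions are
  \<open>g\<^sub>i x\<^sub>j = \<phi> x\<^sub>j g\<^sub>i\<close>, \<open>g\<^sub>j x\<^sub>i = \<psi> x\<^sub>i g\<^sub>j\<close> and \<open>x\<^sub>i x\<^sub>j = \<phi> x\<^sub>j x\<^sub>i\<close>.
\<close>

locale torus_skew_pair =
  A: torus_skew q \<mu> N \<alpha> \<xi> + B: torus_skew q \<nu> N \<beta> Y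
  for q \<mu> \<nu> :: "'k::field" and N \<alpha> \<beta> \<xi> Y +
  fixes \<phi> \<psi> :: 'k
  assumes phi_psi: "\<phi> * \<psi> = 1"
    and phi: "\<And>i j k l. i < N \<Longrightarrow> j < N \<Longrightarrow> k < N \<Longrightarrow> l < N \<Longrightarrow> Y (i, j) (k, l) \<noteq> 0 \<Longrightarrow>
                \<alpha> (k, l) = \<phi> * \<alpha> (i, j)"
    and psi: "\<And>i j k l. i < N \<Longrightarrow> j < N \<Longrightarrow> k < N \<Longrightarrow> l < N \<Longrightarrow> \<xi> (i, j) (k, l) \<noteq> 0 \<Longrightarrow>
                \<beta> (k, l) = \<psi> * \<beta> (i, j)"
    and comm: "\<And>a d. a \<in> {..<N} \<times> {..<N} \<Longrightarrow> d \<in> {..<N} \<times> {..<N} \<Longrightarrow>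
                (\<Sum>c\<in>{..<N} \<times> {..<N}. Y a c * \<xi> c d) = \<phi> * (\<Sum>c\<in>{..<N} \<times> {..<N}. \<xi> a c * Y c d)"
begin

lemma swapped: "torus_skew_pair q \<nu> \<mu> N \<beta> \<alpha> Y \<xi> \<psi> \<phi>"
proof unfold_locales
  show "(\<Sum>c\<in>{..<N} \<times> {..<N}. \<xi> a c * Y c d) = \<psi> * (\<Sum>c\<in>{..<N} \<times> {..<N}. Y a c * \<xi> c d)"
    if "a \<in> {..<N} \<times> {..<N}" "d \<in> {..<N} \<times> {..<N}" for a d
    using comm[OF that] phi_psi by (simp add: mult.assoc [symmetric] mult.commute)
qed (use phi_psi phi psi in \<open>auto simp: mult.commute\<close>)

lemma transposed_pair:
  "torus_skew_pair q \<mu> \<nu> N (\<lambda>a. \<alpha> (tr a)) (\<lambda>a. \<beta> (tr a)) (\<lambda>a b. \<xi> (tr a) (tr b)) (\<lambda>a b. Y (tr a) (tr b)) \<phi> \<psi>"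
proof -
  have swap: "(\<Sum>c\<in>{..<N} \<times> {..<N}. f (tr c)) = (\<Sum>c\<in>{..<N} \<times> {..<N}. f c)" for f :: "nat \<times> nat \<Rightarrow> 'k"
    by (rule sum.reindex_bij_witness[of _ tr tr]) auto
  show ?thesis
    apply (intro torus_skew_pair.intro A.transposed B.transposed torus_skew_pair_axioms.intro)
    subgoal by (rule phi_psi)
    subgoal using phi by auto
    subgoal using psi by auto
    subgoal premises prems for a d
      using comm[of "tr a" "tr d"] prems swap[of "\<lambda>c. Y (tr a) c * \<xi> c (tr d)"]
        swap[of "\<lambda>c. \<xi> (tr a) c * Y c (tr d)"] by auto
    done
qed

text \<open>
  The ratio of the weights \<open>\<alpha>\<close> along a common move is both \<open>\<mu>\<close> and \<open>\<phi>\<close>, and that of \<open>\<beta>\<close> is both \<open>\<nu>\<close> and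
  \<open>\<psi>\<close>.
\<close>

lemma common_move:
  assumes "\<xi> (i, j) (k, l) \<noteq> 0" "Y (i, j) (k, l) \<noteq> 0" and b: "i < N" "j < N" "k < N" "l < N"
  shows "\<mu> * \<nu> = 1"
proof -
  have "\<mu> = \<phi>" using A.eig[OF b assms(1)] phi[OF b assms(2)] A.al0 b by simp
  moreover have "\<nu> = \<psi>" using B.eig[OF b assms(2)] psi[OF b assms(1)] B.al0 b by simp
  ultimately show ?thesis using phi_psi by simp
qed

text \<open>
  The weights are consistent here, and the contradiction comes from \<open>x\<^sub>i x\<^sub>j = \<phi> x\<^sub>j x\<^sub>i\<close> at the entry
  \<open>b = (t + 1, 0)\<close>. The left side moves \<open>b\<close> up and down again, and no other path leads from \<open>b\<close> to \<open>b\<close>. The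
  right side vanishes because \<open>x\<^sub>i\<close> cannot move \<open>b\<close> at all: the target would have weight
  \<open>q\<^sup>-\<^sup>3\<close> instead of \<open>q\<close> or \<open>q\<^sup>-\<^sup>1\<close>.
\<close>

lemma down_up_conflict:
  assumes \<xi>: "full_row q \<mu> N \<alpha> \<xi> t" "\<mu> * q * q = 1" "\<xi> (t, 0) (Suc t, 0) \<noteq> 0"
    and Y: "full_row q \<nu> N \<beta> Y t" "\<nu> = q * q" "Y (Suc t, 0) (t, 0) \<noteq> 0"
    and t: "Suc t < N"
  shows False
proof -
  let ?b = "(Suc t, 0) :: nat \<times> nat"
  have N0: "0 < N" "t < N" using t by auto
  have q1: "q \<noteq> 1" "inverse q \<noteq> 1" "inverse q \<noteq> q" using A.q2 A.q0 A.qinv by auto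
  have "Y ?b c * \<xi> c ?b = 0" if c: "c \<in> {..<N} \<times> {..<N} - {(t, 0)}" for c
  proof (rule ccontr)
    assume "Y ?b c * \<xi> c ?b \<noteq> 0"
    then have y: "Y ?b c \<noteq> 0" by simp
    obtain k n where kn: "c = (k, n)" by (cases c)
    have b: "k < N" "n < N" using c by (auto simp: kn)
    have "\<beta> ?b = inverse q" using Y(1) N0 by (simp add: full_row_def)
    then have "\<beta> (k, n) = q"
      using B.eig[OF t N0(1) b] y Y(2) A.q0 by (simp add: kn)
    then have "k = t" using Y(1) b q1 unfolding full_row_def by metis
    then have "n = 0" using B.straight_move[of "Suc t" 0 k n] y b t N0 by (simp add: kn)
    then show False using \<open>k = t\<close> c by (simp add: kn)
  qed
  then have "(\<Sum>c\<in>{..<N} \<times> {..<N}. Y ?b c * \<xi> c ?b) = (\<Sum>c\<in>{(t, 0)}. Y ?b c * \<xi> c ?b)"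
    using N0 by (intro sum.mono_neutral_right) auto
  then have lhs: "(\<Sum>c\<in>{..<N} \<times> {..<N}. Y ?b c * \<xi> c ?b) \<noteq> 0" using \<xi>(3) Y(3) by simp
  have "\<xi> ?b c * Y c ?b = 0" if c: "c \<in> {..<N} \<times> {..<N}" for c
  proof (rule ccontr)
    assume "\<xi> ?b c * Y c ?b \<noteq> 0"
    then have x: "\<xi> ?b c \<noteq> 0" by simp
    obtain k n where kn: "c = (k, n)" by (cases c)
    have b: "k < N" "n < N" using c by (auto simp: kn)
    have "\<alpha> ?b = inverse q" using \<xi>(1) N0 by (simp add: full_row_def)
    then have "\<alpha> (k, n) = \<mu> * inverse q"
      using A.eig[OF t N0(1) b] x by (simp add: kn)
    moreover have "\<alpha> (k, n) = q \<or> \<alpha> (k, n) = inverse q"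
      using A.move_target[of "Suc t" 0 k n] x b t N0 by (simp add: kn)
    ultimately have "\<mu> = q * q \<or> \<mu> = 1" using A.q0 by (auto simp: field_simps)
    then show False using \<xi>(2) A.lam A.q2 by (auto simp: mult.assoc)
  qed
  then have "(\<Sum>c\<in>{..<N} \<times> {..<N}. \<xi> ?b c * Y c ?b) = 0" by (intro sum.neutral) auto
  then show False using comm[of ?b ?b] lhs t N0 by simp
qed

text \<open>
  The weights \<open>\<alpha>\<close> are constant in each row, so the corner move inside a row gives \<open>\<phi> = 1\<close>, hence
  \<open>\<psi> = 1\<close>. But the full move changes \<open>\<beta>\<close> by the factor \<open>q\<^sup>2\<close> or its inverse.
\<close>

lemma full_corner_conflict:
  assumes \<xi>: "full_row q \<mu> N \<alpha> \<xi> t" and Y: "corner q \<nu> N \<beta> Y t" and t: "Suc t < N"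
  shows False
proof -
  have N0: "0 < N" "N - 1 < N" "t < N" using t by auto
  have const: "\<alpha> (l, i) = \<alpha> (l, j)" if "l < N" "i < N" "j < N" for l i j
    using \<xi> that unfolding full_row_def by metis
  obtain l i j where y: "Y (l, i) (l, j) \<noteq> 0" and b: "l < N" "i < N" "j < N"
    using Y N0 unfolding corner_def by blast
  have "\<phi> = 1" using phi[OF b(1,2,1,3) y] const[OF b] A.al0 b by simp
  then have psi1: "\<psi> = 1" using phi_psi by simp
  have "\<xi> (t, 0) (Suc t, 0) \<noteq> 0 \<or> \<xi> (Suc t, 0) (t, 0) \<noteq> 0"
    using \<xi> N0 unfolding full_row_def by blast
  then have "\<beta> (Suc t, 0) = \<beta> (t, 0)"
    using psi[of t 0 "Suc t" 0] psi[of "Suc t" 0 t 0] psi1 t N0 by auto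
  moreover have "\<beta> (Suc t, 0) = q * q * \<beta> (t, 0)" using Y N0 unfolding corner_def by blast
  ultimately show False using A.q2 B.al0[of t 0] N0 by simp
qed

text \<open>
  Two occupants of the same kind and direction have the same eigenvalue and a common move, which is
  impossible since \<open>\<mu>\<^sup>2 \<noteq> 1\<close>. The two corner moves are in different slots because \<open>N \<ge> 3\<close>.
\<close>

lemma row_slot_conflict:
  assumes \<xi>: "row_slot q \<mu> N \<alpha> \<xi> t" and Y: "row_slot q \<nu> N \<beta> Y t"
  shows False
proof -
  interpret S: torus_skew_pair q \<nu> \<mu> N \<beta> \<alpha> Y \<xi> \<psi> \<phi> by (rule swapped)
  have t: "Suc t < N" using \<xi> by (simp add: row_slot_def)
  then have N0: "0 < N" "N - 1 < N" "t < N" by auto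
  have mn: "\<mu> \<noteq> \<nu>" if "\<mu> * \<nu> = 1" using that A.lam by auto
  have eq1: "\<mu> = \<nu>" if "\<mu> * q * q = 1" "\<nu> * q * q = 1"
    using that A.q0 by (metis mult_right_cancel)
  show False
  proof (cases "full_row q \<mu> N \<alpha> \<xi> t")
    case fX: True
    then have dX: "\<mu> * q * q = 1 \<and> \<xi> (t, 0) (Suc t, 0) \<noteq> 0 \<or> \<mu> = q * q \<and> \<xi> (Suc t, 0) (t, 0) \<noteq> 0"
      using N0 unfolding full_row_def by blast
    show False
    proof (cases "full_row q \<nu> N \<beta> Y t")
      case fY: True
      then have dY: "\<nu> * q * q = 1 \<and> Y (t, 0) (Suc t, 0) \<noteq> 0 \<or> \<nu> = q * q \<and> Y (Suc t, 0) (t, 0) \<noteq> 0"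
        using N0 unfolding full_row_def by blast
      show False
        using dX dY down_up_conflict[OF fX _ _ fY _ _ t] S.down_up_conflict[OF fY _ _ fX _ _ t]
          common_move[of t 0 "Suc t" 0] common_move[of "Suc t" 0 t 0] mn eq1 t N0 by blast
    next
      case False
      then show False using full_corner_conflict[OF fX _ t] Y by (auto simp: row_slot_def)
    qed
  next
    case False
    then have cX: "corner q \<mu> N \<alpha> \<xi> t" using \<xi> by (simp add: row_slot_def)
    show False
    proof (cases "full_row q \<nu> N \<beta> Y t")
      case True
      then show False using S.full_corner_conflict[OF True cX t] by blast
    next
      case False
      then have cY: "corner q \<nu> N \<beta> Y t" using Y by (simp add: row_slot_def)
      have "0 \<noteq> N - 2" using A.N3 by simp
      then consider "\<mu> = q * q" "\<nu> = q * q" "\<xi> (0, 0) (0, N - 1) \<noteq> 0" "Y (0, 0) (0, N - 1) \<noteq> 0"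
        | "\<mu> * q * q = 1" "\<nu> * q * q = 1" "\<xi> (N - 1, N - 1) (N - 1, 0) \<noteq> 0" "Y (N - 1, N - 1) (N - 1, 0) \<noteq> 0"
        using cX cY unfolding corner_def by auto
      then show False
        using common_move[of 0 0 0 "N - 1"] common_move[of "N - 1" "N - 1" "N - 1" 0] mn eq1 N0
        by cases blast+
    qed
  qed
qed

lemma slot_conflict:
  assumes \<xi>: "slot q \<mu> N \<alpha> \<xi> s" and Y: "slot q \<nu> N \<beta> Y s"
  shows False
proof (cases "fst s")
  case True
  interpret T: torus_skew_pair q \<mu> \<nu> N "\<lambda>a. \<alpha> (tr a)" "\<lambda>a. \<beta> (tr a)"
    "\<lambda>a b. \<xi> (tr a) (tr b)" "\<lambda>a b. Y (tr a) (tr b)" \<phi> \<psi> by (rule transposed_pair)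
  show ?thesis using T.row_slot_conflict \<xi> Y True by (simp add: slot_def)
next
  case False
  then show ?thesis using row_slot_conflict \<xi> Y by (simp add: slot_def)
qed

end

section \<open>Skew derivations twisted by a transposition\<close>

text \<open>
  Applying \<open>g x = \<mu> x g\<close> twice multiplies a coefficient by \<open>\<mu>\<^sup>2\<close> if its target is the source or the
  transpose of the source, so these coefficients vanish. For any other target off the diagonal, the
  relation between source and target, read off at the square of the target, contains a
  single coefficient, since \<open>g\<close> takes the two entries to their transposes. For a target \<open>(k, k)\<close> on the
  diagonal, the relation of the source with a suitable third entry in row or column \<open>k\<close> isolates the
  coefficient in the same way.
\<close>

lemma transpose_skew_zero:
  fixes q \<mu> :: "'k::field"
  assumes q0: "q \<noteq> 0" and lam: "\<mu> * \<mu> \<noteq> 1" and N3: "3 \<le> N"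
    and al0: "\<And>i j. i < N \<Longrightarrow> j < N \<Longrightarrow> \<alpha> (i, j) \<noteq> 0"
    and eig: "\<And>i j k l. i < N \<Longrightarrow> j < N \<Longrightarrow> k < N \<Longrightarrow> l < N \<Longrightarrow>
                \<xi> (i, j) (k, l) * \<alpha> (k, l) = \<mu> * \<alpha> (i, j) * \<xi> (j, i) (l, k)"
    and sd: "skew_derivation q N (\<lambda>a u. if u = tr a then \<alpha> a else 0) \<xi>"
    and b: "i < N" "j < N" "k < N" "l < N"
  shows "\<xi> (i, j) (k, l) = 0"
proof (cases "(k, l) = (i, j) \<or> (k, l) = (j, i)")
  case True
  have "\<xi> (i, j) (k, l) * \<alpha> (k, l) * \<alpha> (l, k) = \<mu> * \<alpha> (i, j) * (\<xi> (j, i) (l, k) * \<alpha> (l, k))"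
    using eig[OF b] by (simp add: mult_ac)
  also have "\<dots> = \<mu> * \<mu> * \<alpha> (i, j) * \<alpha> (j, i) * \<xi> (i, j) (k, l)"
    using eig[of j i l k] b by (simp add: mult_ac)
  finally have "(\<mu> * \<mu> - 1) * (\<xi> (i, j) (k, l) * (\<alpha> (i, j) * \<alpha> (j, i))) = 0"
    using True by (auto simp: algebra_simps)
  then show ?thesis using lam al0 b by simp
next
  case ne: False
  note D = skew_derivationD[OF sd]
  show ?thesis
  proof (cases "k = l")
    case False
    note [simp] = leibniz_def
    consider "i = k" "j < l" | "i = k" "l < j" | "j = l" "i < k" | "j = l" "k < i"
      | "i < k" "j < l" | "i < k" "l < j" | "k < i" "j < l" | "k < i" "l < j"
      using ne by (metis linorder_neqE_nat)
    then show ?thesis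
    proof cases
      case 1 then show ?thesis
        using quad_zeroD(1)[OF D(1)[of i j 0 l], of k l 0 0] ne False b q0 by (auto split: if_splits)
    next
      case 2 then show ?thesis
        using quad_zeroD(1)[OF D(1)[of i l 0 j], of k l 0 0] ne False b q0 by (auto split: if_splits)
    next
      case 3 then show ?thesis
        using quad_zeroD(1)[OF D(2)[of i j k 0], of k l 0 0] ne False b q0 by (auto split: if_splits)
    next
      case 4 then show ?thesis
        using quad_zeroD(1)[OF D(2)[of k j i 0], of k l 0 0] ne False b q0 by (auto split: if_splits)
    next
      case 5 then show ?thesis
        using quad_zeroD(1)[OF D(4)[of i j k l], of k l 0 0] ne False b q0 by (auto split: if_splits)
    next
      case 6 then show ?thesis
        using quad_zeroD(1)[OF D(3)[of i l k j], of k l 0 0] ne False b q0 by (auto split: if_splits)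
    next
      case 7 then show ?thesis
        using quad_zeroD(1)[OF D(3)[of k j i l], of k l 0 0] ne False b q0 by (auto split: if_splits)
    next
      case 8 then show ?thesis
        using quad_zeroD(1)[OF D(4)[of k l i j], of k l 0 0] ne False b q0 by (auto split: if_splits)
    qed
  next
    case True
    have kk: "(i, j) \<noteq> (k, k)" using ne True by auto
    show ?thesis
    proof (cases "i = k \<or> j = k")
      case False
      then show ?thesis
        using quad_zeroD(3)[OF D(1)[of i j 0 k], of i k k 0] quad_zeroD(3)[OF D(1)[of i j 0 k], of k k i 0]
          quad_zeroD(3)[OF D(1)[of i k 0 j], of i k k 0] quad_zeroD(3)[OF D(1)[of i k 0 j], of k k i 0]
          b q0 \<open>k = l\<close>
        by (cases "j < k"; cases "i < k") (auto simp: leibniz_def)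
    next
      case ijk: True
      obtain m where m: "m < N" "m \<noteq> k" "m \<noteq> (if i = k then j else i)"
        using fresh_index[OF N3] by blast
      show ?thesis
      proof (cases "i = k")
        case True
        then show ?thesis
          using quad_zeroD(2)[OF D(1)[of k j 0 m], of k k 0 m] quad_zeroD(2)[OF D(1)[of k j 0 m], of k m 0 k]
            quad_zeroD(2)[OF D(1)[of k m 0 j], of k k 0 m] quad_zeroD(2)[OF D(1)[of k m 0 j], of k m 0 k]
            b q0 \<open>k = l\<close> m kk
          by (cases "j < m"; cases "k < m") (auto simp: leibniz_def)
      next
        case False
        then show ?thesis
          using quad_zeroD(3)[OF D(2)[of i k m 0], of k k m 0] quad_zeroD(3)[OF D(2)[of i k m 0], of m k k 0]
            quad_zeroD(3)[OF D(2)[of m k i 0], of k k m 0] quad_zeroD(3)[OF D(2)[of m k i 0], of m k k 0]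
            b q0 \<open>k = l\<close> m kk ijk
          by (cases "i < m"; cases "k < m") (auto simp: leibniz_def)
      qed
    qed
  qed
qed

section \<open>Monoid algebras\<close>

lemma lookup_smult: "Poly_Mapping.lookup (Poly_Mapping.map ((*) c) f) k = (c :: 'k::field) * Poly_Mapping.lookup f k"
  by (simp add: Poly_Mapping.map.rep_eq when_def)

lemma keys_smult: "Poly_Mapping.keys (Poly_Mapping.map ((*) (c :: 'k::field)) f) \<subseteq> Poly_Mapping.keys f"
  by (auto simp: in_keys_iff lookup_smult)

lemma smult_single:
  "Poly_Mapping.map ((*) (c :: 'k::field)) (Poly_Mapping.single w d) = Poly_Mapping.single w (c * d)"
  by (rule poly_mapping_eqI) (simp add: lookup_smult lookup_single when_def)

lemma smult_sum:
  "Poly_Mapping.map ((*) (c :: 'k::field)) (\<Sum>x\<in>A. f x) = (\<Sum>x\<in>A. Poly_Mapping.map ((*) c) (f x))"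
  by (rule poly_mapping_eqI) (simp add: lookup_smult lookup_sum sum_distrib_left)

lemma sum_single_lookup:
  assumes "finite A" "Poly_Mapping.keys f \<subseteq> A"
  shows "(\<Sum>x\<in>A. Poly_Mapping.single x (Poly_Mapping.lookup f x)) = f"
proof (rule poly_mapping_eqI)
  fix k
  show "Poly_Mapping.lookup (\<Sum>x\<in>A. Poly_Mapping.single x (Poly_Mapping.lookup f x)) k = Poly_Mapping.lookup f k"
    using assms by (auto simp: lookup_sum lookup_single when_def in_keys_iff)
qed

lemma single_sum: "Poly_Mapping.single w (\<Sum>x\<in>A. f x) = (\<Sum>x\<in>A. Poly_Mapping.single w (f x))"
  by (rule poly_mapping_eqI) (simp add: lookup_sum lookup_single when_def)

lemma monoid_algebra_simps [simp]:
  "carrier (monoid_algebra M) = {f. Poly_Mapping.keys f \<subseteq> carrier M}"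
  "\<one>\<^bsub>monoid_algebra M\<^esub> = Poly_Mapping.single \<one>\<^bsub>M\<^esub> 1"
  "\<zero>\<^bsub>monoid_algebra M\<^esub> = 0"
  "f \<oplus>\<^bsub>monoid_algebra M\<^esub> g = f + g"
  "c \<odot>\<^bsub>monoid_algebra M\<^esub> f = Poly_Mapping.map ((*) c) f"
  by (simp_all add: monoid_algebra_def)

text \<open>
  Summing over arbitrary finite sets that contain the supports makes bilinearity visible: both sides of
  an identity can be expanded over the same index sets.
\<close>

lemma monoid_algebra_mult:
  assumes "finite A" "finite B" "Poly_Mapping.keys f \<subseteq> A" "Poly_Mapping.keys g \<subseteq> B"
  shows "f \<otimes>\<^bsub>monoid_algebra M\<^esub> g = (\<Sum>x\<in>A. \<Sum>y\<in>B.
     Poly_Mapping.single (x \<otimes>\<^bsub>M\<^esub> y) (Poly_Mapping.lookup f x * Poly_Mapping.lookup g y))"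
proof -
  have "f \<otimes>\<^bsub>monoid_algebra M\<^esub> g = (\<Sum>x\<in>A. \<Sum>y\<in>Poly_Mapping.keys g.
     Poly_Mapping.single (x \<otimes>\<^bsub>M\<^esub> y) (Poly_Mapping.lookup f x * Poly_Mapping.lookup g y))"
    unfolding monoid_algebra_def using assms
    by (auto intro!: sum.mono_neutral_left sum.neutral simp: in_keys_iff)
  also have "\<dots> = (\<Sum>x\<in>A. \<Sum>y\<in>B.
     Poly_Mapping.single (x \<otimes>\<^bsub>M\<^esub> y) (Poly_Mapping.lookup f x * Poly_Mapping.lookup g y))"
    using assms by (intro sum.cong refl sum.mono_neutral_left) (auto simp: in_keys_iff)
  finally show ?thesis .
qed

lemma monoid_algebra_mult_single:
  "Poly_Mapping.single x a \<otimes>\<^bsub>monoid_algebra M\<^esub> Poly_Mapping.single y b = Poly_Mapping.single (x \<otimes>\<^bsub>M\<^esub> y) (a * b)"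
  by (subst monoid_algebra_mult[of "{x}" "{y}"]) auto

lemma monoid_algebra_add_mult:
  "(f + g) \<otimes>\<^bsub>monoid_algebra M\<^esub> h = f \<otimes>\<^bsub>monoid_algebra M\<^esub> h + g \<otimes>\<^bsub>monoid_algebra M\<^esub> h"
  using Poly_Mapping.keys_add[of f g]
  by (simp add: monoid_algebra_mult[of "Poly_Mapping.keys f \<union> Poly_Mapping.keys g" "Poly_Mapping.keys h"]
      lookup_add algebra_simps single_add sum.distrib)

lemma monoid_algebra_mult_add:
  "h \<otimes>\<^bsub>monoid_algebra M\<^esub> (f + g) = h \<otimes>\<^bsub>monoid_algebra M\<^esub> f + h \<otimes>\<^bsub>monoid_algebra M\<^esub> g"
  using Poly_Mapping.keys_add[of f g]
  by (simp add: monoid_algebra_mult[of "Poly_Mapping.keys h" "Poly_Mapping.keys f \<union> Poly_Mapping.keys g"]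
      lookup_add algebra_simps single_add sum.distrib)

lemma monoid_algebra_mult_zero [simp]:
  "0 \<otimes>\<^bsub>monoid_algebra M\<^esub> h = 0" "h \<otimes>\<^bsub>monoid_algebra M\<^esub> 0 = 0"
  by (simp_all add: monoid_algebra_def)

lemma monoid_algebra_sum_mult:
  "(\<Sum>i\<in>A. f i) \<otimes>\<^bsub>monoid_algebra M\<^esub> h = (\<Sum>i\<in>A. f i \<otimes>\<^bsub>monoid_algebra M\<^esub> h)"
  by (induction A rule: infinite_finite_induct) (auto simp: monoid_algebra_add_mult)

lemma monoid_algebra_mult_sum:
  "h \<otimes>\<^bsub>monoid_algebra M\<^esub> (\<Sum>i\<in>A. f i) = (\<Sum>i\<in>A. h \<otimes>\<^bsub>monoid_algebra M\<^esub> f i)"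
  by (induction A rule: infinite_finite_induct) (auto simp: monoid_algebra_mult_add)

lemma monoid_algebra_smult_mult:
  "Poly_Mapping.map ((*) c) f \<otimes>\<^bsub>monoid_algebra M\<^esub> g = Poly_Mapping.map ((*) c) (f \<otimes>\<^bsub>monoid_algebra M\<^esub> g)"
  "f \<otimes>\<^bsub>monoid_algebra M\<^esub> Poly_Mapping.map ((*) c) g = Poly_Mapping.map ((*) c) (f \<otimes>\<^bsub>monoid_algebra M\<^esub> g)"
  using keys_smult[of c f] keys_smult[of c g]
  by (simp_all add: monoid_algebra_mult[of "Poly_Mapping.keys f" "Poly_Mapping.keys g"]
      lookup_smult smult_sum smult_single mult_ac)

lemma monoid_algebra_mult_closed:
  assumes "Group.monoid M" "Poly_Mapping.keys f \<subseteq> carrier M" "Poly_Mapping.keys g \<subseteq> carrier M"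
  shows "Poly_Mapping.keys (f \<otimes>\<^bsub>monoid_algebra M\<^esub> g) \<subseteq> carrier M"
proof -
  have "Poly_Mapping.keys (\<Sum>y\<in>Poly_Mapping.keys g.
      Poly_Mapping.single (x \<otimes>\<^bsub>M\<^esub> y) (Poly_Mapping.lookup f x * Poly_Mapping.lookup g y)) \<subseteq> carrier M"
    if "x \<in> Poly_Mapping.keys f" for x
    using that assms by (intro order_trans[OF keys_sum]) (auto intro: monoid.m_closed)
  then show ?thesis
    unfolding monoid_algebra_def
    by (simp) (intro order_trans[OF keys_sum], auto)
qed

lemma monoid_algebra_assoc:
  fixes f g h :: "'a \<Rightarrow>\<^sub>0 'k::field"
  assumes "Group.monoid M"
    and "Poly_Mapping.keys f \<subseteq> carrier M" "Poly_Mapping.keys g \<subseteq> carrier M" "Poly_Mapping.keys h \<subseteq> carrier M"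
  shows "(f \<otimes>\<^bsub>monoid_algebra M\<^esub> g) \<otimes>\<^bsub>monoid_algebra M\<^esub> h = f \<otimes>\<^bsub>monoid_algebra M\<^esub> (g \<otimes>\<^bsub>monoid_algebra M\<^esub> h)"
proof -
  define s where "s = (\<lambda>f x. Poly_Mapping.single x (Poly_Mapping.lookup f x) :: 'a \<Rightarrow>\<^sub>0 'k)"
  define F where "F = Poly_Mapping.keys f"
  define G where "G = Poly_Mapping.keys g"
  define H where "H = Poly_Mapping.keys h"
  have fgh: "f = (\<Sum>x\<in>F. s f x)" "g = (\<Sum>x\<in>G. s g x)" "h = (\<Sum>x\<in>H. s h x)"
    by (simp_all add: s_def F_def G_def H_def sum_single_lookup)
  have "(f \<otimes>\<^bsub>monoid_algebra M\<^esub> g) \<otimes>\<^bsub>monoid_algebra M\<^esub> h =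
      (\<Sum>z\<in>H. \<Sum>y\<in>G. \<Sum>x\<in>F. (s f x \<otimes>\<^bsub>monoid_algebra M\<^esub> s g y) \<otimes>\<^bsub>monoid_algebra M\<^esub> s h z)"
    by (subst fgh(1), subst fgh(2), subst fgh(3))
       (simp only: monoid_algebra_sum_mult monoid_algebra_mult_sum)
  also have "\<dots> = (\<Sum>z\<in>H. \<Sum>y\<in>G. \<Sum>x\<in>F. s f x \<otimes>\<^bsub>monoid_algebra M\<^esub> (s g y \<otimes>\<^bsub>monoid_algebra M\<^esub> s h z))"
    using assms by (intro sum.cong refl)
      (auto simp: s_def F_def G_def H_def monoid_algebra_mult_single monoid.m_assoc subset_iff mult.assoc)
  also have "\<dots> = f \<otimes>\<^bsub>monoid_algebra M\<^esub> (g \<otimes>\<^bsub>monoid_algebra M\<^esub> h)"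
    by (subst (2) fgh(1), subst (2) fgh(2), subst (2) fgh(3))
       (simp only: monoid_algebra_sum_mult monoid_algebra_mult_sum)
  finally show ?thesis .
qed

lemma monoid_algebra_one:
  assumes "Group.monoid M" "Poly_Mapping.keys f \<subseteq> carrier M"
  shows "Poly_Mapping.single \<one>\<^bsub>M\<^esub> 1 \<otimes>\<^bsub>monoid_algebra M\<^esub> f = f"
    and "f \<otimes>\<^bsub>monoid_algebra M\<^esub> Poly_Mapping.single \<one>\<^bsub>M\<^esub> 1 = f"
proof -
  have "(\<Sum>x\<in>Poly_Mapping.keys f. Poly_Mapping.single (\<one>\<^bsub>M\<^esub> \<otimes>\<^bsub>M\<^esub> x) (Poly_Mapping.lookup f x)) = f"
    "(\<Sum>x\<in>Poly_Mapping.keys f. Poly_Mapping.single (x \<otimes>\<^bsub>M\<^esub> \<one>\<^bsub>M\<^esub>) (Poly_Mapping.lookup f x)) = f"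
    using assms sum_single_lookup[of "Poly_Mapping.keys f" f]
    by (simp_all add: monoid.l_one monoid.r_one subset_iff cong: sum.cong)
  then show "Poly_Mapping.single \<one>\<^bsub>M\<^esub> 1 \<otimes>\<^bsub>monoid_algebra M\<^esub> f = f"
    "f \<otimes>\<^bsub>monoid_algebra M\<^esub> Poly_Mapping.single \<one>\<^bsub>M\<^esub> 1 = f"
    by (simp_all add: monoid_algebra_def)
qed

lemma monoid_algebra_is_algebra:
  assumes M: "Group.monoid M"
  shows "is_algebra (monoid_algebra M :: ('k::field, 'a \<Rightarrow>\<^sub>0 'k) module)"
proof -
  let ?A = "monoid_algebra M :: ('k, 'a \<Rightarrow>\<^sub>0 'k) module"
  have ab: "abelian_group ?A"
    by (rule abelian_groupI)
       (use Poly_Mapping.keys_add in \<open>fastforce simp: add_ac intro: exI[of _ "- _"]\<close>)+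
  have "ring ?A"
  proof (rule ringI[OF ab])
    show "Group.monoid ?A"
      by (rule monoidI)
         (use M in \<open>auto simp: monoid_algebra_one monoid_algebra_assoc monoid.one_closed
            dest: monoid_algebra_mult_closed[THEN subsetD]\<close>)
  qed (simp_all add: monoid_algebra_add_mult monoid_algebra_mult_add)
  moreover have "Module.module (class_ring :: 'k ring) ?A"
  proof (rule moduleI)
    show "cring (class_ring :: 'k ring)" by (rule class_cring.cring_axioms)
    show "abelian_group ?A" by (rule ab)
    show "a \<odot>\<^bsub>?A\<^esub> x \<in> carrier ?A" if "x \<in> carrier ?A" for a x
      using that keys_smult[of a x] by auto
  qed (auto intro!: poly_mapping_eqI simp: lookup_smult lookup_add algebra_simps)
  ultimately show ?thesis
    unfolding is_algebra_def by (auto simp: monoid_algebra_smult_mult)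
qed

section \<open>Quotient algebras\<close>

lemma is_algebraD:
  assumes "is_algebra (A :: ('k::field, 'a, 'm) module_scheme)"
  shows "ring A" "Module.module (class_ring :: 'k ring) A"
    and "\<And>c x y. x \<in> carrier A \<Longrightarrow> y \<in> carrier A \<Longrightarrow>
          (c \<odot>\<^bsub>A\<^esub> x) \<otimes>\<^bsub>A\<^esub> y = c \<odot>\<^bsub>A\<^esub> (x \<otimes>\<^bsub>A\<^esub> y)"
    and "\<And>c x y. x \<in> carrier A \<Longrightarrow> y \<in> carrier A \<Longrightarrow>
          x \<otimes>\<^bsub>A\<^esub> (c \<odot>\<^bsub>A\<^esub> y) = c \<odot>\<^bsub>A\<^esub> (x \<otimes>\<^bsub>A\<^esub> y)"
    and "\<And>c x. x \<in> carrier A \<Longrightarrow> c \<odot>\<^bsub>A\<^esub> x \<in> carrier A"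
  using assms unfolding is_algebra_def
  by (auto intro: Module.module.smult_closed)

locale quotient_of_algebra = ideal I A
  for I and A :: "('k::field, 'a, 'm) module_scheme" (structure) +
  assumes alg: "is_algebra A"
begin

abbreviation Q where "Q \<equiv> quotient_algebra A I"

lemma ideal_smult: "x \<in> I \<Longrightarrow> c \<odot> x \<in> I"
proof -
  assume x: "x \<in> I"
  then have xc: "x \<in> carrier A" by (rule a_Hcarr)
  have "c \<odot> x = (c \<odot> \<one>) \<otimes> x" using is_algebraD(3)[OF alg, of \<one> x c] xc by simp
  then show ?thesis using I_l_closed[OF x] is_algebraD(5)[OF alg] by simp
qed

lemma Q_carrier: "carrier Q = (\<lambda>x. I +> x) ` carrier A"
  by (auto simp: quotient_algebra_def FactRing_def A_RCOSETS_def')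

lemma Q_mult: "x \<in> carrier A \<Longrightarrow> y \<in> carrier A \<Longrightarrow> (I +> x) \<otimes>\<^bsub>Q\<^esub> (I +> y) = I +> (x \<otimes> y)"
  by (simp add: quotient_algebra_def FactRing_def rcoset_mult_add)

lemma Q_add: "x \<in> carrier A \<Longrightarrow> y \<in> carrier A \<Longrightarrow> (I +> x) \<oplus>\<^bsub>Q\<^esub> (I +> y) = I +> (x \<oplus> y)"
  by (simp add: quotient_algebra_def FactRing_def a_rcos_sum)

lemma Q_one: "\<one>\<^bsub>Q\<^esub> = I +> \<one>"
  by (simp add: quotient_algebra_def FactRing_def)

lemma Q_zero: "\<zero>\<^bsub>Q\<^esub> = I +> \<zero>"
  using a_coset_add_zero[OF a_subset] by (simp add: quotient_algebra_def FactRing_def)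

lemma coset_eq_iff:
  assumes "x \<in> carrier A" "y \<in> carrier A"
  shows "I +> x = I +> y \<longleftrightarrow> x \<ominus> y \<in> I"
proof
  assume "I +> x = I +> y"
  then have "x \<in> I +> y" using a_rcos_self[OF assms(1)] by simp
  then show "x \<ominus> y \<in> I" using a_rcos_module_minus[OF ring_axioms] assms by blast
next
  assume "x \<ominus> y \<in> I"
  then have "x \<in> I +> y" using a_rcos_module_minus[OF ring_axioms] assms by blast
  then show "I +> x = I +> y" using a_repr_independence[OF _ assms(2)] a_subgroup by metis
qed

lemma coset_zero_iff: "x \<in> carrier A \<Longrightarrow> I +> x = \<zero>\<^bsub>Q\<^esub> \<longleftrightarrow> x \<in> I"
  using coset_eq_iff[of x \<zero>] by (simp add: Q_zero a_minus_def)

text \<open>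
  The definition takes a union over all representatives of the coset. They contribute the same coset
  because an ideal of an algebra is closed under scalars.
\<close>

lemma Q_smult:
  assumes x: "x \<in> carrier A"
  shows "c \<odot>\<^bsub>Q\<^esub> (I +> x) = I +> (c \<odot> x)"
proof -
  interpret M: Module.module "class_ring :: 'k ring" A by (rule is_algebraD(2)[OF alg])
  have "I +> (c \<odot> y) = I +> (c \<odot> x)" if y: "y \<in> I +> x" for y
  proof -
    obtain z where z: "z \<in> I" "y = z \<oplus> x" using y by (auto simp: a_r_coset_def')
    then have zc: "z \<in> carrier A" by simp
    have "c \<odot> y \<ominus> c \<odot> x = c \<odot> z"
      using z zc x by (simp add: M.smult_r_distr a_minus_def a_assoc r_neg)
    then show ?thesis
      using coset_eq_iff[of "c \<odot> y" "c \<odot> x"] ideal_smult[OF z(1)] z zc x by simp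
  qed
  moreover have "c \<odot>\<^bsub>Q\<^esub> (I +> x) = (\<Union>y\<in>I +> x. I +> (c \<odot> y))"
    by (simp add: quotient_algebra_def)
  ultimately show ?thesis
    using a_rcos_self[OF x] by (metis (no_types, lifting) SUP_eq_const empty_iff)
qed

end

section \<open>Presented algebras\<close>

lemma free_monoid_monoid: "Group.monoid (free_monoid S)"
  by (rule monoidI) (auto simp: free_monoid_def)

lemma free_monoid_simps [simp]:
  "carrier (free_monoid S) = lists S" "x \<otimes>\<^bsub>free_monoid S\<^esub> y = x @ y" "\<one>\<^bsub>free_monoid S\<^esub> = []"
  by (simp_all add: free_monoid_def)

text \<open>
  Elements of the presented algebra are handled as classes \<open>cls f\<close> of elements \<open>f\<close> of the free algebra. The
  predicate \<open>wd\<close> is membership in the carrier of the free algebra, kept folded so that simplification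
  does not reduce it to statements about the letters of words.
\<close>

locale presentation =
  fixes S :: "'x set" and rels :: "('x list \<Rightarrow>\<^sub>0 'k::field) set"
  assumes rels: "rels \<subseteq> {f. Poly_Mapping.keys f \<subseteq> lists S}"
begin

abbreviation F where "F \<equiv> (free_algebra S :: ('k, 'x list \<Rightarrow>\<^sub>0 'k) module)"
abbreviation P where "P \<equiv> presented_algebra S rels"

definition cls :: "('x list \<Rightarrow>\<^sub>0 'k) \<Rightarrow> ('x list \<Rightarrow>\<^sub>0 'k) set" where
  "cls f = Idl\<^bsub>F\<^esub> rels +>\<^bsub>F\<^esub> f"

definition wd :: "('x list \<Rightarrow>\<^sub>0 'k) \<Rightarrow> bool" where
  "wd f \<longleftrightarrow> Poly_Mapping.keys f \<subseteq> lists S"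

lemma F_algebra: "is_algebra F"
  by (rule monoid_algebra_is_algebra[OF free_monoid_monoid])

lemma F_carrier: "carrier F = {f. wd f}"
  by (simp add: wd_def)

sublocale quotient_of_algebra "Idl\<^bsub>F\<^esub> rels" F
proof -
  have "ideal (Idl\<^bsub>F\<^esub> rels) F"
    by (rule ring.genideal_ideal[OF is_algebraD(1)[OF F_algebra]]) (use rels in auto)
  then show "quotient_of_algebra (Idl\<^bsub>F\<^esub> rels) F"
    by (intro quotient_of_algebra.intro quotient_of_algebra_axioms.intro F_algebra)
qed

lemma wd_single [simp]: "wd (Poly_Mapping.single w c) \<longleftrightarrow> c = 0 \<or> w \<in> lists S"
  by (simp add: wd_def)

lemma wd_0 [simp]: "wd 0" by (simp add: wd_def)

lemma wd_add [simp]: "wd f \<Longrightarrow> wd g \<Longrightarrow> wd (f + g)"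
  using Poly_Mapping.keys_add[of f g] by (auto simp: wd_def)

lemma wd_sum [simp]: "(\<And>i. i \<in> A \<Longrightarrow> wd (f i)) \<Longrightarrow> wd (\<Sum>i\<in>A. f i)"
  by (induction A rule: infinite_finite_induct) auto

lemma wd_smult [simp]: "wd f \<Longrightarrow> wd (Poly_Mapping.map ((*) c) f)"
  using keys_smult[of c f] by (auto simp: wd_def)

lemma wd_mult [simp]: "wd f \<Longrightarrow> wd g \<Longrightarrow> wd (f \<otimes>\<^bsub>F\<^esub> g)"
  using monoid_algebra_mult_closed[OF free_monoid_monoid, of f S g] by (simp add: wd_def)

lemma P_carrier: "carrier P = cls ` {f. wd f}"
  using Q_carrier by (simp add: presented_algebra_def cls_def wd_def)

lemma cls_closed [simp]: "wd f \<Longrightarrow> cls f \<in> carrier P"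
  by (simp add: P_carrier)

lemma cls_mult: "wd f \<Longrightarrow> wd g \<Longrightarrow> cls f \<otimes>\<^bsub>P\<^esub> cls g = cls (f \<otimes>\<^bsub>F\<^esub> g)"
  using Q_mult by (simp add: presented_algebra_def cls_def wd_def)

lemma cls_add: "wd f \<Longrightarrow> wd g \<Longrightarrow> cls f \<oplus>\<^bsub>P\<^esub> cls g = cls (f + g)"
  using Q_add by (simp add: presented_algebra_def cls_def wd_def)

lemma cls_smult: "wd f \<Longrightarrow> c \<odot>\<^bsub>P\<^esub> cls f = cls (Poly_Mapping.map ((*) c) f)"
  using Q_smult by (simp add: presented_algebra_def cls_def wd_def)

lemma cls_one: "\<one>\<^bsub>P\<^esub> = cls (Poly_Mapping.single [] 1)"
  using Q_one by (simp add: presented_algebra_def cls_def)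

lemma cls_zero: "\<zero>\<^bsub>P\<^esub> = cls 0"
  using Q_zero by (simp add: presented_algebra_def cls_def)

lemma cls_zero_iff: "wd f \<Longrightarrow> cls f = \<zero>\<^bsub>P\<^esub> \<longleftrightarrow> f \<in> Idl\<^bsub>F\<^esub> rels"
  using coset_zero_iff by (simp add: presented_algebra_def cls_def wd_def)

lemma cls_relation: "f \<in> rels \<Longrightarrow> cls f = \<zero>\<^bsub>P\<^esub>"
  using cls_zero_iff[of f] ring.genideal_self[OF is_algebraD(1)[OF F_algebra], of rels] rels
  by (auto simp: wd_def)

lemma generator_cls: "generator S rels x = cls (Poly_Mapping.single [x] 1)"
  by (simp add: generator_def cls_def)

text \<open>
  Every element is a finite sum of classes of scalar multiples of words.
\<close>

lemma P_induct [consumes 1, case_names word add]: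
  assumes r: "r \<in> carrier P"
    and word: "\<And>w c. w \<in> lists S \<Longrightarrow> Pr (cls (Poly_Mapping.single w c))"
    and add: "\<And>f g. wd f \<Longrightarrow> wd g \<Longrightarrow> Pr (cls f) \<Longrightarrow> Pr (cls g) \<Longrightarrow> Pr (cls (f + g))"
  shows "Pr r"
proof -
  obtain f where f: "wd f" "r = cls f" using r by (auto simp: P_carrier)
  have "wd (\<Sum>w\<in>A. Poly_Mapping.single w (Poly_Mapping.lookup f w)) \<and>
      Pr (cls (\<Sum>w\<in>A. Poly_Mapping.single w (Poly_Mapping.lookup f w)))"
    if "finite A" "A \<subseteq> lists S" for A
    using that
  proof (induction A rule: finite_induct)
    case empty
    then show ?case using word[of "[]" 0] by simp
  next
    case (insert w A)
    then show ?case using add[of "Poly_Mapping.single w (Poly_Mapping.lookup f w)"] word[of w] by auto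
  qed
  from this[of "Poly_Mapping.keys f"] show ?thesis
    using f sum_single_lookup[of "Poly_Mapping.keys f" f] by (simp add: wd_def)
qed

end

section \<open>Linear spans\<close>

lemma linear_span_induct [consumes 3, case_names zero add]:
  fixes A :: "('k::field, 'a, 'm) module_scheme"
  assumes A: "Module.module (class_ring :: 'k ring) A" and S: "S \<subseteq> carrier A"
    and x: "x \<in> linear_span A S"
    and zero: "Pr \<zero>\<^bsub>A\<^esub>"
    and add: "\<And>c s y. s \<in> S \<Longrightarrow> y \<in> carrier A \<Longrightarrow> Pr y \<Longrightarrow> Pr (c \<odot>\<^bsub>A\<^esub> s \<oplus>\<^bsub>A\<^esub> y)"
  shows "x \<in> carrier A \<and> Pr x"
proof -
  interpret M: Module.module "class_ring :: 'k ring" A by (rule A)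
  obtain T a where T: "finite T" "T \<subseteq> S" and xT: "x = (\<Oplus>\<^bsub>A\<^esub>v\<in>T. a v \<odot>\<^bsub>A\<^esub> v)"
    using x by (auto simp: linear_span_def M.span_def M.lincomb_def)
  have "(\<Oplus>\<^bsub>A\<^esub>v\<in>T. a v \<odot>\<^bsub>A\<^esub> v) \<in> carrier A \<and> Pr (\<Oplus>\<^bsub>A\<^esub>v\<in>T. a v \<odot>\<^bsub>A\<^esub> v)"
    using T
  proof (induction T rule: finite_induct)
    case empty
    then show ?case using zero by simp
  next
    case (insert v T)
    have c: "a v \<odot>\<^bsub>A\<^esub> v \<in> carrier A" "(\<lambda>v. a v \<odot>\<^bsub>A\<^esub> v) \<in> T \<rightarrow> carrier A"
      using insert.prems S by auto
    then have "(\<Oplus>\<^bsub>A\<^esub>v\<in>insert v T. a v \<odot>\<^bsub>A\<^esub> v) = a v \<odot>\<^bsub>A\<^esub> v \<oplus>\<^bsub>A\<^esub> (\<Oplus>\<^bsub>A\<^esub>v\<in>T. a v \<odot>\<^bsub>A\<^esub> v)"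
      using insert.hyps by (intro M.finsum_insert) auto
    then show ?case using insert c add by auto
  qed
  then show ?thesis by (simp add: xT)
qed

section \<open>Linear maps out of a tensor product\<close>

text \<open>
  The value of \<open>tensor_lift\<close> at a tensor is computed from an arbitrary representative. The evaluation \<open>ev\<close>
  of representatives is linear and vanishes on the bilinearity relations (\<open>ev_null\<close>), so on a sum
  of pure tensors it can be computed from the obvious representative.
\<close>

locale bilinear_map =
  fixes H :: "('k::field, 'h, 'm) module_scheme" and R :: "('k, 'r, 'n) module_scheme"
    and \<phi> :: "'h \<Rightarrow> 'h \<Rightarrow> 'r"
  assumes H: "is_algebra H" and R: "is_algebra R"
    and closed: "\<And>a b. a \<in> carrier H \<Longrightarrow> b \<in> carrier H \<Longrightarrow> \<phi> a b \<in> carrier R"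
    and add1: "\<And>a a' b. a \<in> carrier H \<Longrightarrow> a' \<in> carrier H \<Longrightarrow> b \<in> carrier H \<Longrightarrow>
                 \<phi> (a \<oplus>\<^bsub>H\<^esub> a') b = \<phi> a b \<oplus>\<^bsub>R\<^esub> \<phi> a' b"
    and add2: "\<And>a b b'. a \<in> carrier H \<Longrightarrow> b \<in> carrier H \<Longrightarrow> b' \<in> carrier H \<Longrightarrow>
                 \<phi> a (b \<oplus>\<^bsub>H\<^esub> b') = \<phi> a b \<oplus>\<^bsub>R\<^esub> \<phi> a b'"
    and smult1: "\<And>c a b. a \<in> carrier H \<Longrightarrow> b \<in> carrier H \<Longrightarrow> \<phi> (c \<odot>\<^bsub>H\<^esub> a) b = c \<odot>\<^bsub>R\<^esub> \<phi> a b"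
    and smult2: "\<And>c a b. a \<in> carrier H \<Longrightarrow> b \<in> carrier H \<Longrightarrow> \<phi> a (c \<odot>\<^bsub>H\<^esub> b) = c \<odot>\<^bsub>R\<^esub> \<phi> a b"
begin

sublocale HR: ring H by (rule is_algebraD(1)[OF H])
sublocale HM: Module.module "class_ring :: 'k ring" H by (rule is_algebraD(2)[OF H])
sublocale RR: ring R by (rule is_algebraD(1)[OF R])
sublocale RM: Module.module "class_ring :: 'k ring" R by (rule is_algebraD(2)[OF R])

abbreviation T where "T \<equiv> (monoid_algebra (H \<times>\<times> H) :: ('k, 'h \<times> 'h \<Rightarrow>\<^sub>0 'k) module)"

lemma T_algebra: "is_algebra T"
  by (intro monoid_algebra_is_algebra DirProd_monoid HR.monoid_axioms)

lemma T_carrier: "carrier T = {t. Poly_Mapping.keys t \<subseteq> carrier H \<times> carrier H}"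
  by (simp add: DirProd_def)

definition ev :: "('h \<times> 'h \<Rightarrow>\<^sub>0 'k) \<Rightarrow> 'r" where
  "ev t = (\<Oplus>\<^bsub>R\<^esub>p\<in>Poly_Mapping.keys t. Poly_Mapping.lookup t p \<odot>\<^bsub>R\<^esub> \<phi> (fst p) (snd p))"

lemma term_closed: "p \<in> carrier H \<times> carrier H \<Longrightarrow> c \<odot>\<^bsub>R\<^esub> \<phi> (fst p) (snd p) \<in> carrier R"
  using closed by auto

lemma smult_zero: "x \<in> carrier R \<Longrightarrow> 0 \<odot>\<^bsub>R\<^esub> x = \<zero>\<^bsub>R\<^esub>"
  using RM.smult_l_null[of x] by simp

lemma smult_one: "x \<in> carrier R \<Longrightarrow> 1 \<odot>\<^bsub>R\<^esub> x = x"
  using RM.smult_one[of x] by simp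

lemma smult_minus: "x \<in> carrier R \<Longrightarrow> (- c) \<odot>\<^bsub>R\<^esub> x = \<ominus>\<^bsub>R\<^esub> (c \<odot>\<^bsub>R\<^esub> x)"
  using RM.smult_l_minus[of c x] by (simp add: class_ring_simps)

lemma term_funcset: "A \<subseteq> carrier H \<times> carrier H \<Longrightarrow>
    (\<lambda>p. f p \<odot>\<^bsub>R\<^esub> \<phi> (fst p) (snd p)) \<in> A \<rightarrow> carrier R"
  using term_closed by blast

lemma ev_superset:
  assumes "finite A" "Poly_Mapping.keys t \<subseteq> A" "A \<subseteq> carrier H \<times> carrier H"
  shows "ev t = (\<Oplus>\<^bsub>R\<^esub>p\<in>A. Poly_Mapping.lookup t p \<odot>\<^bsub>R\<^esub> \<phi> (fst p) (snd p))"
  unfolding ev_def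
proof (rule RR.add.finprod_mono_neutral_cong_left)
  show "Poly_Mapping.lookup t p \<odot>\<^bsub>R\<^esub> \<phi> (fst p) (snd p) = \<zero>\<^bsub>R\<^esub>" if "p \<in> A - Poly_Mapping.keys t" for p
  proof -
    have "p \<in> carrier H \<times> carrier H" "Poly_Mapping.lookup t p = 0"
      using that assms(3) by (auto simp: in_keys_iff)
    then show ?thesis using smult_zero closed by (auto simp: mem_Times_iff)
  qed
qed (use assms term_funcset in auto)

lemma ev_add:
  assumes "s \<in> carrier T" "t \<in> carrier T"
  shows "ev (s + t) = ev s \<oplus>\<^bsub>R\<^esub> ev t"
proof -
  define A where "A = Poly_Mapping.keys s \<union> Poly_Mapping.keys t"
  have A: "finite A" "A \<subseteq> carrier H \<times> carrier H" "Poly_Mapping.keys s \<subseteq> A" "Poly_Mapping.keys t \<subseteq> A"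
    "Poly_Mapping.keys (s + t) \<subseteq> A"
    using assms Poly_Mapping.keys_add[of s t] by (auto simp: A_def T_carrier)
  have "ev (s + t) = (\<Oplus>\<^bsub>R\<^esub>p\<in>A. Poly_Mapping.lookup s p \<odot>\<^bsub>R\<^esub> \<phi> (fst p) (snd p)
      \<oplus>\<^bsub>R\<^esub> Poly_Mapping.lookup t p \<odot>\<^bsub>R\<^esub> \<phi> (fst p) (snd p))"
    unfolding ev_superset[OF A(1,5,2)]
  proof (intro RR.finsum_cong' refl)
    fix p assume "p \<in> A"
    then have "\<phi> (fst p) (snd p) \<in> carrier R" using A(2) closed by (auto simp: mem_Times_iff)
    then show "Poly_Mapping.lookup (s + t) p \<odot>\<^bsub>R\<^esub> \<phi> (fst p) (snd p) =
        Poly_Mapping.lookup s p \<odot>\<^bsub>R\<^esub> \<phi> (fst p) (snd p) \<oplus>\<^bsub>R\<^esub> Poly_Mapping.lookup t p \<odot>\<^bsub>R\<^esub> \<phi> (fst p) (snd p)"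
      using RM.smult_l_distr[of "Poly_Mapping.lookup s p" "Poly_Mapping.lookup t p"] by (simp add: lookup_add)
  qed (use A closed in \<open>auto simp: subset_iff\<close>)
  also have "\<dots> = ev s \<oplus>\<^bsub>R\<^esub> ev t"
    unfolding ev_superset[OF A(1,3,2)] ev_superset[OF A(1,4,2)]
    by (rule RR.finsum_addf) (rule term_funcset[OF A(2)])+
  finally show ?thesis .
qed

lemma ev_single:
  assumes "a \<in> carrier H" "b \<in> carrier H"
  shows "ev (Poly_Mapping.single (a, b) c) = c \<odot>\<^bsub>R\<^esub> \<phi> a b"
proof -
  have "ev (Poly_Mapping.single (a, b) c) = (\<Oplus>\<^bsub>R\<^esub>p\<in>{(a, b)}.
      Poly_Mapping.lookup (Poly_Mapping.single (a, b) c) p \<odot>\<^bsub>R\<^esub> \<phi> (fst p) (snd p))"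
    by (rule ev_superset) (use assms in auto)
  also have "\<dots> = c \<odot>\<^bsub>R\<^esub> \<phi> a b"
    using RR.finsum_insert[of "{}" "(a, b)" "\<lambda>p. Poly_Mapping.lookup (Poly_Mapping.single (a, b) c) p \<odot>\<^bsub>R\<^esub> \<phi> (fst p) (snd p)"]
      closed assms by simp
  finally show ?thesis .
qed

lemma ev_smult:
  assumes "t \<in> carrier T" "ev t = \<zero>\<^bsub>R\<^esub>"
  shows "ev (Poly_Mapping.map ((*) c) t) = \<zero>\<^bsub>R\<^esub>"
proof -
  have A: "finite (Poly_Mapping.keys t)" "Poly_Mapping.keys t \<subseteq> carrier H \<times> carrier H"
    using assms by (auto simp: T_carrier)
  have "ev (Poly_Mapping.map ((*) c) t) = (\<Oplus>\<^bsub>R\<^esub>p\<in>Poly_Mapping.keys t.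
      c \<odot>\<^bsub>R\<^esub> (Poly_Mapping.lookup t p \<odot>\<^bsub>R\<^esub> \<phi> (fst p) (snd p)))"
    unfolding ev_superset[OF A(1) keys_smult A(2)]
  proof (intro RR.finsum_cong' refl)
    fix p assume "p \<in> Poly_Mapping.keys t"
    then have "\<phi> (fst p) (snd p) \<in> carrier R" using A(2) closed by (auto simp: mem_Times_iff)
    then show "Poly_Mapping.lookup (Poly_Mapping.map ((*) c) t) p \<odot>\<^bsub>R\<^esub> \<phi> (fst p) (snd p) =
        c \<odot>\<^bsub>R\<^esub> (Poly_Mapping.lookup t p \<odot>\<^bsub>R\<^esub> \<phi> (fst p) (snd p))"
      using RM.smult_assoc1[of c "Poly_Mapping.lookup t p"] by (simp add: lookup_smult)
  qed (use A closed in \<open>auto simp: subset_iff\<close>)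
  also have "\<dots> = c \<odot>\<^bsub>R\<^esub> ev t"
    unfolding ev_def by (rule RM.finsum_smult_ldistr [symmetric]) (use A term_funcset[OF A(2)] in auto)
  finally show ?thesis using assms(2) by simp
qed

lemma ev_null:
  assumes "t \<in> tensor_null H H"
  shows "t \<in> carrier T" "ev t = \<zero>\<^bsub>R\<^esub>"
proof -
  have neg: "Poly_Mapping.single x c - Poly_Mapping.single y d = Poly_Mapping.single x c + Poly_Mapping.single y (- d)"
    for x y :: "'h \<times> 'h" and c d :: 'k
    by (rule poly_mapping_eqI) (simp add: lookup_minus lookup_add lookup_single when_def)
  have neg2: "f - Poly_Mapping.single y d = f + Poly_Mapping.single y (- d)"
    for f and y :: "'h \<times> 'h" and d :: 'k
    by (rule poly_mapping_eqI) (simp add: lookup_minus lookup_add lookup_single when_def)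
  have single: "Poly_Mapping.single (a, b) c \<in> carrier T" if "a \<in> carrier H" "b \<in> carrier H" for a b c
    using that by (simp add: T_carrier)
  have add: "s + t \<in> carrier T" if "s \<in> carrier T" "t \<in> carrier T" for s t
    using that Poly_Mapping.keys_add[of s t] by (auto simp: T_carrier)
  have rel: "r \<in> carrier T \<and> ev r = \<zero>\<^bsub>R\<^esub>" if "r \<in> tensor_relations H H" for r
    using that unfolding tensor_relations_def
    apply (elim UnE CollectE exE conjE)
    subgoal
      by (simp del: monoid_algebra_simps add: neg2 ev_add ev_single single add closed add1 smult_minus smult_one RR.r_neg RR.minus_add
          RR.a_assoc [symmetric])
        (simp add: closed RR.add.m_ac RR.r_neg RR.r_neg1 RR.r_neg2)
    subgoal
      by (simp del: monoid_algebra_simps add: neg2 ev_add ev_single single add closed add2 smult_minus smult_one RR.r_neg RR.minus_add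
          RR.a_assoc [symmetric])
        (simp add: closed RR.add.m_ac RR.r_neg RR.r_neg1 RR.r_neg2)
    subgoal
      by (simp del: monoid_algebra_simps add: neg2 ev_add ev_single single add closed smult1 smult_minus smult_one RR.r_neg)
    subgoal
      by (simp del: monoid_algebra_simps add: neg2 ev_add ev_single single add closed smult2 smult_minus smult_one RR.r_neg)
    done
  have "t \<in> carrier T \<and> ev t = \<zero>\<^bsub>R\<^esub>"
  proof (rule linear_span_induct[OF is_algebraD(2)[OF T_algebra] _ assms[unfolded tensor_null_def]])
    show "tensor_relations H H \<subseteq> carrier T" using rel by blast
    show "ev \<zero>\<^bsub>T\<^esub> = \<zero>\<^bsub>R\<^esub>" by (simp add: ev_def)
    fix c s y assume "s \<in> tensor_relations H H" and y: "y \<in> carrier T" "ev y = \<zero>\<^bsub>R\<^esub>"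
    then have s: "s \<in> carrier T" "ev s = \<zero>\<^bsub>R\<^esub>" using rel by auto
    then have "Poly_Mapping.map ((*) c) s \<in> carrier T" using keys_smult[of c s] by (auto simp: T_carrier)
    then show "ev (c \<odot>\<^bsub>T\<^esub> s \<oplus>\<^bsub>T\<^esub> y) = \<zero>\<^bsub>R\<^esub>"
      using ev_add[of "Poly_Mapping.map ((*) c) s" y] ev_smult[OF s] y by simp
  qed
  then show "t \<in> carrier T" "ev t = \<zero>\<^bsub>R\<^esub>" by auto
qed

lemma zero_null: "0 \<in> tensor_null H H"
proof -
  interpret M: Module.module "class_ring :: 'k ring" T by (rule is_algebraD(2)[OF T_algebra])
  have "M.lincomb (\<lambda>_. 0) {} = 0" by (simp add: M.lincomb_def)
  moreover have "M.lincomb (\<lambda>_. 0) {} \<in> M.span (tensor_relations H H)"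
    unfolding M.span_def
    by (rule CollectI, rule exI[of _ "\<lambda>_. 0"], rule exI[of _ "{}"]) auto
  ultimately show ?thesis unfolding tensor_null_def linear_span_def by simp
qed

lemma pure_tensor_elem:
  assumes "a \<in> carrier H" "b \<in> carrier H"
  shows "pure_tensor H H a b \<noteq> {}"
    and "t \<in> pure_tensor H H a b \<Longrightarrow> t \<in> carrier T \<and> ev t = \<phi> a b"
proof -
  have s: "Poly_Mapping.single (a, b) 1 \<in> carrier T" using assms by (simp add: T_carrier)
  show "pure_tensor H H a b \<noteq> {}"
    using zero_null by (auto simp: pure_tensor_def a_r_coset_def')
  show "t \<in> carrier T \<and> ev t = \<phi> a b" if t: "t \<in> pure_tensor H H a b"
  proof -
    obtain n where n: "n \<in> tensor_null H H" "t = n + Poly_Mapping.single (a, b) 1"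
      using t by (auto simp: pure_tensor_def a_r_coset_def')
    have "t \<in> carrier T"
      using n(2) ev_null(1)[OF n(1)] s Poly_Mapping.keys_add[of n "Poly_Mapping.single (a, b) 1"]
      by (auto simp: T_carrier)
    moreover have "ev t = \<phi> a b"
      using n ev_null[OF n(1)] s assms closed by (simp add: ev_add ev_single smult_one del: monoid_algebra_simps)
    ultimately show ?thesis by simp
  qed
qed

lemma tensor_lift_pure_add:
  assumes "a \<in> carrier H" "b \<in> carrier H" "c \<in> carrier H" "d \<in> carrier H"
  shows "tensor_lift R \<phi> (pure_tensor H H a b \<oplus>\<^bsub>tensor H H\<^esub> pure_tensor H H c d) = \<phi> a b \<oplus>\<^bsub>R\<^esub> \<phi> c d"
proof -
  let ?U = "pure_tensor H H a b \<oplus>\<^bsub>tensor H H\<^esub> pure_tensor H H c d"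
  have U: "?U = {s + t | s t. s \<in> pure_tensor H H a b \<and> t \<in> pure_tensor H H c d}"
    by (auto simp: tensor_def quotient_algebra_def FactRing_def set_add_def')
  obtain s0 t0 where "s0 \<in> pure_tensor H H a b" "t0 \<in> pure_tensor H H c d"
    using pure_tensor_elem(1) assms by (metis ex_in_conv)
  then have "s0 + t0 \<in> ?U" by (subst U) blast
  then have "(SOME t. t \<in> ?U) \<in> ?U" by (rule someI)
  then obtain s t where st: "(SOME t. t \<in> ?U) = s + t" "s \<in> pure_tensor H H a b" "t \<in> pure_tensor H H c d"
    by (subst (asm) (3) U) blast
  have "ev (s + t) = \<phi> a b \<oplus>\<^bsub>R\<^esub> \<phi> c d"
    using pure_tensor_elem(2)[OF assms(1,2) st(2)] pure_tensor_elem(2)[OF assms(3,4) st(3)] ev_add by simp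
  then show ?thesis
    by (simp add: tensor_lift_def ev_def Let_def st(1))
qed

end

section \<open>Quantum matrices in degree at most two\<close>

text \<open>
  A word \<open>w\<close> factors into two words in exactly \<open>length w + 1\<close> ways.
\<close>

lemma free_algebra_lookup_mult:
  fixes f g :: "'x list \<Rightarrow>\<^sub>0 'k::field"
  shows "Poly_Mapping.lookup (f \<otimes>\<^bsub>free_algebra S\<^esub> g) w =
    (\<Sum>k\<le>length w. Poly_Mapping.lookup f (take k w) * Poly_Mapping.lookup g (drop k w))"
proof -
  define A where "A = Poly_Mapping.keys f \<union> (\<lambda>k. take k w) ` {..length w}"
  define B where "B = Poly_Mapping.keys g \<union> (\<lambda>k. drop k w) ` {..length w}"
  define h where "h = (\<lambda>p. Poly_Mapping.lookup f (fst p) * Poly_Mapping.lookup g (snd p))"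
  have fin: "finite A" "finite B" by (auto simp: A_def B_def)
  have "Poly_Mapping.lookup (f \<otimes>\<^bsub>free_algebra S\<^esub> g) w =
      (\<Sum>x\<in>A. \<Sum>y\<in>B. (Poly_Mapping.lookup f x * Poly_Mapping.lookup g y) when x @ y = w)"
    using fin by (subst monoid_algebra_mult[of A B]) (auto simp: A_def B_def lookup_sum lookup_single)
  also have "\<dots> = (\<Sum>p\<in>A \<times> B. h p when fst p @ snd p = w)"
    by (simp add: sum.cartesian_product case_prod_unfold h_def)
  also have "\<dots> = (\<Sum>p\<in>{p \<in> A \<times> B. fst p @ snd p = w}. h p)"
    using fin by (simp add: when_def sum.inter_filter)
  also have "{p \<in> A \<times> B. fst p @ snd p = w} = (\<lambda>k. (take k w, drop k w)) ` {..length w}"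
  proof (intro subset_antisym subsetI)
    fix p assume "p \<in> {p \<in> A \<times> B. fst p @ snd p = w}"
    then have "w = fst p @ snd p" by auto
    then have "p = (take (length (fst p)) w, drop (length (fst p)) w)" "length (fst p) \<le> length w" by auto
    then show "p \<in> (\<lambda>k. (take k w, drop k w)) ` {..length w}" by blast
  qed (auto simp: A_def B_def)
  also have "(\<Sum>p\<in>\<dots>. h p) = (\<Sum>k\<le>length w. h (take k w, drop k w))"
  proof (rule sum.reindex_cong[OF _ refl refl], rule inj_onI)
    fix k l assume kl: "k \<in> {..length w}" "l \<in> {..length w}"
      and "(take k w, drop k w) = (take l w, drop l w)"
    then have "length (take k w) = length (take l w)" by (metis Pair_inject)
    then show "k = l" using kl by (simp add: min_absorb2)
  qed
  finally show ?thesis by (simp add: h_def)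
qed

lemma free_algebra_lookup_mult_short:
  fixes f g :: "'x list \<Rightarrow>\<^sub>0 'k::field"
  shows "Poly_Mapping.lookup (f \<otimes>\<^bsub>free_algebra S\<^esub> g) [] = Poly_Mapping.lookup f [] * Poly_Mapping.lookup g []"
    "Poly_Mapping.lookup (f \<otimes>\<^bsub>free_algebra S\<^esub> g) [u] =
       Poly_Mapping.lookup f [] * Poly_Mapping.lookup g [u] + Poly_Mapping.lookup f [u] * Poly_Mapping.lookup g []"
    "Poly_Mapping.lookup (f \<otimes>\<^bsub>free_algebra S\<^esub> g) [u, v] =
       Poly_Mapping.lookup f [] * Poly_Mapping.lookup g [u, v] + Poly_Mapping.lookup f [u] * Poly_Mapping.lookup g [v]
       + Poly_Mapping.lookup f [u, v] * Poly_Mapping.lookup g []"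
  by (simp_all add: free_algebra_lookup_mult numeral_2_eq_2)

abbreviation entries :: "nat \<Rightarrow> (nat \<times> nat) set" where
  "entries N \<equiv> {..<N} \<times> {..<N}"

lemma qmat_presentation: "presentation (entries N) (qmat_relations q N)"
proof
  have keys: "Poly_Mapping.keys (Poly_Mapping.single x c - Poly_Mapping.single y d) \<subseteq> {x, y}"
    "Poly_Mapping.keys (Poly_Mapping.single x c - Poly_Mapping.single y d - Poly_Mapping.single z e) \<subseteq> {x, y, z}"
    for x y z :: "(nat \<times> nat) list" and c d e :: 'a
    by (auto simp: in_keys_iff lookup_minus lookup_single when_def split: if_splits)
  show "qmat_relations q N \<subseteq> {f. Poly_Mapping.keys f \<subseteq> lists (entries N)}"
    unfolding qmat_relations_def
    by (auto dest!: keys[THEN subsetD])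
qed

text \<open>
  This set bounds the ideal of relations from above in degree at most two. It is an ideal: multiplying
  \<open>f\<close> by \<open>g\<close> only multiplies the quadratic part of \<open>f\<close> by the constant term of \<open>g\<close>, because \<open>f\<close> has
  no constant and no linear part.
\<close>

definition low_degree :: "'k::field \<Rightarrow> nat \<Rightarrow> ((nat \<times> nat) list \<Rightarrow>\<^sub>0 'k) set" where
  "low_degree q N = {f. Poly_Mapping.keys f \<subseteq> lists (entries N) \<and> Poly_Mapping.lookup f [] = 0 \<and>
     (\<forall>u. Poly_Mapping.lookup f [u] = 0) \<and> quad_zero q N (\<lambda>u v. Poly_Mapping.lookup f [u, v])}"

lemma low_degree_ideal: "ideal (low_degree q N) (free_algebra (entries N) :: ('k::field, (nat \<times> nat) list \<Rightarrow>\<^sub>0 'k) module)"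
proof -
  interpret presentation "entries N" "qmat_relations q N" by (rule qmat_presentation)
  show ?thesis
  proof (rule idealI)
    show "ring F" by (rule ring_axioms)
    have mem: "f \<in> low_degree q N \<longleftrightarrow> wd f \<and> Poly_Mapping.lookup f [] = 0 \<and>
        (\<forall>u. Poly_Mapping.lookup f [u] = 0) \<and> quad_zero q N (\<lambda>u v. Poly_Mapping.lookup f [u, v])" for f
      unfolding low_degree_def wd_def by blast
    have z: "0 \<in> low_degree q N" by (simp add: mem quad_zero_def)
    have add: "f + g \<in> low_degree q N" if "f \<in> low_degree q N" "g \<in> low_degree q N" for f g
      using that by (simp add: mem lookup_add quad_zero_add)
    have neg: "- f \<in> low_degree q N" if "f \<in> low_degree q N" for f
      using that quad_zero_scale[of q N "\<lambda>u v. Poly_Mapping.lookup f [u, v]" "- 1"]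
      by (simp add: mem) (simp add: wd_def)
    have inv: "inv\<^bsub>add_monoid F\<^esub> f = - f" if "f \<in> low_degree q N" for f
    proof -
      have "f \<in> carrier F" "- f \<in> carrier F" using that neg[OF that] by (simp_all add: mem wd_def)
      then have "\<ominus>\<^bsub>F\<^esub> f = - f" by (intro minus_equality) auto
      then show ?thesis by (simp add: a_inv_def)
    qed
    show "subgroup (low_degree q N) (add_monoid F)"
    proof (rule add.subgroupI)
      show "low_degree q N \<subseteq> carrier F" unfolding F_carrier by (auto simp: mem)
      show "low_degree q N \<noteq> {}" using z by blast
      show "\<ominus>\<^bsub>F\<^esub> f \<in> low_degree q N" if "f \<in> low_degree q N" for f
        using inv[OF that] neg[OF that] by (simp add: a_inv_def)
      show "f \<oplus>\<^bsub>F\<^esub> g \<in> low_degree q N" if "f \<in> low_degree q N" "g \<in> low_degree q N" for f g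
        using add that by simp
    qed
    fix f g assume f: "f \<in> low_degree q N" and g: "g \<in> carrier F"
    have wd: "wd (g \<otimes>\<^bsub>F\<^esub> f)" "wd (f \<otimes>\<^bsub>F\<^esub> g)"
      using f g F_carrier by (auto simp: mem simp del: monoid_algebra_simps)
    show "g \<otimes>\<^bsub>F\<^esub> f \<in> low_degree q N"
      using f wd quad_zero_scale[of q N "\<lambda>u v. Poly_Mapping.lookup f [u, v]" "Poly_Mapping.lookup g []"]
      by (simp add: mem free_algebra_lookup_mult_short del: split_paired_All)
    show "f \<otimes>\<^bsub>F\<^esub> g \<in> low_degree q N"
      using f wd quad_zero_scale[of q N "\<lambda>u v. Poly_Mapping.lookup f [u, v]" "Poly_Mapping.lookup g []"]
      by (simp add: mem free_algebra_lookup_mult_short mult.commute del: split_paired_All)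
  qed
qed

lemma quad_zero_row_relation:
  fixes q :: "'k::field"
  assumes "j < m"
  shows "quad_zero q N (\<lambda>u v. (if u = (i,j) \<and> v = (i,m) then 1 else 0) - (if u = (i,m) \<and> v = (i,j) then q else 0))"
  unfolding quad_zero_def by (intro conjI allI impI) (use assms in \<open>simp_all\<close>, auto)

lemma quad_zero_col_relation:
  fixes q :: "'k::field"
  assumes "i < l"
  shows "quad_zero q N (\<lambda>u v. (if u = (i,j) \<and> v = (l,j) then 1 else 0) - (if u = (l,j) \<and> v = (i,j) then q else 0))"
  unfolding quad_zero_def by (intro conjI allI impI) (use assms in \<open>simp_all\<close>, auto)

lemma quad_zero_anti_relation:
  fixes q :: "'k::field"
  assumes "i < l" "m < j"
  shows "quad_zero q N (\<lambda>u v. (if u = (i,j) \<and> v = (l,m) then 1 else 0) - (if u = (l,m) \<and> v = (i,j) then 1 else 0))"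
  unfolding quad_zero_def by (intro conjI allI impI) (use assms in \<open>simp_all\<close>, auto)

lemma quad_zero_diag_relation:
  fixes q :: "'k::field"
  assumes "i < l" "j < m"
  shows "quad_zero q N (\<lambda>u v. (if u = (i,j) \<and> v = (l,m) then 1 else 0) - (if u = (l,m) \<and> v = (i,j) then 1 else 0)
   - (if u = (i,m) \<and> v = (l,j) then (q - inverse q) else 0))"
  unfolding quad_zero_def by (intro conjI allI impI) (use assms in \<open>simp_all\<close>, auto)

lemma qmat_relations_low_degree:
  fixes q :: "'k::field"
  shows "qmat_relations q N \<subseteq> low_degree q N"
proof
  fix f assume f: "f \<in> qmat_relations q N"
  have keys: "Poly_Mapping.keys f \<subseteq> lists (entries N)"
    using presentation.rels[OF qmat_presentation] f by blast
  have "Poly_Mapping.lookup f [] = 0 \<and> (\<forall>u. Poly_Mapping.lookup f [u] = 0)"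
    using f unfolding qmat_relations_def by (auto simp: lookup_minus lookup_single)
  moreover have "quad_zero q N (\<lambda>u v. Poly_Mapping.lookup f [u, v])"
  proof -
    have look: "Poly_Mapping.lookup (Poly_Mapping.single [a, b] c) [u, v] = (if u = a \<and> v = b then c else 0)"
      for a b u v :: "nat \<times> nat" and c :: 'k
      by (auto simp: lookup_single when_def)
    show ?thesis
      using f unfolding qmat_relations_def
      by (elim UnE CollectE exE conjE disjE)
        (simp_all only: lookup_minus look quad_zero_row_relation quad_zero_col_relation quad_zero_anti_relation quad_zero_diag_relation)
  qed
  ultimately show "f \<in> low_degree q N" using keys by (simp add: low_degree_def)
qed

lemma linear_mapsD:
  fixes A :: "('k::field, 'a, 'm) module_scheme" and B :: "('k, 'b, 'n) module_scheme"
  assumes "\<xi> \<in> linear_maps A B"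
  shows "\<And>x. x \<in> carrier A \<Longrightarrow> \<xi> x \<in> carrier B"
    and "\<And>x y. x \<in> carrier A \<Longrightarrow> y \<in> carrier A \<Longrightarrow> \<xi> (x \<oplus>\<^bsub>A\<^esub> y) = \<xi> x \<oplus>\<^bsub>B\<^esub> \<xi> y"
    and "\<And>c x. x \<in> carrier A \<Longrightarrow> \<xi> (c \<odot>\<^bsub>A\<^esub> x) = c \<odot>\<^bsub>B\<^esub> \<xi> x"
  using assms by (simp_all add: linear_maps_def LinearCombinations.module_hom_def Pi_iff)

locale qmat =
  fixes q :: "'k::field" and N :: nat
begin

sublocale presentation "entries N" "qmat_relations q N" by (rule qmat_presentation)

abbreviation R where "R \<equiv> quantum_matrices q N"

abbreviation Y :: "nat \<times> nat \<Rightarrow> ((nat \<times> nat) list \<Rightarrow>\<^sub>0 'k) set" where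
  "Y a \<equiv> qmat_gen q N (fst a) (snd a)"

lemma R_P: "P = R" by (simp add: quantum_matrices_def)

lemmas R_carrier = P_carrier[unfolded R_P]
lemmas cls_in_R [simp] = cls_closed[unfolded R_P]
lemmas R_mult = cls_mult[unfolded R_P]
lemmas R_add = cls_add[unfolded R_P]
lemmas R_smult = cls_smult[unfolded R_P]
lemmas R_one = cls_one[unfolded R_P]
lemmas R_zero = cls_zero[unfolded R_P]
lemmas R_zero_iff = cls_zero_iff[unfolded R_P]
lemmas R_relation = cls_relation[unfolded R_P]
lemmas R_induct [consumes 1, case_names word add] = P_induct[unfolded R_P]

lemma Y_cls: "Y a = cls (Poly_Mapping.single [a] 1)"
  by (simp add: qmat_gen_def generator_cls)

lemma cls_zero_low_degree:
  assumes "wd f" "cls f = \<zero>\<^bsub>R\<^esub>"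
  shows "Poly_Mapping.lookup f [u] = 0" "quad_zero q N (\<lambda>u v. Poly_Mapping.lookup f [u, v])"
proof -
  have "Idl\<^bsub>F\<^esub> qmat_relations q N \<subseteq> low_degree q N"
    using ring.genideal_minimal[OF is_algebraD(1)[OF F_algebra] low_degree_ideal qmat_relations_low_degree] .
  then have "f \<in> low_degree q N" using assms R_zero_iff by blast
  then show "Poly_Mapping.lookup f [u] = 0" "quad_zero q N (\<lambda>u v. Poly_Mapping.lookup f [u, v])"
    unfolding low_degree_def by blast+
qed

text \<open>
  Lifts of the elements of the span of the generators to the free algebra.
\<close>

definition lin :: "(nat \<times> nat \<Rightarrow> 'k) \<Rightarrow> (nat \<times> nat) list \<Rightarrow>\<^sub>0 'k" where
  "lin f = (\<Sum>b\<in>entries N. Poly_Mapping.single [b] (f b))"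

lemma wd_lin [simp]: "wd (lin f)"
  unfolding lin_def by (intro wd_sum) auto

lemma lookup_lin:
  "Poly_Mapping.lookup (lin f) [b] = (if b \<in> entries N then f b else 0)"
  "Poly_Mapping.lookup (lin f) [] = 0"
  "Poly_Mapping.lookup (lin f) (b # c # w) = 0"
  by (auto simp: lin_def lookup_sum lookup_single when_def)

lemma lin_single: "b \<in> entries N \<Longrightarrow> lin (\<lambda>u. if u = b then c else 0) = Poly_Mapping.single [b] c"
  unfolding lin_def by (subst sum.remove[of _ b]) (auto intro: sum.neutral)

lemma lin_add: "lin f + lin g = lin (\<lambda>b. f b + g b)"
  by (simp add: lin_def single_add sum.distrib)

lemma lin_smult: "Poly_Mapping.map ((*) c) (lin f) = lin (\<lambda>b. c * f b)"
  by (simp add: lin_def smult_sum smult_single)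

lemma lin_cong: "(\<And>b. b \<in> entries N \<Longrightarrow> f b = g b) \<Longrightarrow> lin f = lin g"
  by (simp add: lin_def)

lemma cls_lin_eq:
  assumes "cls (lin f) = cls (lin g)" "b \<in> entries N"
  shows "f b = g b"
proof -
  have "cls (lin f) \<oplus>\<^bsub>R\<^esub> (-1) \<odot>\<^bsub>R\<^esub> cls (lin g) = cls (lin g) \<oplus>\<^bsub>R\<^esub> (-1) \<odot>\<^bsub>R\<^esub> cls (lin g)"
    using assms by simp
  also have "\<dots> = \<zero>\<^bsub>R\<^esub>"
    by (simp add: R_smult R_add lin_smult lin_add R_zero) (simp add: lin_def)
  finally have "cls (lin (\<lambda>b. f b - g b)) = \<zero>\<^bsub>R\<^esub>"
    by (simp add: R_smult R_add lin_smult lin_add)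
  from cls_zero_low_degree(1)[OF _ this, of b] show ?thesis using assms(2) by (simp add: lookup_lin)
qed

lemma span_lin:
  assumes alg: "is_algebra R"
    and v: "v \<in> linear_span R {qmat_gen q N i j | i j. i < N \<and> j < N}"
  shows "\<exists>f. v = cls (lin f)"
proof -
  have gen: "qmat_gen q N i j = cls (lin (\<lambda>u. if u = (i, j) then 1 else 0))" if "i < N" "j < N" for i j
    using Y_cls[of "(i, j)"] that by (simp add: lin_single)
  have "v \<in> carrier R \<and> (\<exists>f. v = cls (lin f))"
  proof (rule linear_span_induct[OF is_algebraD(2)[OF alg] _ v])
    show "{qmat_gen q N i j | i j. i < N \<and> j < N} \<subseteq> carrier R" by (auto simp: gen)
    show "\<exists>f. \<zero>\<^bsub>R\<^esub> = cls (lin f)"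
      by (rule exI[of _ "\<lambda>_. 0"]) (simp add: lin_def R_zero)
    fix c s y assume "s \<in> {qmat_gen q N i j | i j. i < N \<and> j < N}" "\<exists>f. y = cls (lin f)"
    then show "\<exists>f. c \<odot>\<^bsub>R\<^esub> s \<oplus>\<^bsub>R\<^esub> y = cls (lin f)"
      by (auto simp: gen R_smult R_add lin_smult lin_add)
  qed
  then show ?thesis by simp
qed

lemma Y_in_span:
  assumes alg: "is_algebra R" and a: "a \<in> entries N"
  shows "Y a \<in> linear_span R {qmat_gen q N i j | i j. i < N \<and> j < N}"
proof -
  interpret M: Module.module "class_ring :: 'k ring" R by (rule is_algebraD(2)[OF alg])
  have "{qmat_gen q N i j | i j. i < N \<and> j < N} \<subseteq> carrier R"
    using Y_cls by auto
  then have "{qmat_gen q N i j | i j. i < N \<and> j < N} \<subseteq> M.span {qmat_gen q N i j | i j. i < N \<and> j < N}"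
    by (rule M.in_own_span)
  moreover have "Y a \<in> {qmat_gen q N i j | i j. i < N \<and> j < N}"
    using a by (intro CollectI exI[of _ "fst a"] exI[of _ "snd a"]) auto
  ultimately show ?thesis unfolding linear_span_def by blast
qed

subsection \<open>Linear maps preserving the span of the generators\<close>

lemma linear_map_zero:
  assumes \<xi>: "\<xi> \<in> linear_maps R R"
  shows "\<xi> \<zero>\<^bsub>R\<^esub> = \<zero>\<^bsub>R\<^esub>"
proof -
  have z: "0 \<odot>\<^bsub>R\<^esub> r = \<zero>\<^bsub>R\<^esub>" if "r \<in> carrier R" for r
  proof -
    have "Poly_Mapping.map ((*) 0) f = 0" for f :: "(nat \<times> nat) list \<Rightarrow>\<^sub>0 'k"
      by (rule poly_mapping_eqI) (simp add: lookup_smult)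
    then show ?thesis using that by (auto simp: R_carrier R_smult R_zero)
  qed
  have "\<zero>\<^bsub>R\<^esub> \<in> carrier R" by (simp add: R_zero)
  then show ?thesis using linear_mapsD(3)[OF \<xi>, of "\<zero>\<^bsub>R\<^esub>" 0] linear_mapsD(1)[OF \<xi>] by (simp add: z)
qed

lemma linear_map_sum:
  assumes \<xi>: "\<xi> \<in> linear_maps R R"
    and x: "\<And>i. i \<in> A \<Longrightarrow> wd (f i) \<and> wd (g i) \<and> \<xi> (cls (f i)) = cls (g i)"
  shows "\<xi> (cls (\<Sum>i\<in>A. f i)) = cls (\<Sum>i\<in>A. g i)"
  using x
proof (induction A rule: infinite_finite_induct)
  case (insert i A)
  then have "\<xi> (cls (f i) \<oplus>\<^bsub>R\<^esub> cls (\<Sum>i\<in>A. f i)) = cls (g i) \<oplus>\<^bsub>R\<^esub> cls (\<Sum>i\<in>A. g i)"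
    using linear_mapsD(2)[OF \<xi>] by simp
  then show ?case using insert by (simp add: R_add)
qed (use linear_map_zero[OF \<xi>] in \<open>simp_all add: R_zero\<close>)

lemma linear_map_single:
  assumes \<xi>: "\<xi> \<in> linear_maps R R" and w: "w \<in> lists (entries N)"
    and x: "\<xi> (cls (Poly_Mapping.single w 1)) = cls g" "wd g"
  shows "\<xi> (cls (Poly_Mapping.single w c)) = cls (Poly_Mapping.map ((*) c) g)"
proof -
  have "cls (Poly_Mapping.single w c) = c \<odot>\<^bsub>R\<^esub> cls (Poly_Mapping.single w 1)"
    using w by (simp add: R_smult smult_single)
  then have "\<xi> (cls (Poly_Mapping.single w c)) = c \<odot>\<^bsub>R\<^esub> \<xi> (cls (Poly_Mapping.single w 1))"
    using linear_mapsD(3)[OF \<xi>, of "cls (Poly_Mapping.single w 1)" c] w by simp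
  then show ?thesis using x by (simp add: R_smult)
qed

lemma linear_map_lin:
  assumes \<xi>: "\<xi> \<in> linear_maps R R" and x: "\<And>a. a \<in> entries N \<Longrightarrow> \<xi> (Y a) = cls (lin (x a))"
  shows "\<xi> (cls (lin f)) = cls (lin (\<lambda>c. \<Sum>a\<in>entries N. f a * x a c))"
proof -
  have "\<xi> (cls (lin f)) = cls (\<Sum>a\<in>entries N. Poly_Mapping.map ((*) (f a)) (lin (x a)))"
    unfolding lin_def[of f]
  proof (rule linear_map_sum[OF \<xi>])
    fix a assume "a \<in> entries N"
    then show "wd (Poly_Mapping.single [a] (f a)) \<and> wd (Poly_Mapping.map ((*) (f a)) (lin (x a))) \<and>
      \<xi> (cls (Poly_Mapping.single [a] (f a))) = cls (Poly_Mapping.map ((*) (f a)) (lin (x a)))"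
      using linear_map_single[OF \<xi>, of "[a]" "lin (x a)"] x Y_cls by auto
  qed
  also have "(\<Sum>a\<in>entries N. Poly_Mapping.map ((*) (f a)) (lin (x a))) =
      lin (\<lambda>c. \<Sum>a\<in>entries N. f a * x a c)"
    unfolding lin_smult unfolding lin_def single_sum by (rule sum.swap)
  finally show ?thesis .
qed

text \<open>
  As the generators are linearly independent (\<open>cls_lin_eq\<close>), an identity of linear maps becomes an
  identity of matrices.
\<close>

lemma commutation_coefficients:
  assumes \<xi>: "\<xi> \<in> linear_maps R R" and x: "\<And>a. a \<in> entries N \<Longrightarrow> \<xi> (Y a) = cls (lin (x a))"
    and Z: "Z \<in> linear_maps R R" and z: "\<And>a. a \<in> entries N \<Longrightarrow> Z (Y a) = cls (lin (z a))"
    and comm: "\<And>r. r \<in> carrier R \<Longrightarrow> \<xi> (Z r) = p \<odot>\<^bsub>R\<^esub> Z (\<xi> r)"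
    and a: "a \<in> entries N" and d: "d \<in> entries N"
  shows "(\<Sum>c\<in>entries N. z a c * x c d) = p * (\<Sum>c\<in>entries N. x a c * z c d)"
proof -
  have "Y a \<in> carrier R" using a by (auto simp: Y_cls)
  from comm[OF this]
  have "cls (lin (\<lambda>d. \<Sum>c\<in>entries N. z a c * x c d)) = cls (lin (\<lambda>d. p * (\<Sum>c\<in>entries N. x a c * z c d)))"
    using a linear_map_lin[OF \<xi> x] linear_map_lin[OF Z z] by (simp add: x z R_smult lin_smult)
  from cls_lin_eq[OF this d] show ?thesis .
qed

subsection \<open>Skew derivations\<close>

text \<open>
  With \<open>t = 0\<close> the hypothesis \<open>rel\<close> covers the relations of two terms as well.
\<close>

lemma relation_coefficients:
  assumes K: "\<And>a. a \<in> entries N \<Longrightarrow> K (Y a) = cls (lin (k a))"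
    and \<xi>: "\<xi> \<in> linear_maps R R" and x: "\<And>a. a \<in> entries N \<Longrightarrow> \<xi> (Y a) = cls (lin (x a))"
    and leib: "\<And>r s. r \<in> carrier R \<Longrightarrow> s \<in> carrier R \<Longrightarrow>
                 \<xi> (r \<otimes>\<^bsub>R\<^esub> s) = K r \<otimes>\<^bsub>R\<^esub> \<xi> s \<oplus>\<^bsub>R\<^esub> \<xi> r \<otimes>\<^bsub>R\<^esub> s"
    and ab: "a \<in> entries N" "b \<in> entries N" "e \<in> entries N" "f \<in> entries N"
    and rel: "Poly_Mapping.single [a, b] 1 - Poly_Mapping.single [b, a] p - Poly_Mapping.single [e, f] t
                \<in> qmat_relations q N"
  shows "quad_zero q N (\<lambda>u v. leibniz k x a b u v - p * leibniz k x b a u v - t * leibniz k x e f u v)"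
proof -
  define D where "D = (\<lambda>a b. lin (k a) \<otimes>\<^bsub>F\<^esub> lin (x b) + lin (x a) \<otimes>\<^bsub>F\<^esub> Poly_Mapping.single [b] 1)"
  have wdD: "wd (D a b)" if "b \<in> entries N" for a b using that by (auto simp: D_def)
  have XD: "\<xi> (cls (Poly_Mapping.single [a, b] c)) = cls (Poly_Mapping.map ((*) c) (D a b))"
    if "a \<in> entries N" "b \<in> entries N" for a b c
  proof (rule linear_map_single[OF \<xi>])
    have "cls (Poly_Mapping.single [a, b] 1) = Y a \<otimes>\<^bsub>R\<^esub> Y b"
      using that by (simp add: Y_cls R_mult monoid_algebra_mult_single)
    then show "\<xi> (cls (Poly_Mapping.single [a, b] 1)) = cls (D a b)"
      using that leib[of "Y a" "Y b"] by (simp add: K x) (simp add: Y_cls R_mult R_add D_def)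
  qed (use that wdD in auto)
  have lookup_D: "Poly_Mapping.lookup (D a b) [u, v] = leibniz k x a b u v"
    if "u \<in> entries N" "v \<in> entries N" for a b u v
    using that by (simp add: D_def lookup_add free_algebra_lookup_mult_short lookup_lin lookup_single
        leibniz_def when_def eq_commute)
  let ?s = "\<lambda>a b c. Poly_Mapping.single [a, b] c"
  have r: "?s a b 1 - ?s b a p - ?s e f t = ?s a b 1 + (?s b a (- p) + ?s e f (- t))"
    by (rule poly_mapping_eqI) (simp add: lookup_minus lookup_add lookup_single when_def)
  have "cls (?s a b 1) \<oplus>\<^bsub>R\<^esub> (cls (?s b a (- p)) \<oplus>\<^bsub>R\<^esub> cls (?s e f (- t))) = \<zero>\<^bsub>R\<^esub>"
    using R_relation[OF rel] ab by (simp add: R_add r)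
  then have "\<xi> (cls (?s a b 1)) \<oplus>\<^bsub>R\<^esub> (\<xi> (cls (?s b a (- p))) \<oplus>\<^bsub>R\<^esub> \<xi> (cls (?s e f (- t)))) = \<zero>\<^bsub>R\<^esub>"
    using linear_mapsD(2)[OF \<xi>] linear_map_zero[OF \<xi>] ab by (metis (no_types, lifting) Cons_in_lists_iff R_add cls_in_R lists.Nil wd_add wd_single)
  then have "cls (Poly_Mapping.map ((*) 1) (D a b) + (Poly_Mapping.map ((*) (- p)) (D b a) +
      Poly_Mapping.map ((*) (- t)) (D e f))) = \<zero>\<^bsub>R\<^esub>"
    using ab wdD by (simp add: XD R_add)
  from cls_zero_low_degree(2)[OF _ this]
  have "quad_zero q N (\<lambda>u v. Poly_Mapping.lookup (Poly_Mapping.map ((*) 1) (D a b) +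
      (Poly_Mapping.map ((*) (- p)) (D b a) + Poly_Mapping.map ((*) (- t)) (D e f))) [u, v])"
    using ab wdD by simp
  then show ?thesis
    by (rule quad_zero_cong) (use lookup_D in \<open>simp add: lookup_add lookup_smult\<close>)
qed

lemma skew_derivation_coefficients:
  assumes K: "\<And>a. a \<in> entries N \<Longrightarrow> K (Y a) = cls (lin (k a))"
    and \<xi>: "\<xi> \<in> linear_maps R R" and x: "\<And>a. a \<in> entries N \<Longrightarrow> \<xi> (Y a) = cls (lin (x a))"
    and leib: "\<And>r s. r \<in> carrier R \<Longrightarrow> s \<in> carrier R \<Longrightarrow>
                 \<xi> (r \<otimes>\<^bsub>R\<^esub> s) = K r \<otimes>\<^bsub>R\<^esub> \<xi> s \<oplus>\<^bsub>R\<^esub> \<xi> r \<otimes>\<^bsub>R\<^esub> s"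
  shows "skew_derivation q N k x"
proof -
  note rel = relation_coefficients[OF K \<xi> x leib]
  show ?thesis
    unfolding skew_derivation_def
  proof (intro conjI allI impI)
    fix i j m assume *: "i < N" "j < N" "m < N" "j < m"
    have mem: "Poly_Mapping.single [(i, j), (i, m)] 1 - Poly_Mapping.single [(i, m), (i, j)] q \<in> qmat_relations q N"
      using * unfolding qmat_relations_def by blast
    show "quad_zero q N (\<lambda>u v. leibniz k x (i, j) (i, m) u v - q * leibniz k x (i, m) (i, j) u v)"
      using rel[of "(i, j)" "(i, m)" "(i, j)" "(i, j)" q 0] * mem by auto
  next
    fix i l j assume *: "i < N" "l < N" "j < N" "i < l"
    have mem: "Poly_Mapping.single [(i, j), (l, j)] 1 - Poly_Mapping.single [(l, j), (i, j)] q \<in> qmat_relations q N"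
      using * unfolding qmat_relations_def by blast
    show "quad_zero q N (\<lambda>u v. leibniz k x (i, j) (l, j) u v - q * leibniz k x (l, j) (i, j) u v)"
      using rel[of "(i, j)" "(l, j)" "(i, j)" "(i, j)" q 0] * mem by auto
  next
    fix i l j m assume *: "i < N" "l < N" "j < N" "m < N" "i < l" "j < m"
    have "Poly_Mapping.single [(i, m), (l, j)] 1 - Poly_Mapping.single [(l, j), (i, m)] 1 \<in> qmat_relations q N"
      using * unfolding qmat_relations_def by blast
    then show "quad_zero q N (\<lambda>u v. leibniz k x (i, m) (l, j) u v - leibniz k x (l, j) (i, m) u v)"
      using rel[of "(i, m)" "(l, j)" "(i, j)" "(i, j)" 1 0] * by auto
    have "Poly_Mapping.single [(i, j), (l, m)] 1 - Poly_Mapping.single [(l, m), (i, j)] 1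
        - Poly_Mapping.single [(i, m), (l, j)] (q - inverse q) \<in> qmat_relations q N"
      using * unfolding qmat_relations_def by blast
    then show "quad_zero q N (\<lambda>u v. leibniz k x (i, j) (l, m) u v - leibniz k x (l, m) (i, j) u v
          - (q - inverse q) * leibniz k x (i, m) (l, j) u v)"
      using rel[of "(i, j)" "(l, m)" "(i, m)" "(l, j)" 1 "q - inverse q"] * by auto
  qed
qed

text \<open>
  Since \<open>K\<close> fixes 1, the Leibniz rule gives \<open>\<xi>(1) = \<xi>(1) + \<xi>(1)\<close>, hence \<open>\<xi>(1) = 0\<close>. By the Leibniz
  rule again, \<open>\<xi>\<close> vanishes on all words.
\<close>

lemma skew_derivation_zero:
  assumes alg: "is_algebra R" and K: "\<And>r. r \<in> carrier R \<Longrightarrow> K r \<in> carrier R" "K \<one>\<^bsub>R\<^esub> = \<one>\<^bsub>R\<^esub>"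
    and \<xi>: "\<xi> \<in> linear_maps R R" and x: "\<And>a. a \<in> entries N \<Longrightarrow> \<xi> (Y a) = \<zero>\<^bsub>R\<^esub>"
    and leib: "\<And>r s. r \<in> carrier R \<Longrightarrow> s \<in> carrier R \<Longrightarrow>
                 \<xi> (r \<otimes>\<^bsub>R\<^esub> s) = K r \<otimes>\<^bsub>R\<^esub> \<xi> s \<oplus>\<^bsub>R\<^esub> \<xi> r \<otimes>\<^bsub>R\<^esub> s"
    and r: "r \<in> carrier R"
  shows "\<xi> r = \<zero>\<^bsub>R\<^esub>"
proof -
  interpret RR: ring R by (rule is_algebraD(1)[OF alg])
  interpret RM: Module.module "class_ring :: 'k ring" R by (rule is_algebraD(2)[OF alg])
  have "\<xi> \<one>\<^bsub>R\<^esub> \<oplus>\<^bsub>R\<^esub> \<xi> \<one>\<^bsub>R\<^esub> = \<xi> \<one>\<^bsub>R\<^esub>"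
    using leib[of "\<one>\<^bsub>R\<^esub>" "\<one>\<^bsub>R\<^esub>"] K(2) linear_mapsD(1)[OF \<xi>, of "\<one>\<^bsub>R\<^esub>"] by simp
  then have one: "\<xi> \<one>\<^bsub>R\<^esub> = \<zero>\<^bsub>R\<^esub>"
    using linear_mapsD(1)[OF \<xi>, of "\<one>\<^bsub>R\<^esub>"] by simp
  have word: "\<xi> (cls (Poly_Mapping.single w 1)) = \<zero>\<^bsub>R\<^esub>" if "w \<in> lists (entries N)" for w
    using that
  proof (induction w)
    case Nil
    then show ?case using one by (simp add: R_one)
  next
    case (Cons a w)
    then have a: "a \<in> entries N" "w \<in> lists (entries N)" by auto
    have c: "Y a \<in> carrier R" "cls (Poly_Mapping.single w 1) \<in> carrier R"
      using a by (auto simp: Y_cls)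
    have "cls (Poly_Mapping.single (a # w) 1) = Y a \<otimes>\<^bsub>R\<^esub> cls (Poly_Mapping.single w 1)"
      using a by (simp add: Y_cls R_mult monoid_algebra_mult_single)
    then show ?case using Cons.IH leib[OF c] x a c K by simp
  qed
  show ?thesis using r
  proof (induction r rule: R_induct)
    case (word w c)
    then have "\<xi> (cls (Poly_Mapping.single w c)) = cls (Poly_Mapping.map ((*) c) 0)"
      using linear_map_single[OF \<xi>, of w 0 c] \<open>w \<in> lists (entries N) \<Longrightarrow> \<xi> (cls (Poly_Mapping.single w 1)) = \<zero>\<^bsub>R\<^esub>\<close>
      by (simp add: R_zero)
    moreover have "Poly_Mapping.map ((*) c) 0 = (0 :: (nat \<times> nat) list \<Rightarrow>\<^sub>0 'k)"
      by (rule poly_mapping_eqI) (simp add: lookup_smult)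
    ultimately show ?case by (simp add: R_zero)
  next
    case (add f g)
    then show ?case using linear_mapsD(2)[OF \<xi>, of "cls f" "cls g"] by (simp add: R_add)
  qed
qed

end

section \<open>The torus and the transposition\<close>

text \<open>
  If a minor of order two is nonzero, the two columns through it are linearly independent.
\<close>

lemma rank_one_minor:
  fixes A :: "'k::field mat"
  assumes A: "A \<in> carrier_mat N N" and rank: "vec_space.rank N A = 1"
    and b: "i < N" "j < N" "k < N" "l < N"
  shows "A $$ (i, j) * A $$ (k, l) = A $$ (i, l) * A $$ (k, j)"
proof (rule ccontr)
  interpret vec_space "TYPE('k)" N .
  assume ne: "A $$ (i, j) * A $$ (k, l) \<noteq> A $$ (i, l) * A $$ (k, j)"
  let ?u = "col A j" and ?w = "col A l"
  have at: "?u $ i = A $$ (i, j)" "?u $ k = A $$ (k, j)" "?w $ i = A $$ (i, l)" "?w $ k = A $$ (k, l)"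
    using A b by auto
  have uw: "?u \<noteq> ?w" using ne at by (metis mult.commute)
  have car: "{?u, ?w} \<subseteq> carrier_vec N" using A by auto
  have "lin_indpt {?u, ?w}"
  proof
    assume "lin_dep {?u, ?w}"
    then obtain a v where a: "lincomb a {?u, ?w} = 0\<^sub>v N" "v \<in> {?u, ?w}" "a v \<noteq> 0"
      using finite_lin_dep[of "{?u, ?w}"] car by auto
    have eq: "a ?u * ?u $ r + a ?w * ?w $ r = 0" if "r < N" for r
      using lincomb_index[OF that car, of a] a(1) uw that by simp
    have "a ?u * (A $$ (i, j) * A $$ (k, l) - A $$ (i, l) * A $$ (k, j)) =
        (a ?u * ?u $ i + a ?w * ?w $ i) * A $$ (k, l) - (a ?u * ?u $ k + a ?w * ?w $ k) * A $$ (i, l)"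
      unfolding at by (simp add: algebra_simps)
    then have u: "a ?u = 0" using eq b ne by simp
    have "a ?w * (A $$ (i, j) * A $$ (k, l) - A $$ (i, l) * A $$ (k, j)) =
        (a ?u * ?u $ k + a ?w * ?w $ k) * A $$ (i, j) - (a ?u * ?u $ i + a ?w * ?w $ i) * A $$ (k, j)"
      unfolding at by (simp add: algebra_simps)
    then have "a ?w = 0" using eq b ne by simp
    then show False using a u by auto
  qed
  then have "card {?u, ?w} \<le> rank A"
    using A b by (intro rank_ge_card_indpt[OF A]) (auto simp: cols_def)
  then show False using uw rank by simp
qed

lemma algebra_autsD:
  assumes "f \<in> algebra_auts A"
  shows "f \<in> Bij (carrier A)" "f \<in> linear_maps A A" "f \<one>\<^bsub>A\<^esub> = \<one>\<^bsub>A\<^esub>"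
    and "\<And>x y. x \<in> carrier A \<Longrightarrow> y \<in> carrier A \<Longrightarrow> f (x \<otimes>\<^bsub>A\<^esub> y) = f x \<otimes>\<^bsub>A\<^esub> f y"
  using assms by (auto simp: algebra_auts_def algebra_homs_def ring_hom_one ring_hom_mult)

lemma linear_mapsI:
  fixes A :: "('k::field, 'a, 'm) module_scheme" and B :: "('k, 'b, 'n) module_scheme"
  assumes "\<And>x. x \<in> carrier A \<Longrightarrow> f x \<in> carrier B"
    and "\<And>x y. x \<in> carrier A \<Longrightarrow> y \<in> carrier A \<Longrightarrow> f (x \<oplus>\<^bsub>A\<^esub> y) = f x \<oplus>\<^bsub>B\<^esub> f y"
    and "\<And>c x. x \<in> carrier A \<Longrightarrow> f (c \<odot>\<^bsub>A\<^esub> x) = c \<odot>\<^bsub>B\<^esub> f x"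
  shows "f \<in> linear_maps A B"
  using assms by (simp add: linear_maps_def LinearCombinations.module_hom_def)

lemma algebra_auts_compose:
  assumes A: "is_algebra A" and f: "f \<in> algebra_auts A" and g: "g \<in> algebra_auts A"
  shows "compose (carrier A) f g \<in> algebra_auts A"
proof -
  interpret ring A by (rule is_algebraD(1)[OF A])
  note F = algebra_autsD[OF f] and G = algebra_autsD[OF g]
  note lf = linear_mapsD[OF F(2)] and lg = linear_mapsD[OF G(2)]
  have "compose (carrier A) f g \<in> linear_maps A A"
    by (rule linear_mapsI) (use lf lg is_algebraD(5)[OF A] in \<open>auto simp: compose_def\<close>)
  moreover have "compose (carrier A) f g \<in> Ring.ring_hom A A"
    by (rule ring_hom_memI) (use F G lf lg in \<open>auto simp: compose_def\<close>)
  ultimately show ?thesis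
    using compose_Bij[OF F(1) G(1)] by (simp add: algebra_auts_def algebra_homs_def)
qed

lemma id_algebra_aut:
  assumes A: "is_algebra A"
  shows "(\<lambda>x\<in>carrier A. x) \<in> algebra_auts A"
proof -
  interpret ring A by (rule is_algebraD(1)[OF A])
  have "(\<lambda>x\<in>carrier A. x) \<in> linear_maps A A"
    by (rule linear_mapsI) (use is_algebraD(5)[OF A] in auto)
  moreover have "(\<lambda>x\<in>carrier A. x) \<in> Ring.ring_hom A A"
    by (rule ring_hom_memI) auto
  ultimately show ?thesis by (simp add: algebra_auts_def algebra_homs_def id_Bij)
qed

lemma Aut_algebra_simps:
  "carrier (Aut_algebra A) = algebra_auts A"
  "\<one>\<^bsub>Aut_algebra A\<^esub> = (\<lambda>x\<in>carrier A. x)"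
  "f \<in> algebra_auts A \<Longrightarrow> g \<in> algebra_auts A \<Longrightarrow> f \<otimes>\<^bsub>Aut_algebra A\<^esub> g = compose (carrier A) f g"
  using algebra_autsD(1)[of f A] algebra_autsD(1)[of g A]
  by (simp_all add: Aut_algebra_def BijGroup_def)

context qmat
begin

lemma aut_fixing_generators:
  assumes f: "f \<in> algebra_auts R" and Y: "\<And>a. a \<in> entries N \<Longrightarrow> f (Y a) = Y a" and r: "r \<in> carrier R"
  shows "f r = r"
proof -
  note F = algebra_autsD[OF f] and L = linear_mapsD[OF algebra_autsD(2)[OF f]]
  have aut_word: "f (cls (Poly_Mapping.single w 1)) = cls (Poly_Mapping.single w 1)" if "w \<in> lists (entries N)" for w
    using that
  proof (induction w)
    case Nil
    then show ?case using F(3) by (simp add: R_one)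
  next
    case (Cons a w)
    have e: "cls (Poly_Mapping.single (a # w) 1) = Y a \<otimes>\<^bsub>R\<^esub> cls (Poly_Mapping.single w 1)"
      using Cons.hyps by (simp add: Y_cls R_mult monoid_algebra_mult_single)
    have "Y a \<in> carrier R" "cls (Poly_Mapping.single w 1) \<in> carrier R"
      using Cons.hyps by (auto simp: Y_cls)
    then show ?case using Cons F(4) Y unfolding e by simp
  qed
  show ?thesis using r
  proof (induction r rule: R_induct)
    case (word w c)
    then have "f (cls (Poly_Mapping.single w c)) = cls (Poly_Mapping.map ((*) c) (Poly_Mapping.single w 1))"
      using aut_word linear_map_single[OF F(2), of w "Poly_Mapping.single w 1" c] by simp
    then show ?case by (simp add: smult_single)
  next
    case (add g h)
    then show ?case using L(2)[of "cls g" "cls h"] by (simp add: R_add)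
  qed
qed

lemma transpose_square:
  assumes t: "\<tau> \<in> transpose_auts q N" and alg: "is_algebra R" and r: "r \<in> carrier R"
  shows "\<tau> (\<tau> r) = r"
proof -
  have aut: "\<tau> \<in> algebra_auts R"
    and Y: "\<And>i j. i < N \<Longrightarrow> j < N \<Longrightarrow> \<tau> (qmat_gen q N i j) = qmat_gen q N j i"
    using t by (auto simp: transpose_auts_def)
  have "compose (carrier R) \<tau> \<tau> r = r"
  proof (rule aut_fixing_generators[OF algebra_auts_compose[OF alg aut aut] _ r])
    fix a assume "a \<in> entries N"
    moreover have "Y a \<in> carrier R" if "a \<in> entries N" using that by (auto simp: Y_cls)
    ultimately show "compose (carrier R) \<tau> \<tau> (Y a) = Y a"
      using Y by (auto simp: compose_def)
  qed
  then show ?thesis using r by (simp add: compose_def)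
qed

text \<open>
  The inverse in a monoid is given by a unique description. Any right inverse of \<open>\<tau>\<close> equals
  \<open>\<tau>\<close>, because \<open>\<tau>\<close> is an involution.
\<close>

lemma transpose_inverse:
  assumes t: "\<tau> \<in> transpose_auts q N" and alg: "is_algebra R"
  shows "inv\<^bsub>Aut_algebra R\<^esub> \<tau> = \<tau>"
proof -
  have aut: "\<tau> \<in> algebra_auts R" using t by (simp add: transpose_auts_def)
  have ext: "f \<in> extensional (carrier R)" if "f \<in> algebra_auts R" for f
    using that by (auto dest: algebra_autsD(1) Bij_imp_extensional)
  have sq: "\<tau> \<otimes>\<^bsub>Aut_algebra R\<^esub> \<tau> = \<one>\<^bsub>Aut_algebra R\<^esub>"
    unfolding Aut_algebra_simps(3)[OF aut aut] Aut_algebra_simps(2) compose_def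
    by (rule restrict_ext) (rule transpose_square[OF t alg])
  show ?thesis
    unfolding m_inv_def
  proof (rule the_equality)
    show "\<tau> \<in> carrier (Aut_algebra R) \<and> \<tau> \<otimes>\<^bsub>Aut_algebra R\<^esub> \<tau> = \<one>\<^bsub>Aut_algebra R\<^esub> \<and>
      \<tau> \<otimes>\<^bsub>Aut_algebra R\<^esub> \<tau> = \<one>\<^bsub>Aut_algebra R\<^esub>"
      using sq aut by (simp add: Aut_algebra_simps(1))
    fix f assume f: "f \<in> carrier (Aut_algebra R) \<and> \<tau> \<otimes>\<^bsub>Aut_algebra R\<^esub> f = \<one>\<^bsub>Aut_algebra R\<^esub> \<and>
      f \<otimes>\<^bsub>Aut_algebra R\<^esub> \<tau> = \<one>\<^bsub>Aut_algebra R\<^esub>"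
    then have fa: "f \<in> algebra_auts R" by (simp add: Aut_algebra_simps(1))
    show "f = \<tau>"
    proof (rule extensionalityI[OF ext[OF fa] ext[OF aut]])
      fix r assume r: "r \<in> carrier R"
      have "compose (carrier R) \<tau> f = (\<lambda>x\<in>carrier R. x)"
        using f by (simp add: Aut_algebra_simps aut fa)
      from fun_cong[OF this, of r] have "\<tau> (f r) = r" using r by (simp add: compose_def)
      moreover have "f r \<in> carrier R" using linear_mapsD(1)[OF algebra_autsD(2)[OF fa] r] .
      ultimately show "f r = \<tau> r" using transpose_square[OF t alg, of "f r"] by simp
    qed
  qed
qed

lemma generate_transpose:
  assumes alg: "is_algebra R" and k: "k \<in> generate (Aut_algebra R) (transpose_auts q N)"
  shows "k \<in> algebra_auts R \<and>
    ((\<forall>a\<in>entries N. k (Y a) = Y a) \<or> (\<forall>a\<in>entries N. k (Y a) = Y (tr a)))"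
proof -
  have Yc: "Y a \<in> carrier R" if "a \<in> entries N" for a using that by (auto simp: Y_cls)
  have tr: "tr a \<in> entries N" if "a \<in> entries N" for a using that by auto
  have swap: "h \<in> algebra_auts R \<and> (\<forall>a\<in>entries N. h (Y a) = Y (tr a))"
    if "h \<in> transpose_auts q N" for h
    using that by (auto simp: transpose_auts_def)
  show ?thesis using k
  proof (induction k rule: generate.induct)
    case one
    have "\<forall>a\<in>entries N. (\<lambda>x\<in>carrier R. x) (Y a) = Y a" using Yc by (simp del: restrict_apply add: restrict_apply')
    then show ?case unfolding Aut_algebra_simps(2) using id_algebra_aut[OF alg] by blast
  next
    case (incl h)
    then show ?case using swap by blast
  next
    case (inv h)
    then show ?case using swap[of h] transpose_inverse[OF inv alg] by simp
  next
    case (eng h k)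
    have "compose (carrier R) h k (Y a) = h (k (Y a))" if "a \<in> entries N" for a
      using Yc[OF that] by (simp add: compose_def)
    then have "(\<forall>a\<in>entries N. compose (carrier R) h k (Y a) = Y a) \<or>
        (\<forall>a\<in>entries N. compose (carrier R) h k (Y a) = Y (tr a))"
      using eng.IH tr by auto
    then show ?case
      using eng.IH algebra_auts_compose[OF alg, of h k] by (simp add: Aut_algebra_simps(3))
  qed
qed

text \<open>
  A torus element applied after the transposition scales by the entry of its matrix at the transposed
  position; this reindexing is absorbed into \<open>\<alpha>\<close>.
\<close>

lemma torus_transpose_cases:
  assumes alg: "is_algebra R" and K: "restrict K (carrier R) \<in> torus_transpose_group q N"
  obtains \<alpha> where "K \<one>\<^bsub>R\<^esub> = \<one>\<^bsub>R\<^esub>"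
    "\<And>i j. i < N \<Longrightarrow> j < N \<Longrightarrow> \<alpha> (i, j) \<noteq> 0"
    "\<And>i j k l. i < N \<Longrightarrow> j < N \<Longrightarrow> k < N \<Longrightarrow> l < N \<Longrightarrow>
       \<alpha> (i, j) * \<alpha> (k, l) = \<alpha> (i, l) * \<alpha> (k, j)"
    "(\<forall>a\<in>entries N. K (Y a) = cls (lin (\<lambda>u. if u = a then \<alpha> a else 0))) \<or>
     (\<forall>a\<in>entries N. K (Y a) = cls (lin (\<lambda>u. if u = tr a then \<alpha> a else 0)))"
proof -
  interpret RR: ring R by (rule is_algebraD(1)[OF alg])
  obtain h k where h: "h \<in> torus_auts q N" and k: "k \<in> generate (Aut_algebra R) (transpose_auts q N)"
    and hk: "restrict K (carrier R) = h \<otimes>\<^bsub>Aut_algebra R\<^esub> k"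
    using K by (auto simp: torus_transpose_group_def set_mult_def)
  note k' = generate_transpose[OF alg k]
  obtain A where ha: "h \<in> algebra_auts R" and A: "A \<in> carrier_mat N N" "vec_space.rank N A = 1"
    and hY: "\<And>i j. i < N \<Longrightarrow> j < N \<Longrightarrow> A $$ (i, j) \<noteq> 0 \<and> h (qmat_gen q N i j) = A $$ (i, j) \<odot>\<^bsub>R\<^esub> qmat_gen q N i j"
    using h by (auto simp: torus_auts_def)
  have Kr: "K r = h (k r)" if "r \<in> carrier R" for r
  proof -
    have "restrict K (carrier R) r = compose (carrier R) h k r"
      using hk k' ha by (simp add: Aut_algebra_simps(3))
    then show ?thesis using that by (simp add: compose_def)
  qed
  have one: "K \<one>\<^bsub>R\<^esub> = \<one>\<^bsub>R\<^esub>"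
    using Kr algebra_autsD(3)[OF ha] algebra_autsD(3)[OF k'[THEN conjunct1]] by simp
  have Yc: "Y a \<in> carrier R" if "a \<in> entries N" for a using that by (auto simp: Y_cls)
  have hY': "h (Y a) = cls (lin (\<lambda>u. if u = a then A $$ a else 0))" if "a \<in> entries N" for a
    using hY[of "fst a" "snd a"] that
    by (auto simp: lin_single R_smult smult_single Y_cls[of "(fst a, snd a)", simplified])
  note minor = rank_one_minor[OF A]
  from k' consider "\<forall>a\<in>entries N. k (Y a) = Y a" | "\<forall>a\<in>entries N. k (Y a) = Y (tr a)" by blast
  then show thesis
  proof cases
    case 1
    then show thesis
      using hY' Kr Yc hY minor by (intro that[of "\<lambda>a. A $$ a"] one) auto
  next
    case 2
    have "K (Y a) = cls (lin (\<lambda>u. if u = tr a then A $$ tr a else 0))" if "a \<in> entries N" for a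
      using 2 hY'[of "tr a"] Kr[OF Yc[OF that]] that by auto
    then show thesis
      using hY minor by (intro that[of "\<lambda>a. A $$ tr a"] one) (auto simp: mult.commute)
  qed
qed

end

section \<open>Actions of bosonizations\<close>

lemma (in presentation) relation_eq:
  assumes "f - g \<in> rels" "wd g"
  shows "cls f = cls g"
proof -
  have wd: "wd (f - g)" using rels assms(1) by (auto simp: wd_def)
  have "cls f = cls (f - g) \<oplus>\<^bsub>P\<^esub> cls g" using wd assms(2) by (simp add: cls_add)
  also have "\<dots> = cls (0 + g)" using cls_relation[OF assms(1)] assms(2) by (simp add: cls_zero cls_add)
  finally show ?thesis by simp
qed

lemma bos_presentation:
  fixes g :: "nat \<Rightarrow> 'g" and \<chi> :: "nat \<Rightarrow> 'g \<Rightarrow> 'k::field"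
  assumes "Group.monoid G"
  shows "presentation (bos_gens G \<theta>) (bos_relations G \<theta> g \<chi>)"
proof
  have keys: "Poly_Mapping.keys (Poly_Mapping.single x c - Poly_Mapping.single y d) \<subseteq> {x, y}"
    for x y :: "'g bos_gen list" and c d :: 'k
    by (auto simp: in_keys_iff lookup_minus lookup_single when_def split: if_splits)
  have gens: "Grp a \<in> bos_gens G \<theta>" if "a \<in> carrier G" for a using that by (simp add: bos_gens_def)
  have skews: "Skew i \<in> bos_gens G \<theta>" if "i < \<theta>" for i using that by (simp add: bos_gens_def)
  show "bos_relations G \<theta> g \<chi> \<subseteq> {f. Poly_Mapping.keys f \<subseteq> lists (bos_gens G \<theta>)}"
    unfolding bos_relations_def
    by (intro subsetI CollectI, elim UnE CollectE exE conjE singletonE)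
      (use gens skews assms in \<open>auto dest!: keys[THEN subsetD] simp: monoid.m_closed monoid.one_closed in_set_replicate split: if_splits\<close>)
qed

locale bosonization_action =
  fixes G :: "'g monoid" and \<theta> :: nat and g :: "nat \<Rightarrow> 'g" and \<chi> :: "nat \<Rightarrow> 'g \<Rightarrow> 'k::field"
    and H :: "('k, ('g bos_gen list \<Rightarrow>\<^sub>0 'k) set) hopf"
    and R :: "('k, 'r, 'n) module_scheme" and act :: "('g bos_gen list \<Rightarrow>\<^sub>0 'k) set \<Rightarrow> 'r \<Rightarrow> 'r"
  assumes datum: "qls_datum G \<theta> g \<chi>" and bos: "is_bosonization G \<theta> g \<chi> H"
    and ma: "module_algebra H R act"
begin

lemma monoid_G: "Group.monoid G"
  using datum by (auto simp: qls_datum_def intro: comm_group.axioms group.is_monoid)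

sublocale B: presentation "bos_gens G \<theta>" "bos_relations G \<theta> g \<chi>"
  by (rule bos_presentation[OF monoid_G])

abbreviation grp where "grp \<equiv> bos_grp G \<theta> g \<chi>"
abbreviation skew where "skew \<equiv> bos_skew G \<theta> g \<chi>"

text \<open>
  The bosonization carries the operations of the presented algebra on the same carrier, so identities
  between the generators can be checked there.
\<close>

lemma H_simps:
  "carrier H = carrier B.P" "monoid.mult H = monoid.mult B.P" "\<one>\<^bsub>H\<^esub> = \<one>\<^bsub>B.P\<^esub>"
  "module.smult H = module.smult B.P"
proof -
  have t: "module.truncate H = B.P" using bos by (simp add: is_bosonization_def bos_algebra_def)
  show "carrier H = carrier B.P" "monoid.mult H = monoid.mult B.P" "\<one>\<^bsub>H\<^esub> = \<one>\<^bsub>B.P\<^esub>"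
    "module.smult H = module.smult B.P"
    unfolding t [symmetric] by (simp_all add: module.truncate_def)
qed

lemma grp_cls: "grp h = B.cls (Poly_Mapping.single [Grp h] 1)"
  by (simp add: bos_grp_def B.generator_cls)

lemma skew_cls: "skew i = B.cls (Poly_Mapping.single [Skew i] 1)"
  by (simp add: bos_skew_def B.generator_cls)

lemma gens: "h \<in> carrier G \<Longrightarrow> Grp h \<in> bos_gens G \<theta>" "i < \<theta> \<Longrightarrow> Skew i \<in> bos_gens G \<theta>"
  by (simp_all add: bos_gens_def)

lemma wd_gens:
  "h \<in> carrier G \<Longrightarrow> B.wd (Poly_Mapping.single [Grp h] 1)" "i < \<theta> \<Longrightarrow> B.wd (Poly_Mapping.single [Skew i] 1)"
  by (simp_all add: gens)

lemma g_closed: "i < \<theta> \<Longrightarrow> g i \<in> carrier G"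
  using datum by (simp add: qls_datum_def)

lemma grp_closed: "h \<in> carrier G \<Longrightarrow> grp h \<in> carrier H"
  and skew_closed: "i < \<theta> \<Longrightarrow> skew i \<in> carrier H"
  using wd_gens by (simp_all only: H_simps grp_cls skew_cls B.cls_closed)

lemma grp_skew:
  assumes h: "h \<in> carrier G" and i: "i < \<theta>"
  shows "grp h \<otimes>\<^bsub>H\<^esub> skew i = \<chi> i h \<odot>\<^bsub>H\<^esub> (skew i \<otimes>\<^bsub>H\<^esub> grp h)"
proof -
  have "Poly_Mapping.single [Grp h, Skew i] 1 - Poly_Mapping.single [Skew i, Grp h] (\<chi> i h) \<in> bos_relations G \<theta> g \<chi>"
    using h i unfolding bos_relations_def by blast
  moreover have "B.wd (Poly_Mapping.single [Skew i, Grp h] c)" for c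
    using h i by (simp add: gens)
  ultimately show ?thesis
    using wd_gens(1)[OF h] wd_gens(2)[OF i] B.relation_eq
    by (simp add: H_simps grp_cls skew_cls B.cls_mult B.cls_smult monoid_algebra_mult_single smult_single del: B.wd_single)
qed

lemma skew_skew:
  assumes i: "i < \<theta>" and j: "j < \<theta>" and ij: "i \<noteq> j"
  shows "skew i \<otimes>\<^bsub>H\<^esub> skew j = \<chi> j (g i) \<odot>\<^bsub>H\<^esub> (skew j \<otimes>\<^bsub>H\<^esub> skew i)"
proof -
  have "Poly_Mapping.single [Skew i, Skew j] 1 - Poly_Mapping.single [Skew j, Skew i] (\<chi> j (g i)) \<in> bos_relations G \<theta> g \<chi>"
    using i j ij unfolding bos_relations_def by blast
  moreover have "B.wd (Poly_Mapping.single [Skew j, Skew i] c)" for c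
    using i j by (simp add: gens)
  ultimately show ?thesis
    using wd_gens(2)[OF i] wd_gens(2)[OF j] B.relation_eq
    by (simp add: H_simps skew_cls B.cls_mult B.cls_smult monoid_algebra_mult_single smult_single del: B.wd_single)
qed

lemma algebras: "is_algebra H" "is_algebra R"
  using bos ma by (auto simp: is_bosonization_def hopf_algebra_def module_algebra_def)

lemma act_linear: "h \<in> carrier H \<Longrightarrow> act h \<in> linear_maps R R"
  and act_linear': "r \<in> carrier R \<Longrightarrow> (\<lambda>h. act h r) \<in> linear_maps H R"
  and act_one: "r \<in> carrier R \<Longrightarrow> act \<one>\<^bsub>H\<^esub> r = r"
  and act_mult: "h \<in> carrier H \<Longrightarrow> h' \<in> carrier H \<Longrightarrow> r \<in> carrier R \<Longrightarrow> act (h \<otimes>\<^bsub>H\<^esub> h') r = act h (act h' r)"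
  and act_prod: "h \<in> carrier H \<Longrightarrow> r \<in> carrier R \<Longrightarrow> s \<in> carrier R \<Longrightarrow>
    act h (r \<otimes>\<^bsub>R\<^esub> s) = tensor_lift R (\<lambda>a b. act a r \<otimes>\<^bsub>R\<^esub> act b s) (comult H h)"
  using ma by (auto simp: module_algebra_def)

lemma act_grp_skew:
  assumes h: "h \<in> carrier G" and i: "i < \<theta>" and r: "r \<in> carrier R"
  shows "act (grp h) (act (skew i) r) = \<chi> i h \<odot>\<^bsub>R\<^esub> act (skew i) (act (grp h) r)"
proof -
  interpret HR: ring H by (rule is_algebraD(1)[OF algebras(1)])
  have c: "grp h \<in> carrier H" "skew i \<in> carrier H" using grp_closed[OF h] skew_closed[OF i] by auto
  then show ?thesis
    using act_mult[OF c r] act_mult[OF c(2,1) r] grp_skew[OF h i] linear_mapsD(3)[OF act_linear'[OF r]] by simp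
qed

lemma act_skew_skew:
  assumes i: "i < \<theta>" and j: "j < \<theta>" and ij: "i \<noteq> j" and r: "r \<in> carrier R"
  shows "act (skew i) (act (skew j) r) = \<chi> j (g i) \<odot>\<^bsub>R\<^esub> act (skew j) (act (skew i) r)"
proof -
  interpret HR: ring H by (rule is_algebraD(1)[OF algebras(1)])
  have c: "skew i \<in> carrier H" "skew j \<in> carrier H" using skew_closed[OF i] skew_closed[OF j] by auto
  then show ?thesis
    using act_mult[OF c r] act_mult[OF c(2,1) r] skew_skew[OF i j ij] linear_mapsD(3)[OF act_linear'[OF r]] by simp
qed

text \<open>
  This is the coproduct \<open>\<Delta>(x\<^sub>i) = g\<^sub>i \<otimes> x\<^sub>i + x\<^sub>i \<otimes> 1\<close>, translated by the module algebra axiom.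
\<close>

lemma act_skew_leibniz:
  assumes i: "i < \<theta>" and r: "r \<in> carrier R" and s: "s \<in> carrier R"
  shows "act (skew i) (r \<otimes>\<^bsub>R\<^esub> s) = act (grp (g i)) r \<otimes>\<^bsub>R\<^esub> act (skew i) s \<oplus>\<^bsub>R\<^esub> act (skew i) r \<otimes>\<^bsub>R\<^esub> s"
proof -
  interpret HR: ring H by (rule is_algebraD(1)[OF algebras(1)])
  interpret RR: ring R by (rule is_algebraD(1)[OF algebras(2)])
  note lr = linear_mapsD[OF act_linear'[OF r]] and ls = linear_mapsD[OF act_linear'[OF s]]
  interpret bilinear_map H R "\<lambda>a b. act a r \<otimes>\<^bsub>R\<^esub> act b s"
    by (rule bilinear_map.intro)
       (use algebras lr ls is_algebraD(3,4)[OF algebras(2)] in \<open>auto simp: RR.l_distr RR.r_distr\<close>)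
  have c: "grp (g i) \<in> carrier H" "skew i \<in> carrier H" using grp_closed[OF g_closed[OF i]] skew_closed[OF i] by auto
  have "comult H (skew i) = pure_tensor H H (grp (g i)) (skew i) \<oplus>\<^bsub>tensor H H\<^esub> pure_tensor H H (skew i) \<one>\<^bsub>H\<^esub>"
    using bos i by (simp add: is_bosonization_def)
  then show ?thesis
    using act_prod[OF c(2) r s] tensor_lift_pure_add[OF c(1,2,2) HR.one_closed] act_one[OF s] by simp
qed

lemma chi_nonzero: "i < \<theta> \<Longrightarrow> h \<in> carrier G \<Longrightarrow> \<chi> i h \<noteq> 0"
  using datum by (auto simp: qls_datum_def hom_def mult_of_def)

lemma chi_inverse:
  assumes i: "i < \<theta>" and j: "j < \<theta>" and ij: "i \<noteq> j"
  shows "\<chi> j (g i) * \<chi> i (g j) = 1"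
proof -
  have eq: "\<chi> j (g i) = inverse (\<chi> i (g j))"
    using datum i j ij unfolding qls_datum_def by metis
  show ?thesis unfolding eq by (rule left_inverse[OF chi_nonzero[OF i g_closed[OF j]]])
qed

text \<open>
  Otherwise the order of \<open>\<chi>\<^sub>i(g\<^sub>i)\<close> divides 2, and being at least 2 it equals 2.
\<close>

lemma chi_square:
  assumes i: "i < \<theta>" and "qls_order g \<chi> i \<noteq> 2"
  shows "\<chi> i (g i) * \<chi> i (g i) \<noteq> 1"
proof
  assume sq: "\<chi> i (g i) * \<chi> i (g i) = 1"
  let ?M = "mult_of (class_ring :: 'k ring)"
  interpret M: group ?M
  proof (rule groupI)
    show "\<exists>y\<in>carrier ?M. y \<otimes>\<^bsub>?M\<^esub> x = \<one>\<^bsub>?M\<^esub>" if "x \<in> carrier ?M" for x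
      using that by (intro bexI[of _ "inverse x"]) (auto simp: mult_of_def)
  qed (auto simp: mult_of_def)
  have "\<chi> i (g i) \<in> carrier ?M" using chi_nonzero[OF i g_closed[OF i]] by (simp add: mult_of_def)
  moreover have "\<chi> i (g i) [^]\<^bsub>?M\<^esub> (2::nat) = \<one>\<^bsub>?M\<^esub>"
    using sq by (simp add: numeral_2_eq_2 mult_of_def nat_pow_def)
  ultimately have "qls_order g \<chi> i dvd 2" unfolding qls_order_def using M.pow_eq_id by blast
  moreover have "2 \<le> qls_order g \<chi> i" using datum i by (simp add: qls_datum_def)
  ultimately show False using assms(2) by (auto dest: dvd_imp_le)
qed

end

section \<open>The bound\<close>

text \<open>
  A generator that kills all \<open>Y\<^sub>a\<close> kills the whole algebra. Hence \<open>x\<^sub>i\<close> has a nonzero coefficient, and this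
  rules out that \<open>g\<^sub>i\<close> involves the transposition.
\<close>

lemma skew_derivation_moves:
  fixes q :: "'k::field" and act :: "('g bos_gen list \<Rightarrow>\<^sub>0 'k) set \<Rightarrow> _"
  assumes BA: "bosonization_action G \<theta> g \<chi> H (quantum_matrices q N) act"
    and q: "q \<noteq> 0" "q * q \<noteq> 1" and N3: "3 \<le> N"
    and i: "i < \<theta>" and ord: "qls_order g \<chi> i \<noteq> 2"
    and K: "restrict (act (bos_grp G \<theta> g \<chi> (g i))) (carrier (quantum_matrices q N)) \<in> torus_transpose_group q N"
    and lin: "acts_linearly_nonzero q N (act (bos_skew G \<theta> g \<chi> i))"
  shows "\<exists>\<alpha> x. torus_skew q (\<chi> i (g i)) N \<alpha> x \<and>
     (\<forall>a\<in>entries N. act (bos_grp G \<theta> g \<chi> (g i)) (qmat_gen q N (fst a) (snd a)) =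
        presentation.cls (entries N) (qmat_relations q N) (qmat.lin N (\<lambda>u. if u = a then \<alpha> a else 0))) \<and>
     (\<forall>a\<in>entries N. act (bos_skew G \<theta> g \<chi> i) (qmat_gen q N (fst a) (snd a)) =
        presentation.cls (entries N) (qmat_relations q N) (qmat.lin N (x a))) \<and>
     (\<exists>a\<in>entries N. \<exists>c\<in>entries N. x a c \<noteq> 0)"
proof -
  interpret Q: qmat q N .
  interpret BA: bosonization_action G \<theta> g \<chi> H Q.R act by (rule BA)
  note alg = BA.algebras(2)
  define k where "k = act (BA.grp (g i))"
  define \<xi> where "\<xi> = act (BA.skew i)"
  have k_lin: "k \<in> linear_maps Q.R Q.R"
    unfolding k_def by (rule BA.act_linear[OF BA.grp_closed[OF BA.g_closed[OF i]]])
  have \<xi>_lin: "\<xi> \<in> linear_maps Q.R Q.R"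
    unfolding \<xi>_def by (rule BA.act_linear[OF BA.skew_closed[OF i]])
  have leib: "\<xi> (r \<otimes>\<^bsub>Q.R\<^esub> s) = k r \<otimes>\<^bsub>Q.R\<^esub> \<xi> s \<oplus>\<^bsub>Q.R\<^esub> \<xi> r \<otimes>\<^bsub>Q.R\<^esub> s"
    if "r \<in> carrier Q.R" "s \<in> carrier Q.R" for r s
    unfolding \<xi>_def k_def by (rule BA.act_skew_leibniz[OF i that])
  have comm: "k (\<xi> r) = \<chi> i (g i) \<odot>\<^bsub>Q.R\<^esub> \<xi> (k r)" if "r \<in> carrier Q.R" for r
    unfolding \<xi>_def k_def by (rule BA.act_grp_skew[OF BA.g_closed[OF i] i that])
  note lam = BA.chi_square[OF i ord]
  have "\<exists>f. \<xi> (Q.Y a) = Q.cls (Q.lin f)" if "a \<in> entries N" for a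
  proof (rule Q.span_lin[OF alg])
    show "\<xi> (Q.Y a) \<in> linear_span Q.R {qmat_gen q N i j | i j. i < N \<and> j < N}"
      using lin Q.Y_in_span[OF alg that] unfolding acts_linearly_nonzero_def Let_def \<xi>_def by blast
  qed
  then obtain x where x: "\<And>a. a \<in> entries N \<Longrightarrow> \<xi> (Q.Y a) = Q.cls (Q.lin (x a))" by metis
  have K': "restrict k (carrier Q.R) \<in> torus_transpose_group q N" using K by (simp add: k_def)
  obtain \<alpha> where one: "k \<one>\<^bsub>Q.R\<^esub> = \<one>\<^bsub>Q.R\<^esub>"
    and al0: "\<And>i j. i < N \<Longrightarrow> j < N \<Longrightarrow> \<alpha> (i, j) \<noteq> 0"
    and minor: "\<And>i j k l. i < N \<Longrightarrow> j < N \<Longrightarrow> k < N \<Longrightarrow> l < N \<Longrightarrow>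
       \<alpha> (i, j) * \<alpha> (k, l) = \<alpha> (i, l) * \<alpha> (k, j)"
    and cases: "(\<forall>a\<in>entries N. k (Q.Y a) = Q.cls (Q.lin (\<lambda>u. if u = a then \<alpha> a else 0))) \<or>
     (\<forall>a\<in>entries N. k (Q.Y a) = Q.cls (Q.lin (\<lambda>u. if u = tr a then \<alpha> a else 0)))"
    by (rule Q.torus_transpose_cases[OF alg K']) blast
  have nonzero: "\<exists>a\<in>entries N. \<exists>c\<in>entries N. x a c \<noteq> 0"
  proof (rule ccontr)
    assume none: "\<not> ?thesis"
    have "Q.lin (x a) = 0" if a: "a \<in> entries N" for a
    proof -
      have "Q.lin (x a) = Q.lin (\<lambda>_. 0)" by (rule Q.lin_cong) (use none a in blast)
      then show ?thesis by (simp add: Q.lin_def)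
    qed
    then have "\<xi> (Q.Y a) = \<zero>\<^bsub>Q.R\<^esub>" if "a \<in> entries N" for a using that by (simp add: x Q.R_zero)
    then have "\<xi> r = \<zero>\<^bsub>Q.R\<^esub>" if "r \<in> carrier Q.R" for r
      using Q.skew_derivation_zero[OF alg linear_mapsD(1)[OF k_lin] one \<xi>_lin _ leib that] by blast
    then show False using lin by (auto simp: acts_linearly_nonzero_def Let_def \<xi>_def)
  qed
  from cases show ?thesis
  proof
    assume k: "\<forall>a\<in>entries N. k (Q.Y a) = Q.cls (Q.lin (\<lambda>u. if u = a then \<alpha> a else 0))"
    have "torus_skew q (\<chi> i (g i)) N \<alpha> x"
    proof
      show "skew_derivation q N (\<lambda>a u. if u = a then \<alpha> a else 0) x"
        by (rule Q.skew_derivation_coefficients[OF _ \<xi>_lin x leib]) (use k in auto)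
      fix i' j' k' l' assume b: "i' < N" "j' < N" "k' < N" "l' < N" and ne: "x (i', j') (k', l') \<noteq> 0"
      have "(\<Sum>c\<in>entries N. x (i', j') c * (if (k', l') = c then \<alpha> c else 0)) =
          \<chi> i (g i) * (\<Sum>c\<in>entries N. (if c = (i', j') then \<alpha> (i', j') else 0) * x c (k', l'))"
        using Q.commutation_coefficients[OF k_lin _ \<xi>_lin x comm, of "\<lambda>a u. if u = a then \<alpha> a else 0" "(i', j')" "(k', l')"]
          k b by auto
      then have "x (i', j') (k', l') * \<alpha> (k', l') = \<chi> i (g i) * (\<alpha> (i', j') * x (i', j') (k', l'))"
        using b by (simp add: if_distrib[where f = "\<lambda>t. _ * t"] if_distrib[where f = "\<lambda>t. t * _"]
            sum.delta sum.delta' cong: if_cong)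
      then show "\<alpha> (k', l') = \<chi> i (g i) * \<alpha> (i', j')" using ne by (simp add: mult_ac)
    qed (use q lam N3 al0 minor in auto)
    then show ?thesis using k x nonzero unfolding k_def \<xi>_def by blast
  next
    assume k: "\<forall>a\<in>entries N. k (Q.Y a) = Q.cls (Q.lin (\<lambda>u. if u = tr a then \<alpha> a else 0))"
    have sd: "skew_derivation q N (\<lambda>a u. if u = tr a then \<alpha> a else 0) x"
      by (rule Q.skew_derivation_coefficients[OF _ \<xi>_lin x leib]) (use k in auto)
    have eig: "x (i', j') (k', l') * \<alpha> (k', l') = \<chi> i (g i) * \<alpha> (i', j') * x (j', i') (l', k')"
      if b: "i' < N" "j' < N" "k' < N" "l' < N" for i' j' k' l'
    proof -
      have "(\<Sum>c\<in>entries N. x (i', j') c * (if (l', k') = tr c then \<alpha> c else 0)) =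
          \<chi> i (g i) * (\<Sum>c\<in>entries N. (if c = tr (i', j') then \<alpha> (i', j') else 0) * x c (l', k'))"
        using Q.commutation_coefficients[OF k_lin _ \<xi>_lin x comm, of "\<lambda>a u. if u = tr a then \<alpha> a else 0" "(i', j')" "(l', k')"]
          k b by auto
      moreover have "(l', k') = tr c \<longleftrightarrow> (k', l') = c" for c by (cases c) auto
      ultimately show ?thesis
        using b by (simp add: if_distrib[where f = "\<lambda>t. _ * t"] if_distrib[where f = "\<lambda>t. t * _"]
            sum.delta sum.delta' cong: if_cong)
    qed
    have "x (i', j') (k', l') = 0" if "i' < N" "j' < N" "k' < N" "l' < N" for i' j' k' l'
      using transpose_skew_zero[OF q(1) lam N3 al0 eig sd that] .
    then show ?thesis using nonzero by auto
  qed
qed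

theorem theorem4p18:
  fixes q :: "'k::{alg_closed_field, field_char_0}"
    and N \<theta> :: nat
    and G :: "'g monoid"
    and g :: "nat \<Rightarrow> 'g"
    and \<chi> :: "nat \<Rightarrow> 'g \<Rightarrow> 'k"
    and H :: "('k, ('g bos_gen list \<Rightarrow>\<^sub>0 'k) set) hopf"
    and act :: "('g bos_gen list \<Rightarrow>\<^sub>0 'k) set
      \<Rightarrow> ((nat \<times> nat) list \<Rightarrow>\<^sub>0 'k) set \<Rightarrow> ((nat \<times> nat) list \<Rightarrow>\<^sub>0 'k) set"
  assumes "q \<noteq> 0" and "q \<noteq> 1" and "q \<noteq> - 1"
    and "qls_datum G \<theta> g \<chi>"
    and "\<forall>i<\<theta>. qls_order g \<chi> i \<noteq> 2"
    and "is_bosonization G \<theta> g \<chi> H"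
    and "N \<ge> 3"
    and "module_algebra H (quantum_matrices q N) act"
    and "\<forall>i<\<theta>. restrict (act (bos_grp G \<theta> g \<chi> (g i))) (carrier (quantum_matrices q N))
           \<in> torus_transpose_group q N"
    and "\<forall>i<\<theta>. acts_linearly_nonzero q N (act (bos_skew G \<theta> g \<chi> i))"
  shows "\<theta> \<le> 2 * N - 2"
proof -
  interpret Q: qmat q N .
  interpret BA: bosonization_action G \<theta> g \<chi> H Q.R act by unfold_locales (fact assms)+
  have q2: "q * q \<noteq> 1" using assms(2,3) by (simp add: square_eq_1_iff)
  define k where "k = (\<lambda>i. act (BA.grp (g i)))"
  define \<xi> where "\<xi> = (\<lambda>i. act (BA.skew i))"
  define moves where "moves = (\<lambda>i \<alpha> x. torus_skew q (\<chi> i (g i)) N \<alpha> x \<and>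
     (\<forall>a\<in>entries N. k i (Q.Y a) = Q.cls (Q.lin (\<lambda>u. if u = a then \<alpha> a else 0))) \<and>
     (\<forall>a\<in>entries N. \<xi> i (Q.Y a) = Q.cls (Q.lin (x a))) \<and>
     (\<exists>a\<in>entries N. \<exists>c\<in>entries N. x a c \<noteq> 0))"
  have "\<exists>\<alpha> x. moves i \<alpha> x" if "i < \<theta>" for i
    unfolding moves_def k_def \<xi>_def
    by (rule skew_derivation_moves[OF BA.bosonization_action_axioms assms(1) q2 assms(7) that])
       (use assms that in auto)
  then obtain \<alpha> x where moves: "\<And>i. i < \<theta> \<Longrightarrow> moves i (\<alpha> i) (x i)" by metis
  have ts: "torus_skew q (\<chi> i (g i)) N (\<alpha> i) (x i)" if "i < \<theta>" for i
    using moves[OF that] by (simp add: moves_def)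
  have k: "k i (Q.Y a) = Q.cls (Q.lin (\<lambda>u. if u = a then \<alpha> i a else 0))" if "i < \<theta>" "a \<in> entries N" for i a
    using moves[OF that(1)] that(2) unfolding moves_def by blast
  have x: "\<xi> i (Q.Y a) = Q.cls (Q.lin (x i a))" if "i < \<theta>" "a \<in> entries N" for i a
    using moves[OF that(1)] that(2) unfolding moves_def by blast
  have nz: "\<exists>a\<in>entries N. \<exists>c\<in>entries N. x i a c \<noteq> 0" if "i < \<theta>" for i
    using moves[OF that] unfolding moves_def by blast
  have k_lin: "k i \<in> linear_maps Q.R Q.R" if "i < \<theta>" for i
    unfolding k_def by (rule BA.act_linear[OF BA.grp_closed[OF BA.g_closed[OF that]]])
  have \<xi>_lin: "\<xi> i \<in> linear_maps Q.R Q.R" if "i < \<theta>" for i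
    unfolding \<xi>_def by (rule BA.act_linear[OF BA.skew_closed[OF that]])
  have eig: "\<alpha> i c = \<chi> j (g i) * \<alpha> i a"
    if ij: "i < \<theta>" "j < \<theta>" and ac: "a \<in> entries N" "c \<in> entries N" and ne: "x j a c \<noteq> 0" for i j a c
  proof -
    have comm: "k i (\<xi> j r) = \<chi> j (g i) \<odot>\<^bsub>Q.R\<^esub> \<xi> j (k i r)" if "r \<in> carrier Q.R" for r
      unfolding k_def \<xi>_def by (rule BA.act_grp_skew[OF BA.g_closed[OF ij(1)] ij(2) that])
    have "(\<Sum>d\<in>entries N. x j a d * (if c = d then \<alpha> i d else 0)) =
        \<chi> j (g i) * (\<Sum>d\<in>entries N. (if d = a then \<alpha> i a else 0) * x j d c)"
      using Q.commutation_coefficients[OF k_lin[OF ij(1)] k[OF ij(1)] \<xi>_lin[OF ij(2)] x[OF ij(2)] comm ac] .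
    then have "x j a c * \<alpha> i c = \<chi> j (g i) * (\<alpha> i a * x j a c)"
      using ac by (simp add: if_distrib[where f = "\<lambda>t. _ * t"] if_distrib[where f = "\<lambda>t. t * _"]
            sum.delta sum.delta' cong: if_cong)
    then show ?thesis using ne by (simp add: mult_ac)
  qed
  have pair: "torus_skew_pair q (\<chi> i (g i)) (\<chi> j (g j)) N (\<alpha> i) (\<alpha> j) (x i) (x j) (\<chi> j (g i)) (\<chi> i (g j))"
    if ij: "i < \<theta>" "j < \<theta>" "i \<noteq> j" for i j
  proof (intro torus_skew_pair.intro ts ij torus_skew_pair_axioms.intro)
    show "\<chi> j (g i) * \<chi> i (g j) = 1" by (rule BA.chi_inverse[OF ij])
    show "(\<Sum>c\<in>entries N. x j a c * x i c d) = \<chi> j (g i) * (\<Sum>c\<in>entries N. x i a c * x j c d)"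
      if "a \<in> entries N" "d \<in> entries N" for a d
    proof (rule Q.commutation_coefficients[OF \<xi>_lin[OF ij(1)] x[OF ij(1)] \<xi>_lin[OF ij(2)] x[OF ij(2)] _ that])
      show "\<xi> i (\<xi> j r) = \<chi> j (g i) \<odot>\<^bsub>Q.R\<^esub> \<xi> j (\<xi> i r)" if "r \<in> carrier Q.R" for r
        unfolding \<xi>_def by (rule BA.act_skew_skew[OF ij that])
    qed
  qed (use eig ij in auto)
  have "\<exists>s\<in>UNIV \<times> {..<N - 1}. slot q (\<chi> i (g i)) N (\<alpha> i) (x i) s" if "i < \<theta>" for i
    using torus_skew.move_slot[OF ts[OF that]] nz[OF that] by blast
  then obtain s where s: "\<And>i. i < \<theta> \<Longrightarrow> s i \<in> UNIV \<times> {..<N - 1}"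
    "\<And>i. i < \<theta> \<Longrightarrow> slot q (\<chi> i (g i)) N (\<alpha> i) (x i) (s i)" by metis
  have "inj_on s {..<\<theta>}"
  proof (rule inj_onI, rule ccontr)
    fix i j assume "i \<in> {..<\<theta>}" "j \<in> {..<\<theta>}" "s i = s j" "i \<noteq> j"
    then show False
      using torus_skew_pair.slot_conflict[OF pair[of i j], of "s i"] s(2)[of i] s(2)[of j] by simp
  qed
  then have "card {..<\<theta>} \<le> card ((UNIV :: bool set) \<times> {..<N - 1})"
  proof (rule card_inj_on_le)
    show "s ` {..<\<theta>} \<subseteq> UNIV \<times> {..<N - 1}" using s(1) by blast
  qed simp
  then show ?thesis by (simp add: card_cartesian_product)
qed

end
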